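(* Let $\mathcal T$ be a regular linear tessellation with activities $\pi_l\in(0,1)$, $D$ a window, $k\ge2$ the number of colours and $\alpha_V\in[0,1]$. The partition function $$\mathcal Z[\Phi_D]=\sum_{\hat\theta\in\hat\Gamma_D(\mathcal T)}e^{-\Phi_D(\hat\theta)}\prod_{e\in E^*(\theta)}\pi_{l[e]}$$ of the consistent polygonal field $\hat{\mathcal A}_{\Phi_D}$ is given by $$\mathcal Z[\Phi_D]=k\prod_{l\in\mathcal T,\ l\cap D\ne\emptyset}(1+\pi_l)\prod_{n(l_1,l_2)\in D}\Bigl(1-\frac{\alpha_V}{k-1}\pi_{l_1}\pi_{l_2}\Bigr)^{-1},$$ where the last product is over all nodes of $\mathcal T$ in $D$.
   Context: Regular linear tessellation: a countable family $\mathcal T$ of straight lines in $\mathbb R^2$ such that no three lines of $\mathcal T$ meet at one point and every bounded set is hit by finitely many lines of $\mathcal T$. Each $l\in\mathcal T$ carries a fixed activity $\pi_l\in(0,1)$. Windows: bounded open convex sets $D\subseteq\mathbb R^2$ such that $\partial D$ contains no intersection point of two lines of $\mathcal T$ and every line of $\mathcal T$ hitting $\overline D$ meets $\partial D$ in exactly two points. $\mathcal T$ partitions $D$ into finitely many convex cells. Nodes are the intersection points $n(l_1,l_2)$ of two lines of $\mathcal T$; segments are the pieces of lines of $\mathcal T$ between consecutive nodes (possibly truncated by $\partial D$). Admissible configurations: assigning each cell a colour in $\{1,\dots,k\}$ gives a coloured planar graph $\hat\gamma$ in $\overline D$, whose underlying uncoloured graph $\gamma$ consists of all segments separating cells of different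 colours. The set $\hat\Gamma_D(\mathcal T)$ of admissible coloured polygonal configurations is the set of all coloured planar graphs with edges on lines of $\mathcal T$, interior vertices (in $D$) of degree 2, 3 or 4, boundary vertices (on $\partial D$) of degree 1, and no two adjacent faces (faces sharing an edge) of the same colour. It is in bijection with the colourings of the cells. A node lying inside a straight piece of $\gamma$ at which no other segment of $\gamma$ ends or passes is not a vertex. V-, T- and X-vertices are the interior vertices of degree 2, 3 and 4, and $N_V(\gamma),N_T(\gamma),N_X(\gamma)$ are their numbers. $E(\gamma)$ is the set of edges: maximal unions of connected collinear segments of $\gamma$ not broken by a vertex; edges are taken open. $E^*(\gamma)$ is the set of primary edges: maximal unions of connected collinear segments of $\gamma$ (possibly containing several edges because of T- or X-vertices). $l[e]$ is the line of $\mathcal T$ containing $e$. Consistent polygonal field: given $\alpha_V\in[0,1]$ put $\alpha_X=1-\alpha_V$, $\alpha_T=\frac12\bigl(1-\frac{k-2}{k-1}\alpha_X\bigr)$, $\epsilon=\frac{\alpha_V}{k-1}+\frac{k-2}{k-1}\alpha_T$, and $$\Phi_D(\hat\gamma)=-N_V(\gamma)\log\alpha_V-N_T(\gamma)\log((k-1)\alpha_T)-N_X(\gamma)\log((k-1)\alpha_X)+\mathrm{card}(E(\gamma))\log(k-1)$$ $$-\sum_{e\in E(\gamma)}\ \sum_{l\in\mathcal T,\,l\nsim e}\log(1-\epsilon\pi_l)+\sum_{n(l_1,l_2)\in\gamma}\log\Bigl(1-\frac{\alpha_V}{k-1}\pi_{l_1}\pi_{l_2}\Bigr),$$ with $0\times\infty=0$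 (so $\Phi_D$ may take the value $+\infty$). Here $l\nsim e$ means that $l$ intersects the open edge $e$ but is not collinear with it, and $n(l_1,l_2)\in\gamma$ ranges over nodes lying on edges of $\gamma$ or coinciding with vertices of $\gamma$. The consistent polygonal field $\hat{\mathcal A}_{\Phi_D}$ is the random element of $\hat\Gamma_D(\mathcal T)$ with $\mathbb P(\hat{\mathcal A}_{\Phi_D}=\hat\gamma)=e^{-\Phi_D(\hat\gamma)}\prod_{e\in E^*(\gamma)}\pi_{l[e]}/\mathcal Z[\Phi_D]$. *)

theory Defs
  imports "HOL-Analysis.Analysis"
begin

type_synonym point = "real ^ 2"

subsection \<open>Tessellations, windows, cells and segments\<close>

definition nodes :: "point set set \<Rightarrow> point set" where
  "nodes T = {x. \<exists>l\<^sub>1\<in>T. \<exists>l\<^sub>2\<in>T. l\<^sub>1 \<noteq> l\<^sub>2 \<and> x \<in> l\<^sub>1 \<inter> l\<^sub>2}"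

definition regular_linear_tessellation :: "point set set \<Rightarrow> bool" where
  "regular_linear_tessellation T \<longleftrightarrow>
     countable T \<and>
     (\<forall>l\<in>T. affine l \<and> aff_dim l = 1) \<and>
     (\<forall>l\<^sub>1\<in>T. \<forall>l\<^sub>2\<in>T. \<forall>l\<^sub>3\<in>T. l\<^sub>1 \<noteq> l\<^sub>2 \<and> l\<^sub>2 \<noteq> l\<^sub>3 \<and> l\<^sub>1 \<noteq> l\<^sub>3 \<longrightarrow> l\<^sub>1 \<inter> l\<^sub>2 \<inter> l\<^sub>3 = {}) \<and>
     (\<forall>B. bounded B \<longrightarrow> finite {l\<in>T. l \<inter> B \<noteq> {}})"

definition window :: "point set set \<Rightarrow> point set \<Rightarrow> bool" where
  "window T D \<longleftrightarrow>
     D \<noteq> {} \<and> bounded D \<and> open D \<and> convex D \<and>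
     frontier D \<inter> nodes T = {} \<and>
     (\<forall>l\<in>T. l \<inter> closure D \<noteq> {} \<longrightarrow> card (l \<inter> frontier D) = 2)"

text \<open>Segments are taken without their two endpoints, each of which is a node or a point of
  the frontier of the window. The endpoints of a segment \<open>s\<close> thus form \<open>closure s - s\<close>.\<close>

definition segments :: "point set set \<Rightarrow> point set \<Rightarrow> point set set" where
  "segments T D = (\<Union>l\<in>T. components (l \<inter> D - nodes T))"

subsection \<open>Planar graphs made of segments\<close>

text \<open>A planar graph with edges on the lines of \<open>T\<close> is represented by the set \<open>G\<close> of all segments
  it consists of. The subset of the plane it occupies is the union of the closed segments.\<close>

definition support :: "point set set \<Rightarrow> point set" where
  "support G = (\<Union>s\<in>G. closure s)"

definition segments_at :: "point set set \<Rightarrow> point \<Rightarrow> point set set" where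
  "segments_at G x = {s\<in>G. x \<in> closure s - s}"

text \<open>The number of segments at a vertex equals the number of edges at this vertex.\<close>

definition degree :: "point set set \<Rightarrow> point \<Rightarrow> nat" where
  "degree G x = card (segments_at G x)"

text \<open>A point at which exactly two segments end, both on the same line, is no vertex.\<close>

definition vertices :: "point set set \<Rightarrow> point set" where
  "vertices G = {x. segments_at G x \<noteq> {} \<and>
     \<not> (\<exists>s t. segments_at G x = {s, t} \<and> s \<noteq> t \<and> collinear (s \<union> t))}"

definition N_V :: "point set \<Rightarrow> point set set \<Rightarrow> nat" where
  "N_V D G = card {x \<in> vertices G \<inter> D. degree G x = 2}"

definition N_T :: "point set \<Rightarrow> point set set \<Rightarrow> nat" where
  "N_T D G = card {x \<in> vertices G \<inter> D. degree G x = 3}"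

definition N_X :: "point set \<Rightarrow> point set set \<Rightarrow> nat" where
  "N_X D G = card {x \<in> vertices G \<inter> D. degree G x = 4}"

text \<open>Edges do not contain their endpoints, since these are vertices.\<close>

definition edges :: "point set set \<Rightarrow> point set set \<Rightarrow> point set set" where
  "edges T G = (\<Union>l\<in>T. components (support {s\<in>G. s \<subseteq> l} - vertices G))"

definition primary_edges :: "point set set \<Rightarrow> point set set \<Rightarrow> point set set" where
  "primary_edges T G = (\<Union>l\<in>T. components (support {s\<in>G. s \<subseteq> l}))"

definition line_of :: "point set set \<Rightarrow> point set \<Rightarrow> point set" where
  "line_of T e = (THE l. l \<in> T \<and> e \<subseteq> l)"

definition faces :: "point set \<Rightarrow> point set set \<Rightarrow> point set set" where
  "faces D G = components (D - support G)"

subsection \<open>Admissible coloured polygonal configurations\<close>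

text \<open>A coloured planar graph is a pair of a graph and a colouring of its faces; the colouring is
  \<open>undefined\<close> off the faces, so that distinct pairs are distinct coloured graphs.
  Since no two adjacent faces have the same colour, a face cannot lie on both sides of an edge
  (it would be adjacent to itself); every edge therefore borders two distinct faces. This rules
  out bridges, such as an edge joining two disjoint cycles.\<close>

definition admissible_configurations ::
  "point set set \<Rightarrow> point set \<Rightarrow> nat \<Rightarrow> (point set set \<times> (point set \<Rightarrow> nat)) set" where
  "admissible_configurations T D k = {(G, c).
     G \<subseteq> segments T D \<and>
     (\<forall>x \<in> vertices G \<inter> D. degree G x \<in> {2, 3, 4}) \<and>
     (\<forall>x \<in> vertices G \<inter> frontier D. degree G x = 1) \<and>
     c \<in> faces D G \<rightarrow>\<^sub>E {1..k} \<and>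
     (\<forall>e \<in> edges T G. \<exists>F\<^sub>1\<in>faces D G. \<exists>F\<^sub>2\<in>faces D G.
        F\<^sub>1 \<noteq> F\<^sub>2 \<and> e \<subseteq> closure F\<^sub>1 \<inter> closure F\<^sub>2) \<and>
     (\<forall>F\<^sub>1\<in>faces D G. \<forall>F\<^sub>2\<in>faces D G.
        F\<^sub>1 \<noteq> F\<^sub>2 \<and> (\<exists>e \<in> edges T G. e \<subseteq> closure F\<^sub>1 \<inter> closure F\<^sub>2) \<longrightarrow> c F\<^sub>1 \<noteq> c F\<^sub>2)}"

subsection \<open>The consistent polygonal field\<close>

definition alpha_X :: "real \<Rightarrow> real" where
  "alpha_X \<alpha>\<^sub>V = 1 - \<alpha>\<^sub>V"

definition alpha_T :: "nat \<Rightarrow> real \<Rightarrow> real" where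
  "alpha_T k \<alpha>\<^sub>V = (1 - (real k - 2) / (real k - 1) * alpha_X \<alpha>\<^sub>V) / 2"

definition epsilon :: "nat \<Rightarrow> real \<Rightarrow> real" where
  "epsilon k \<alpha>\<^sub>V = \<alpha>\<^sub>V / (real k - 1) + (real k - 2) / (real k - 1) * alpha_T k \<alpha>\<^sub>V"

text \<open>\<open>ln_ereal\<close> is meant for nonnegative arguments.\<close>

definition ln_ereal :: "real \<Rightarrow> ereal" where
  "ln_ereal x = (if x = 0 then -\<infinity> else ereal (ln x))"

text \<open>\<open>exp_uminus u\<close> is \<open>e\<^sup>-\<^sup>u\<close> for \<open>u > -\<infinity>\<close>.\<close>

definition exp_uminus :: "ereal \<Rightarrow> real" where
  "exp_uminus u = (if u = \<infinity> then 0 else exp (- real_of_ereal u))"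

text \<open>As no three lines meet at one point, this is the product of the activities of the two
  lines that meet at the node \<open>x\<close>.\<close>

definition node_activity :: "point set set \<Rightarrow> (point set \<Rightarrow> real) \<Rightarrow> point \<Rightarrow> real" where
  "node_activity T \<pi> x = (\<Prod>l | l \<in> T \<and> x \<in> l. \<pi> l)"

text \<open>The convention \<open>0 \<times> \<infinity> = 0\<close> is the one of type \<open>ereal\<close>. For \<open>k \<ge> 2\<close>, \<open>\<alpha>\<^sub>V\<close> in \<open>[0,1]\<close> and
  activities in \<open>(0,1)\<close> only the \<open>N_V\<close> and \<open>N_X\<close> terms can be infinite, and then they are \<open>+\<infinity>\<close>.
  All arguments of \<open>ln\<close> are positive.\<close>

definition Phi :: "point set set \<Rightarrow> (point set \<Rightarrow> real) \<Rightarrow> point set \<Rightarrow> nat \<Rightarrow> real \<Rightarrow>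
    point set set \<times> (point set \<Rightarrow> nat) \<Rightarrow> ereal" where
  "Phi T \<pi> D k \<alpha>\<^sub>V = (\<lambda>(G, c).
     - (ereal (real (N_V D G)) * ln_ereal \<alpha>\<^sub>V)
     - ereal (real (N_T D G)) * ln_ereal ((real k - 1) * alpha_T k \<alpha>\<^sub>V)
     - ereal (real (N_X D G)) * ln_ereal ((real k - 1) * alpha_X \<alpha>\<^sub>V)
     + ereal (real (card (edges T G)) * ln (real k - 1))
     - ereal (\<Sum>e\<in>edges T G. \<Sum>l | l \<in> T \<and> l \<inter> e \<noteq> {} \<and> \<not> e \<subseteq> l. ln (1 - epsilon k \<alpha>\<^sub>V * \<pi> l))
     + ereal (\<Sum>x\<in>nodes T \<inter> support G. ln (1 - \<alpha>\<^sub>V / (real k - 1) * node_activity T \<pi> x)))"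

definition partition_function ::
  "point set set \<Rightarrow> (point set \<Rightarrow> real) \<Rightarrow> point set \<Rightarrow> nat \<Rightarrow> real \<Rightarrow> real" where
  "partition_function T \<pi> D k \<alpha>\<^sub>V =
     (\<Sum>\<theta> \<in> admissible_configurations T D k.
        exp_uminus (Phi T \<pi> D k \<alpha>\<^sub>V \<theta>) * (\<Prod>e\<in>primary_edges T (fst \<theta>). \<pi> (line_of T e)))"

end

theory Submission
  imports Defs
begin

text \<open>Admissible configurations correspond to colourings of the cells that the lines cut out of \<open>D\<close>.
  Let \<open>h\<close> be a generic strictly quasiconvex function on \<open>D\<close> that tends to infinity at the frontier,
  and sweep \<open>D\<close> by its sublevel sets. Every cell appears at its minimum of \<open>h\<close>, which is the minimum of
  \<open>h\<close> on \<open>D\<close>, the minimum of \<open>h\<close> on a line, or a node, and each of these points gives birth to exactly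
  one cell. Charge the activity of a primary edge and the factor \<open>1 / (k - 1)\<close> of an edge to the point
  where it is first met. The weight of a colouring is then a product of weights of lines and of nodes,
  and a weight involves only the cell born there and cells born earlier. Summing over the colours of
  the cells from the last one to the first one, each line contributes \<open>1 + \<pi> l\<close> and each node
  contributes the inverse of its factor, whatever the colours of the earlier cells are.\<close>

subsection \<open>Sign vectors\<close>

text \<open>The weight is stated through connected components (edges, primary edges, faces), while
  summing out colours needs local data. Sign vectors bridge the gap: closure becomes a pointwise
  comparison, crossing a line becomes a function update, and locally constant functions on connected
  sets carry local statements along an edge or a face. Convexity forces one birth per point: a
  strictly quasiconvex function has only one minimum on the closure of a region, and it cannot have
  lower points on both sides of a node along a line. So each line through a node has an incoming and
  an outgoing half, and three of the four quadrants are occupied before the node is reached. The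
  explosion at the frontier keeps all minima inside the open window. Genericity means that no line
  has its minimum at a node and that the minimum over the window lies on no line. A line contributes
  \<open>1 + \<pi> l\<close> since its far cell either copies the colour of the near cell or takes
  one of k - 1 others, each of weight \<open>\<pi> l / (k - 1)\<close>. At a node the analogous
  balance determines \<open>alpha_X\<close>, \<open>alpha_T\<close> and
  \<open>epsilon\<close>.\<close>

definition normal_form :: "point set \<Rightarrow> point \<times> real" where
  "normal_form l = (SOME p. fst p \<noteq> 0 \<and> l = {x. fst p \<bullet> x = snd p})"

text \<open>The choice in \<open>normal_form\<close> orients the line arbitrarily; the sides that
  matter later are singled out by the sweep function, not by this orientation.\<close>

definition side :: "point set \<Rightarrow> point \<Rightarrow> real" where
  "side l x = fst (normal_form l) \<bullet> x - snd (normal_form l)"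

lemma normal_form:
  assumes "affine l" "aff_dim l = 1"
  shows "fst (normal_form l) \<noteq> 0" and "l = {x. fst (normal_form l) \<bullet> x = snd (normal_form l)}"
proof -
  have "affine hull l = l" "aff_dim l = DIM(point) - 1" using assms by (auto simp: affine_hull_eq)
  then obtain a b where "a \<noteq> 0 \<and> l = {x. a \<bullet> x = b}"
    using aff_dim_eq_hyperplane[of l] by metis
  then have "\<exists>p. fst p \<noteq> 0 \<and> l = {x. fst p \<bullet> x = snd p}" by (intro exI[of _ "(a, b)"]) simp
  from someI_ex[OF this]
  have *: "fst (normal_form l) \<noteq> 0 \<and> l = {x. fst (normal_form l) \<bullet> x = snd (normal_form l)}"
    unfolding normal_form_def[symmetric] .
  show "fst (normal_form l) \<noteq> 0" by (rule conjunct1[OF *])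
  show "l = {x. fst (normal_form l) \<bullet> x = snd (normal_form l)}" by (rule conjunct2[OF *])
qed

lemma side_add: "side l (x + y) = side l x + fst (normal_form l) \<bullet> y"
  by (simp add: side_def inner_add_right)

lemma side_combination: "side l ((1 - t) *\<^sub>R x + t *\<^sub>R y) = (1 - t) * side l x + t * side l y"
  by (simp add: side_def inner_add_right algebra_simps)

lemma continuous_on_side [continuous_intros]: "continuous_on S (side l)"
  unfolding side_def[abs_def] by (intro continuous_intros)

lemma side_tendsto: "(side l \<longlongrightarrow> side l p) (nhds p)"
  using continuous_on_side[of UNIV l] by (simp add: continuous_on_def tendsto_at_iff_tendsto_nhds)

lemma affine_line_subset:
  assumes "affine l" "aff_dim l = 1" "affine m" "aff_dim m = 1" "l \<subseteq> m"
  shows "l = m"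
  using assms affine_dim_equal[of l m] by fastforce

section \<open>Sign vectors and strata in a window\<close>

locale tessellated_window =
  fixes T :: "point set set" and D :: "point set"
  assumes tessellation: "regular_linear_tessellation T" and window: "window T D"
begin

lemma D_nonempty: "D \<noteq> {}" and D_bounded: "bounded D" and D_open: "open D" and D_convex: "convex D"
  and frontier_nodes: "frontier D \<inter> nodes T = {}"
  using window by (auto simp: window_def)

lemma line: "l \<in> T \<Longrightarrow> affine l" "l \<in> T \<Longrightarrow> aff_dim l = 1"
  using tessellation by (auto simp: regular_linear_tessellation_def)

lemma normal_nonzero: "l \<in> T \<Longrightarrow> fst (normal_form l) \<noteq> 0"
  using normal_form(1) line by blast

lemma mem_line_iff: "l \<in> T \<Longrightarrow> x \<in> l \<longleftrightarrow> side l x = 0"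
  using normal_form(2)[OF line] unfolding side_def by auto

lemma line_closed: "l \<in> T \<Longrightarrow> closed l"
  using line affine_closed by blast

lemma line_subset: "l \<in> T \<Longrightarrow> m \<in> T \<Longrightarrow> l \<subseteq> m \<Longrightarrow> l = m"
  using affine_line_subset line by blast

definition lines :: "point set set" where
  "lines = {l \<in> T. l \<inter> D \<noteq> {}}"

lemma finite_lines: "finite lines"
  using tessellation D_bounded unfolding regular_linear_tessellation_def lines_def by blast

lemma lines_in_T: "l \<in> lines \<Longrightarrow> l \<in> T"
  by (simp add: lines_def)

text \<open>The value off \<open>lines\<close> is \<open>1\<close>, so that the zeros of a sign vector are lines meeting \<open>D\<close>.\<close>

definition signs :: "point \<Rightarrow> point set \<Rightarrow> real" where
  "signs p l = (if l \<in> lines then sgn (side l p) else 1)"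

lemma signs_zero_iff: "p \<in> D \<Longrightarrow> signs p l = 0 \<longleftrightarrow> l \<in> T \<and> p \<in> l"
  using mem_line_iff by (auto simp: signs_def sgn_zero_iff lines_def)

lemma signs_zero_lines: "signs p l = 0 \<Longrightarrow> l \<in> lines"
  by (auto simp: signs_def split: if_splits)

lemma signs_values: "signs p l \<in> {-1, 0, 1}"
  by (auto simp: signs_def sgn_if)

text \<open>The face order of covectors of an oriented matroid: zeros may be resolved, nonzero signs
  are kept. For sign vectors realised in \<open>D\<close> it describes the closure of a stratum, see
  \<open>below_iff\<close>.\<close>

definition le_signs :: "(point set \<Rightarrow> real) \<Rightarrow> (point set \<Rightarrow> real) \<Rightarrow> bool" (infix "\<preceq>" 50) where
  "v \<preceq> w \<longleftrightarrow> (\<forall>l. v l = 0 \<or> v l = w l)"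

definition stratum :: "(point set \<Rightarrow> real) \<Rightarrow> point set" where
  "stratum v = {q \<in> D. signs q = v}"

lemma le_signs_refl [simp]: "v \<preceq> v" by (simp add: le_signs_def)

text \<open>The absence of triple points in terms of signs: every local argument splits into the
  cases of a cell, a segment and a node.\<close>

lemma no_three_zeros:
  assumes "p \<in> D" "signs p l1 = 0" "signs p l2 = 0" "l1 \<noteq> l2" "signs p l = 0"
  shows "l = l1 \<or> l = l2"
proof (rule ccontr)
  assume *: "\<not> ?thesis"
  have T: "l1 \<in> T" "l2 \<in> T" "l \<in> T" and p: "p \<in> l1 \<inter> l2 \<inter> l"
    using assms by (auto simp: signs_zero_iff)
  have "\<forall>l\<^sub>1\<in>T. \<forall>l\<^sub>2\<in>T. \<forall>l\<^sub>3\<in>T. l\<^sub>1 \<noteq> l\<^sub>2 \<and> l\<^sub>2 \<noteq> l\<^sub>3 \<and> l\<^sub>1 \<noteq> l\<^sub>3 \<longrightarrow> l\<^sub>1 \<inter> l\<^sub>2 \<inter> l\<^sub>3 = {}"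
    using tessellation unfolding regular_linear_tessellation_def by (elim conjE)
  then have "l1 \<inter> l2 \<inter> l = {}" using T * \<open>l1 \<noteq> l2\<close> by metis
  then show False using p by blast
qed

lemma eventually_in_D: "p \<in> D \<Longrightarrow> eventually (\<lambda>q. q \<in> D) (nhds p)"
  using D_open by (rule eventually_nhds_in_open)

text \<open>A nonzero side keeps its sign nearby by continuity. One neighbourhood serves all lines
  because \<open>lines\<close> is finite and the signs off \<open>lines\<close> are
  constant.\<close>

lemma eventually_le_signs: "eventually (\<lambda>q. signs p \<preceq> signs q) (nhds p)"
proof -
  have "eventually (\<lambda>q. side l p \<noteq> 0 \<longrightarrow> sgn (side l q) = sgn (side l p)) (nhds p)" for l
  proof (cases "side l p" "0::real" rule: linorder_cases)
    case less
    from order_tendstoD(2)[OF side_tendsto less] less show ?thesis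
      by (auto elim: eventually_mono)
  next
    case greater
    from order_tendstoD(1)[OF side_tendsto greater] greater show ?thesis
      by (auto elim: eventually_mono)
  qed auto
  then have "eventually (\<lambda>q. \<forall>l\<in>lines. side l p \<noteq> 0 \<longrightarrow> sgn (side l q) = sgn (side l p)) (nhds p)"
    using finite_lines by (auto intro: eventually_ball_finite)
  then show ?thesis
    by (rule eventually_mono) (auto simp: le_signs_def signs_def sgn_zero_iff)
qed

text \<open>At most two lines pass through p, and two lines that meet in one point have independent
  normals, so any signs prescribed on them are attained by some direction.\<close>

lemma exists_direction:
  assumes p: "p \<in> D" and w: "\<And>l. w l \<in> {-1, 0, 1::real}"
  shows "\<exists>u. \<forall>l. signs p l = 0 \<longrightarrow> sgn (fst (normal_form l) \<bullet> u) = w l"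
proof (cases "\<exists>l1. signs p l1 = 0")
  case False
  then show ?thesis by auto
next
  case True
  then obtain l1 where l1: "signs p l1 = 0" by blast
  then have l1T: "l1 \<in> T" "p \<in> l1" using p signs_zero_iff by auto
  have sgn_w: "sgn (w l) = w l" for l using w[of l] by auto
  show ?thesis
  proof (cases "\<exists>l2. l2 \<noteq> l1 \<and> signs p l2 = 0")
    case False
    have "fst (normal_form l1) \<bullet> fst (normal_form l1) > 0" using normal_nonzero l1T by auto
    then have "sgn (fst (normal_form l1) \<bullet> (w l1 *\<^sub>R fst (normal_form l1))) = w l1"
      using sgn_w by (simp add: sgn_mult)
    then show ?thesis using False by metis
  next
    case True
    then obtain l2 where l2: "l2 \<noteq> l1" "signs p l2 = 0" by blast
    then have l2T: "l2 \<in> T" "p \<in> l2" using p signs_zero_iff by auto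
    obtain y where y: "y \<in> l1" "y \<notin> l2" using line_subset l1T l2T l2(1) by blast
    obtain z where z: "z \<in> l2" "z \<notin> l1" using line_subset l1T l2T l2(1) by blast
    \<comment> \<open>The direction \<open>y - p\<close> runs along \<open>l1\<close> and
      \<open>z - p\<close> along \<open>l2\<close>. Divided by their products with the normal of the
      other line, they form a dual basis to \<open>n2\<close> and \<open>n1\<close>.\<close>
    define n1 n2 where "n1 = fst (normal_form l1)" and "n2 = fst (normal_form l2)"
    have "n1 \<bullet> (y - p) = 0" "n2 \<bullet> (z - p) = 0" "n1 \<bullet> (z - p) \<noteq> 0" "n2 \<bullet> (y - p) \<noteq> 0"
      using y z l1T l2T mem_line_iff[OF l1T(1)] mem_line_iff[OF l2T(1)]
      by (auto simp: side_def n1_def n2_def inner_diff_right)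
    then have "n1 \<bullet> (w l2 *\<^sub>R ((y - p) /\<^sub>R (n2 \<bullet> (y - p))) + w l1 *\<^sub>R ((z - p) /\<^sub>R (n1 \<bullet> (z - p)))) = w l1"
      "n2 \<bullet> (w l2 *\<^sub>R ((y - p) /\<^sub>R (n2 \<bullet> (y - p))) + w l1 *\<^sub>R ((z - p) /\<^sub>R (n1 \<bullet> (z - p)))) = w l2"
      by (auto simp: inner_add_right)
    then have "\<forall>l. signs p l = 0 \<longrightarrow> sgn (fst (normal_form l) \<bullet>
       (w l2 *\<^sub>R ((y - p) /\<^sub>R (n2 \<bullet> (y - p))) + w l1 *\<^sub>R ((z - p) /\<^sub>R (n1 \<bullet> (z - p))))) = w l"
      using no_three_zeros[OF p l1 l2(2) l2(1)[symmetric]] sgn_w unfolding n1_def n2_def by metis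
    then show ?thesis by blast
  qed
qed

text \<open>A short step from p in the direction of \<open>exists_direction\<close> resolves the
  zero signs as w prescribes and leaves the nonzero ones alone.\<close>

lemma realize_signs:
  assumes p: "p \<in> D" and w: "\<And>l. w l \<in> {-1, 0, 1}" and le: "signs p \<preceq> w" 
    and ev: "eventually P (nhds p)"
  shows "\<exists>q\<in>D. signs q = w \<and> P q"
proof -
  obtain u where u: "\<And>l. signs p l = 0 \<Longrightarrow> sgn (fst (normal_form l) \<bullet> u) = w l"
    using exists_direction[of p w] p w by blast
  have "((\<lambda>t. p + t *\<^sub>R u) \<longlongrightarrow> p + 0 *\<^sub>R u) (at_right 0)" by (intro tendsto_intros)
  then have lim: "filterlim (\<lambda>t. p + t *\<^sub>R u) (nhds p) (at_right 0)" by simp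
  have "eventually (\<lambda>q. q \<in> D \<and> signs p \<preceq> signs q \<and> P q) (nhds p)"
    using eventually_in_D[OF p] eventually_le_signs[of p] ev by eventually_elim auto
  from eventually_compose_filterlim[OF this lim] eventually_at_right_less[of "0::real"]
  have "eventually (\<lambda>t. 0 < t \<and> p + t *\<^sub>R u \<in> D \<and> signs p \<preceq> signs (p + t *\<^sub>R u) \<and> P (p + t *\<^sub>R u))
    (at_right 0)" by eventually_elim auto
  then obtain t where t: "0 < t" "p + t *\<^sub>R u \<in> D" "signs p \<preceq> signs (p + t *\<^sub>R u)" "P (p + t *\<^sub>R u)"
    by (metis (mono_tags, lifting) eventually_happens' trivial_limit_at_right_real)
  have "signs (p + t *\<^sub>R u) l = w l" for l
  proof (cases "signs p l = 0")
    case True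
    then have l: "l \<in> lines" "l \<in> T" "p \<in> l" using p signs_zero_iff signs_zero_lines by auto
    then have "side l p = 0" using mem_line_iff by auto
    then have "side l (p + t *\<^sub>R u) = t * (fst (normal_form l) \<bullet> u)" by (simp add: side_add)
    then show ?thesis using u[OF True] l t(1) by (simp add: signs_def sgn_mult)
  next
    case False
    then show ?thesis using t(3) le unfolding le_signs_def by metis
  qed
  then show ?thesis using t by blast
qed

lemma signs_combination:
  assumes "signs p \<preceq> signs q" "0 < t" "t \<le> 1"
  shows "signs ((1 - t) *\<^sub>R p + t *\<^sub>R q) = signs q"
proof
  fix l
  show "signs ((1 - t) *\<^sub>R p + t *\<^sub>R q) l = signs q l"
  proof (cases "l \<in> lines")
    case True
    have *: "side l p = 0 \<or> sgn (side l p) = sgn (side l q)"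
      using assms(1) True unfolding le_signs_def signs_def by (metis sgn_zero_iff)
    show ?thesis
    proof (cases "side l q" "0::real" rule: linorder_cases)
      case less
      then have "side l p \<le> 0" using * by (auto simp: sgn_if split: if_splits)
      then have "(1 - t) * side l p + t * side l q < 0" using less assms
        by (smt (verit) mult_pos_neg mult_nonneg_nonpos)
      then show ?thesis using less True by (simp add: signs_def side_combination)
    next
      case equal
      then have "side l p = 0" using * by (auto simp: sgn_zero_iff)
      then show ?thesis using equal True by (simp add: signs_def side_combination)
    next
      case greater
      then have "side l p \<ge> 0" using * by (auto simp: sgn_if split: if_splits)
      then have "(1 - t) * side l p + t * side l q > 0" using greater assms
        by (smt (verit) mult_pos_pos mult_nonneg_nonneg)
      then show ?thesis using greater True by (simp add: signs_def side_combination)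
    qed
  qed (simp add: signs_def)
qed

lemma convex_stratum: "convex (stratum v)"
  unfolding convex_alt stratum_def
proof clarsimp
  fix x y u assume *: "x \<in> D" "y \<in> D" "signs y = signs x" "v = signs x" "0 \<le> u" "u \<le> (1::real)"
  then have "signs ((1 - u) *\<^sub>R x + u *\<^sub>R y) = signs x"
    using signs_combination[of x y u] by (cases "u = 0") auto
  then show "(1 - u) *\<^sub>R x + u *\<^sub>R y \<in> D \<and> signs ((1 - u) *\<^sub>R x + u *\<^sub>R y) = signs x"
    using D_convex * unfolding convex_alt by blast
qed

text \<open>Points of the stratum come arbitrarily close to x, and by
  \<open>eventually_le_signs\<close> the signs of close points lie above those of x. The point x may
  lie on the frontier of \<open>D\<close>, where segments end.\<close>

lemma closure_stratum:
  assumes "x \<in> closure (stratum v)"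
  shows "signs x \<preceq> v"
proof -
  have "\<exists>\<^sub>F q in nhds x. q \<in> stratum v"
    using assms by (simp add: closure_iff_nhds_not_empty frequently_def eventually_nhds) blast
  then have "\<exists>\<^sub>F q in nhds x. q \<in> stratum v \<and> signs x \<preceq> signs q"
    using eventually_le_signs frequently_eventually_frequently by fastforce
  then show ?thesis by (auto simp: stratum_def dest!: frequently_ex)
qed

lemma mem_closure_stratum:
  assumes "x \<in> D" "q \<in> D" "signs x \<preceq> signs q"
  shows "x \<in> closure (stratum (signs q))"
proof (rule Lim_in_closed_set[of _ "\<lambda>t. (1 - t) *\<^sub>R x + t *\<^sub>R q" "at_right 0"])
  show "\<forall>\<^sub>F t in at_right 0. (1 - t) *\<^sub>R x + t *\<^sub>R q \<in> closure (stratum (signs q))"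
    unfolding eventually_at_right_field
  proof (intro exI[of _ 1] conjI allI impI)
    fix t :: real assume "0 < t" "t < 1"
    then have "(1 - t) *\<^sub>R x + t *\<^sub>R q \<in> stratum (signs q)"
      using assms signs_combination[of x q t] D_convex unfolding stratum_def convex_alt by auto
    then show "(1 - t) *\<^sub>R x + t *\<^sub>R q \<in> closure (stratum (signs q))" using closure_subset by blast
  qed simp
  have "((\<lambda>t. (1 - t) *\<^sub>R x + t *\<^sub>R q) \<longlongrightarrow> (1 - 0) *\<^sub>R x + 0 *\<^sub>R q) (at_right 0)"
    by (intro tendsto_intros)
  then show "((\<lambda>t. (1 - t) *\<^sub>R x + t *\<^sub>R q) \<longlongrightarrow> x) (at_right 0)" by simp
qed auto

section \<open>Cells and segments as sign vectors\<close>

definition cells :: "(point set \<Rightarrow> real) set" where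
  "cells = {v \<in> signs ` D. \<forall>l. v l \<noteq> 0}"

definition segs :: "(point set \<Rightarrow> real) set" where
  "segs = {v \<in> signs ` D. \<exists>!l. v l = 0}"

definition line_of_seg :: "(point set \<Rightarrow> real) \<Rightarrow> point set" where
  "line_of_seg v = (THE l. v l = 0)"

lemma line_of_seg: "v \<in> segs \<Longrightarrow> v l = 0 \<longleftrightarrow> l = line_of_seg v"
  using theI'[of "\<lambda>l. v l = 0"] unfolding segs_def line_of_seg_def by blast

lemma line_of_seg_lines: "v \<in> segs \<Longrightarrow> line_of_seg v \<in> lines"
  using line_of_seg[of v "line_of_seg v"] signs_zero_lines unfolding segs_def by auto

lemma finite_signs: "finite (signs ` D)"
proof -
  have "signs ` D \<subseteq> (\<lambda>g l. if l \<in> lines then g l else 1) ` (lines \<rightarrow>\<^sub>E {-1, 0, 1})"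
  proof
    fix v assume "v \<in> signs ` D"
    then obtain p where v: "v = signs p" by blast
    have "v = (\<lambda>l. if l \<in> lines then restrict v lines l else 1)"
      unfolding v by (rule ext) (auto simp: signs_def)
    moreover have "restrict v lines \<in> lines \<rightarrow>\<^sub>E {-1, 0, 1}" using signs_values unfolding v by auto
    ultimately show "v \<in> (\<lambda>g l. if l \<in> lines then g l else 1) ` (lines \<rightarrow>\<^sub>E {-1, 0, 1})" by blast
  qed
  moreover have "finite (lines \<rightarrow>\<^sub>E {-1, 0, 1::real})" using finite_lines by (intro finite_PiE) auto
  ultimately show ?thesis using finite_subset by blast
qed

lemma finite_cells: "finite cells" and finite_segs: "finite segs"
  using finite_signs unfolding cells_def segs_def by auto

lemma stratum_nonempty: "v \<in> signs ` D \<Longrightarrow> stratum v \<noteq> {}"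
  unfolding stratum_def by auto

lemma stratum_disjoint: "x \<in> stratum v \<Longrightarrow> x \<in> stratum w \<Longrightarrow> v = w"
  unfolding stratum_def by auto

lemma inj_on_stratum: "inj_on stratum (signs ` D)"
  unfolding inj_on_def using stratum_nonempty stratum_disjoint by (metis all_not_in_conv)

lemma stratum_subset_line: "v l = 0 \<Longrightarrow> stratum v \<subseteq> l"
  unfolding stratum_def using signs_zero_iff by auto

lemma nodes_iff: "x \<in> D \<Longrightarrow> x \<in> nodes T \<longleftrightarrow> (\<exists>l1 l2. l1 \<noteq> l2 \<and> signs x l1 = 0 \<and> signs x l2 = 0)"
  unfolding nodes_def by (simp add: signs_zero_iff) blast

lemma segs_iff: "p \<in> D \<Longrightarrow> l \<in> T \<Longrightarrow> p \<in> l - nodes T \<longleftrightarrow> signs p \<in> segs \<and> signs p l = 0"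
proof -
  assume *: "p \<in> D" "l \<in> T"
  then have "signs p \<in> segs \<longleftrightarrow> (\<exists>!m. signs p m = 0)" unfolding segs_def by simp
  moreover have "p \<in> l \<longleftrightarrow> signs p l = 0" using * signs_zero_iff by simp
  moreover have "p \<in> nodes T \<longleftrightarrow> (\<exists>l1 l2. l1 \<noteq> l2 \<and> signs p l1 = 0 \<and> signs p l2 = 0)"
    using * nodes_iff by simp
  ultimately show "p \<in> l - nodes T \<longleftrightarrow> signs p \<in> segs \<and> signs p l = 0" by (metis Diff_iff)
qed

text \<open>Strata are convex, hence connected. Conversely, on l off the nodes the only zero is at l
  and nearby points keep all other signs, so the sign vector is locally constant there and cannot
  change within a connected set.\<close>

lemma components_line:
  assumes l: "l \<in> T"
  shows "components (l \<inter> D - nodes T) = stratum ` {v \<in> segs. v l = 0}"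
proof -
  have *: "stratum v \<in> components (l \<inter> D - nodes T)" if v: "v \<in> segs" "v l = 0" for v
    unfolding in_components_maximal
  proof (intro conjI allI impI)
    show "stratum v \<noteq> {}" using v stratum_nonempty segs_def by auto
    show "stratum v \<subseteq> l \<inter> D - nodes T"
      using v segs_iff l unfolding stratum_def by auto
    show "connected (stratum v)" using convex_stratum convex_connected by blast
    fix d assume d: "d \<noteq> {} \<and> stratum v \<subseteq> d \<and> d \<subseteq> l \<inter> D - nodes T \<and> connected d"
    obtain p where p: "p \<in> stratum v" using \<open>stratum v \<noteq> {}\<close> by blast
    have ev: "\<forall>a\<in>d. eventually (\<lambda>b. signs a = signs b) (at a within d)"
    proof
      fix a assume a: "a \<in> d"
      then have sa: "signs a \<in> segs" "signs a l = 0" using d segs_iff l by auto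
      have "eventually (\<lambda>b. signs a \<preceq> signs b) (at a within d)"
        using eventually_le_signs by (rule filter_leD[OF at_within_le_nhds])
      moreover have "eventually (\<lambda>b. b \<in> d) (at a within d)"
        by (simp add: eventually_at_filter)
      ultimately show "eventually (\<lambda>b. signs a = signs b) (at a within d)"
      proof eventually_elim
        case (elim b)
        then have sb: "signs b l = 0" using d segs_iff l by auto
        show ?case
        proof
          fix m show "signs a m = signs b m"
            using elim(1) sb sa line_of_seg[OF sa(1)] unfolding le_signs_def by metis
        qed
      qed
    qed
    have "signs q = signs p" if "q \<in> d" for q
      using connected_local_const[of d p q signs] d ev p that by auto
    then show "d = stratum v" using d p unfolding stratum_def by auto
  qed
  show ?thesis
  proof
    show "stratum ` {v \<in> segs. v l = 0} \<subseteq> components (l \<inter> D - nodes T)" using * by blast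
    show "components (l \<inter> D - nodes T) \<subseteq> stratum ` {v \<in> segs. v l = 0}"
    proof
      fix C assume C: "C \<in> components (l \<inter> D - nodes T)"
      then obtain p where p: "p \<in> C" "p \<in> l \<inter> D - nodes T"
        using in_components_nonempty in_components_subset by blast
      then have v: "signs p \<in> segs" "signs p l = 0" using segs_iff l by auto
      have "p \<in> stratum (signs p)" using p by (simp add: stratum_def)
      then have "C = stratum (signs p)" using components_eq[OF C *[OF v]] p by blast
      then show "C \<in> stratum ` {v \<in> segs. v l = 0}" using v by blast
    qed
  qed
qed

lemma segments_eq: "segments T D = stratum ` segs"
proof -
  have "segments T D = (\<Union>l\<in>T. stratum ` {v \<in> segs. v l = 0})"
    unfolding segments_def using components_line by simp
  also have "\<dots> = stratum ` segs"
  proof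
    show "stratum ` segs \<subseteq> (\<Union>l\<in>T. stratum ` {v \<in> segs. v l = 0})"
      using line_of_seg line_of_seg_lines lines_in_T by blast
  qed blast
  finally show ?thesis .
qed

end

subsection \<open>A sweep function\<close>

lemma norm_power2_combination:
  fixes x y q :: "'a::real_inner"
  shows "(norm ((1 - t) *\<^sub>R x + t *\<^sub>R y - q))\<^sup>2 =
    (1 - t) * (norm (x - q))\<^sup>2 + t * (norm (y - q))\<^sup>2 - t * (1 - t) * (norm (x - y))\<^sup>2"
  by (simp add: power2_norm_eq_inner inner_diff_left inner_diff_right inner_add_left inner_add_right
      inner_commute algebra_simps)

text \<open>The open balls around x and y whose radii are the distances to the complement lie in
  \<open>D\<close>. By convexity so do the combinations of their points, which fill a ball around
  the combined centre.\<close>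

lemma infdist_Compl_concave:
  fixes D :: "'a::euclidean_space set"
  assumes D: "convex D" "open D" "- D \<noteq> {}" and xy: "x \<in> D" "y \<in> D" and t: "0 \<le> t" "t \<le> 1"
  shows "(1 - t) * infdist x (- D) + t * infdist y (- D) \<le> infdist ((1 - t) *\<^sub>R x + t *\<^sub>R y) (- D)"
proof (rule ccontr)
  define z where "z = (1 - t) *\<^sub>R x + t *\<^sub>R y"
  define a b where "a = infdist x (- D)" and "b = infdist y (- D)"
  define c where "c = (1 - t) * a + t * b"
  assume "\<not> ?thesis"
  then have less: "infdist z (- D) < c" by (simp add: z_def a_def b_def c_def)
  have "closed (- D)" using D by auto
  then obtain w where w: "w \<in> - D" "infdist z (- D) = dist z w"
    using infdist_attains_inf D(3) by blast
  have pos: "a > 0" "b > 0"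
    using xy D \<open>closed (- D)\<close> unfolding a_def b_def by (auto simp: infdist_pos_not_in_closed)
  have inD: "x + u \<in> D" if "norm u < a" for u
  proof (rule ccontr)
    assume "x + u \<notin> D"
    then have "a \<le> dist x (x + u)" unfolding a_def by (intro infdist_le) auto
    then show False using that by (simp add: dist_norm)
  qed
  have inD': "y + u \<in> D" if "norm u < b" for u
  proof (rule ccontr)
    assume "y + u \<notin> D"
    then have "b \<le> dist y (y + u)" unfolding b_def by (intro infdist_le) auto
    then show False using that by (simp add: dist_norm)
  qed
  have c: "c > 0" using less infdist_nonneg[of z "- D"] by linarith
  \<comment> \<open>Scaled so that \<open>z + c *\<^sub>R u = w\<close>. As w is closer to z than c,
    the norm of u is below 1, and w is a combination of points of the two balls.\<close>
  define u where "u = (w - z) /\<^sub>R c"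
  have "norm u = norm (w - z) / c" using c by (simp add: u_def divide_inverse_commute)
  then have "norm u < 1" using less w c by (simp add: dist_norm norm_minus_commute)
  then have "norm (a *\<^sub>R u) < a" "norm (b *\<^sub>R u) < b" using pos by auto
  then have "x + a *\<^sub>R u \<in> D" "y + b *\<^sub>R u \<in> D" using inD inD' by auto
  then have "(1 - t) *\<^sub>R (x + a *\<^sub>R u) + t *\<^sub>R (y + b *\<^sub>R u) \<in> D"
    using D(1) t unfolding convex_alt by blast
  also have "(1 - t) *\<^sub>R (x + a *\<^sub>R u) + t *\<^sub>R (y + b *\<^sub>R u) = z + c *\<^sub>R u"
    by (simp add: z_def c_def algebra_simps)
  also have "\<dots> = w" using c by (simp add: u_def)
  finally show False using w by simp
qed

context tessellated_window
begin

lemma lines_meet_once: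
  assumes "l \<in> T" "m \<in> T" "l \<noteq> m" "x \<in> l" "x \<in> m" "y \<in> l" "y \<in> m"
  shows "x = y"
proof (rule ccontr)
  assume "x \<noteq> y"
  then have dim: "aff_dim (affine hull {x, y}) = 1" by (simp add: aff_dim_2)
  have "affine hull {x, y} \<subseteq> l" "affine hull {x, y} \<subseteq> m"
    using assms line by (simp_all add: hull_minimal)
  then have "affine hull {x, y} = l" "affine hull {x, y} = m"
    using affine_line_subset[OF affine_affine_hull dim, of l]
      affine_line_subset[OF affine_affine_hull dim, of m] line assms by blast+
  then show False using assms by simp
qed

lemma finite_nodes: "finite (nodes T \<inter> D)"
proof (rule finite_subset)
  show "nodes T \<inter> D \<subseteq> (\<lambda>(l, m). THE x. x \<in> l \<inter> m) ` (lines \<times> lines)"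
  proof
    fix x assume x: "x \<in> nodes T \<inter> D"
    then obtain l m where lm: "l \<in> T" "m \<in> T" "l \<noteq> m" "x \<in> l \<inter> m" unfolding nodes_def by blast
    then have "(THE x. x \<in> l \<inter> m) = x" using lines_meet_once[of l m] by (intro the_equality) auto
    moreover have "l \<in> lines" "m \<in> lines" using lm x unfolding lines_def by auto
    ultimately show "x \<in> (\<lambda>(l, m). THE x. x \<in> l \<inter> m) ` (lines \<times> lines)" by force
  qed
  show "finite ((\<lambda>(l, m). THE x. x \<in> l \<inter> m) ` (lines \<times> lines))" using finite_lines by auto
qed

lemma exists_line_direction: "l \<in> T \<Longrightarrow> \<exists>d. d \<noteq> 0 \<and> fst (normal_form l) \<bullet> d = 0"
proof -
  assume l: "l \<in> T"
  have "\<not> l \<subseteq> {a}" for a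
  proof
    assume "l \<subseteq> {a}"
    from aff_dim_subset[OF this] show False using line l by simp
  qed
  then obtain y z where "y \<in> l" "z \<in> l" "y \<noteq> z" by blast
  then have "z - y \<noteq> 0 \<and> fst (normal_form l) \<bullet> (z - y) = 0"
    using mem_line_iff[OF l] by (simp add: side_def inner_diff_right)
  then show ?thesis by blast
qed

text \<open>Finitely many lines cannot cover an open set. In the application \<open>d l\<close> is a
  direction of l, and the second condition says that a node is never the foot of the perpendicular
  from q to a line through it.\<close>

lemma exists_generic_point:
  assumes d: "\<And>l. l \<in> T \<Longrightarrow> d l \<noteq> 0"
  shows "\<exists>q\<in>D. (\<forall>l\<in>lines. side l q \<noteq> 0) \<and> (\<forall>x\<in>nodes T \<inter> D. \<forall>l\<in>lines. d l \<bullet> (q - x) \<noteq> 0)"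
proof -
  define B where "B = (\<Union>l\<in>lines. {q. fst (normal_form l) \<bullet> q = snd (normal_form l)}) \<union>
    (\<Union>x\<in>nodes T \<inter> D. \<Union>l\<in>lines. {q. d l \<bullet> q = d l \<bullet> x})"
  have "negligible B"
    unfolding B_def using finite_lines finite_nodes normal_nonzero d lines_in_T
    by (intro negligible_Un negligible_Union finite_imageI ballI)
      (auto intro!: negligible_Union negligible_hyperplane)
  moreover have "\<not> negligible D" using open_not_negligible D_open D_nonempty by blast
  ultimately have "\<not> D \<subseteq> B" using negligible_subset by blast
  then obtain q where "q \<in> D" "q \<notin> B" by blast
  then show ?thesis unfolding B_def by (intro bexI[of _ q]) (auto simp: side_def inner_diff_right)
qed

text \<open>The function is the squared distance to a generic q plus \<delta> times the inverse
  distance to the complement of \<open>D\<close>: a strictly convex term and a convex one that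
  explodes at the frontier. The strict inequalities at nodes and on lines hold for the first term
  alone. As there are finitely many nodes and lines, and q has positive distance from each line,
  they survive for small \<delta>.\<close>

lemma exists_sweep:
  "\<exists>h::point \<Rightarrow> real.
    (\<forall>x y t. x \<in> D \<longrightarrow> y \<in> D \<longrightarrow> x \<noteq> y \<longrightarrow> 0 < t \<longrightarrow> t < 1 \<longrightarrow>
       h ((1 - t) *\<^sub>R x + t *\<^sub>R y) < max (h x) (h y)) \<and>
    (\<forall>C. closed C \<longrightarrow> C \<inter> D \<noteq> {} \<longrightarrow> (\<exists>x\<in>C \<inter> D. \<forall>y\<in>C \<inter> D. h x \<le> h y)) \<and>
    (\<forall>x\<in>nodes T \<inter> D. \<forall>l\<in>T. x \<in> l \<longrightarrow> (\<exists>y\<in>l \<inter> D. h y < h x)) \<and>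
    (\<exists>q\<in>D. \<forall>l\<in>T. \<forall>y\<in>l \<inter> D. h q < h y)"
proof -
  obtain d where d: "\<And>l. l \<in> T \<Longrightarrow> d l \<noteq> 0 \<and> fst (normal_form l) \<bullet> d l = 0"
    using exists_line_direction by metis
  then obtain q where q: "q \<in> D" "\<And>l. l \<in> lines \<Longrightarrow> side l q \<noteq> 0"
    "\<And>x l. x \<in> nodes T \<inter> D \<Longrightarrow> l \<in> lines \<Longrightarrow> d l \<bullet> (q - x) \<noteq> 0"
    using exists_generic_point[of d] by blast
  define \<psi> where "\<psi> = (\<lambda>x. inverse (infdist x (- D)))"
  have ne: "- D \<noteq> {}" using D_bounded by (metis boolean_algebra_class.boolean_algebra.double_compl Compl_empty_eq not_bounded_UNIV)
  have cl: "closed (- D)" using D_open by auto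
  have pos: "infdist x (- D) > 0" if "x \<in> D" for x
    using that ne cl by (auto simp: infdist_pos_not_in_closed)
  have ev_small: "eventually (\<lambda>\<delta>. \<delta> * a < b) (at_right 0)" if "b > 0" for a b :: real
  proof -
    have "((\<lambda>\<delta>. \<delta> * a) \<longlongrightarrow> 0 * a) (at_right 0)" by (intro tendsto_intros)
    then show ?thesis using that by (auto dest: order_tendstoD)
  qed
  have ev1: "eventually (\<lambda>\<delta>. \<forall>y\<in>l. \<delta> * \<psi> q < (norm (y - q))\<^sup>2) (at_right 0)" if l: "l \<in> lines" for l
  proof -
    have "q \<notin> l" using q(2)[OF l] mem_line_iff lines_in_T l by auto
    then obtain r where r: "r > 0" "\<And>y. y \<in> l \<Longrightarrow> r \<le> dist q y"
      using separate_point_closed[of l q] line_closed lines_in_T l by blast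
    have "eventually (\<lambda>\<delta>. \<delta> * \<psi> q < r\<^sup>2) (at_right 0)" using r(1) by (intro ev_small) auto
    then show ?thesis
    proof (rule eventually_mono, intro ballI)
      fix \<delta> y assume "\<delta> * \<psi> q < r\<^sup>2" "y \<in> l"
      moreover have "r\<^sup>2 \<le> (norm (y - q))\<^sup>2"
        using r(1) r(2)[OF \<open>y \<in> l\<close>] by (intro power_mono) (auto simp: dist_norm norm_minus_commute)
      ultimately show "\<delta> * \<psi> q < (norm (y - q))\<^sup>2" by linarith
    qed
  qed
  \<comment> \<open>At a node x the squared distance to q is not stationary along l, so a short move
    along l lowers it by a positive amount, which outweighs the change of the second term for small
    \<delta>.\<close>
  have ev2: "eventually (\<lambda>\<delta>. x \<in> l \<longrightarrow> (\<exists>y\<in>l \<inter> D. (norm (y - q))\<^sup>2 + \<delta> * \<psi> y < (norm (x - q))\<^sup>2 + \<delta> * \<psi> x)) (at_right 0)"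
    if x: "x \<in> nodes T \<inter> D" and l: "l \<in> lines" for x l
  proof (cases "x \<in> l")
    case True
    define e where "e = d l \<bullet> (q - x)"
    have e: "e \<noteq> 0" using q(3)[OF x l] by (simp add: e_def)
    have lim: "((\<lambda>s. x + (s * e) *\<^sub>R d l) \<longlongrightarrow> x + (0 * e) *\<^sub>R d l) (at_right 0)"
      by (intro tendsto_intros)
    have "eventually (\<lambda>y. y \<in> D) (nhds x)" using x eventually_in_D by auto
    then have 1: "eventually (\<lambda>s. x + (s * e) *\<^sub>R d l \<in> D) (at_right 0)"
      using eventually_compose_filterlim lim by fastforce
    have 2: "eventually (\<lambda>s. s * (norm (d l))\<^sup>2 < 2) (at_right 0)" by (rule ev_small) simp
    have "eventually (\<lambda>s. 0 < s \<and> x + (s * e) *\<^sub>R d l \<in> D \<and> s * (norm (d l))\<^sup>2 < 2) (at_right 0)"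
      using 1 2 eventually_at_right_less[of "0::real"] by eventually_elim auto
    then obtain s where s: "0 < s" "x + (s * e) *\<^sub>R d l \<in> D" "s * (norm (d l))\<^sup>2 < 2"
      by (metis (mono_tags, lifting) eventually_happens' trivial_limit_at_right_real)
    define y where "y = x + (s * e) *\<^sub>R d l"
    have yl: "y \<in> l" using True l d[of l] lines_in_T mem_line_iff[of l]
      by (simp add: y_def side_add)
    have "(norm (y - q))\<^sup>2 = (norm (x - q))\<^sup>2 - s * e\<^sup>2 * (2 - s * (norm (d l))\<^sup>2)"
    proof -
      have "y - q = (x - q) + (s * e) *\<^sub>R d l" by (simp add: y_def)
      moreover have "(norm (a + r *\<^sub>R v))\<^sup>2 = (norm a)\<^sup>2 + 2 * r * (a \<bullet> v) + r\<^sup>2 * (norm v)\<^sup>2"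
        for a v :: point and r
        by (simp add: power2_norm_eq_inner inner_add_left inner_add_right inner_commute algebra_simps
            power2_eq_square[of r])
      ultimately have "(norm (y - q))\<^sup>2 = (norm (x - q))\<^sup>2 + 2 * (s * e) * ((x - q) \<bullet> d l) + (s * e)\<^sup>2 * (norm (d l))\<^sup>2"
        by (simp only:)
      also have "(x - q) \<bullet> d l = - e" by (simp add: e_def inner_commute inner_diff_right)
      finally show ?thesis by (simp add: power2_eq_square algebra_simps)
    qed
    moreover have "s * e\<^sup>2 * (2 - s * (norm (d l))\<^sup>2) > 0" using s e by (intro mult_pos_pos) auto
    ultimately have "(norm (x - q))\<^sup>2 - (norm (y - q))\<^sup>2 > 0" by linarith
    from ev_small[OF this, of "\<psi> y - \<psi> x"] show ?thesis
    proof (rule eventually_mono, intro impI)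
      fix \<delta> assume "\<delta> * (\<psi> y - \<psi> x) < (norm (x - q))\<^sup>2 - (norm (y - q))\<^sup>2"
      then show "\<exists>y\<in>l \<inter> D. (norm (y - q))\<^sup>2 + \<delta> * \<psi> y < (norm (x - q))\<^sup>2 + \<delta> * \<psi> x"
        using yl s(2) by (intro bexI[of _ y]) (auto simp: y_def algebra_simps)
    qed
  qed simp
  have "eventually (\<lambda>\<delta>. \<forall>l\<in>lines. \<forall>y\<in>l. \<delta> * \<psi> q < (norm (y - q))\<^sup>2) (at_right 0)"
    using finite_lines ev1 by (intro eventually_ball_finite) auto
  moreover have "eventually (\<lambda>\<delta>. \<forall>x\<in>nodes T \<inter> D. \<forall>l\<in>lines. x \<in> l \<longrightarrow>
      (\<exists>y\<in>l \<inter> D. (norm (y - q))\<^sup>2 + \<delta> * \<psi> y < (norm (x - q))\<^sup>2 + \<delta> * \<psi> x)) (at_right 0)"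
    using finite_lines finite_nodes ev2 by (intro eventually_ball_finite ballI) auto
  ultimately have ev: "eventually (\<lambda>\<delta>. 0 < \<delta> \<and> (\<forall>l\<in>lines. \<forall>y\<in>l. \<delta> * \<psi> q < (norm (y - q))\<^sup>2) \<and>
      (\<forall>x\<in>nodes T \<inter> D. \<forall>l\<in>lines. x \<in> l \<longrightarrow>
      (\<exists>y\<in>l \<inter> D. (norm (y - q))\<^sup>2 + \<delta> * \<psi> y < (norm (x - q))\<^sup>2 + \<delta> * \<psi> x))) (at_right 0)"
    using eventually_at_right_less[of "0::real"] by eventually_elim auto
  from eventually_happens'[OF trivial_limit_at_right_real ev]
  obtain \<delta> where \<delta>0: "0 < \<delta> \<and> (\<forall>l\<in>lines. \<forall>y\<in>l. \<delta> * \<psi> q < (norm (y - q))\<^sup>2) \<and>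
      (\<forall>x\<in>nodes T \<inter> D. \<forall>l\<in>lines. x \<in> l \<longrightarrow>
      (\<exists>y\<in>l \<inter> D. (norm (y - q))\<^sup>2 + \<delta> * \<psi> y < (norm (x - q))\<^sup>2 + \<delta> * \<psi> x))" ..
  then have \<delta>: "\<delta> > 0" "\<And>l y. l \<in> lines \<Longrightarrow> y \<in> l \<Longrightarrow> \<delta> * \<psi> q < (norm (y - q))\<^sup>2"
    "\<And>x l. x \<in> nodes T \<inter> D \<Longrightarrow> l \<in> lines \<Longrightarrow> x \<in> l \<Longrightarrow>
      \<exists>y\<in>l \<inter> D. (norm (y - q))\<^sup>2 + \<delta> * \<psi> y < (norm (x - q))\<^sup>2 + \<delta> * \<psi> x"
    by blast+
  define h where "h = (\<lambda>x. (norm (x - q))\<^sup>2 + \<delta> * \<psi> x)"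
  have quasi: "h ((1 - t) *\<^sub>R x + t *\<^sub>R y) < max (h x) (h y)"
    if "x \<in> D" "y \<in> D" "x \<noteq> y" "0 < t" "t < 1" for x y t
  proof -
    have px: "infdist x (- D) > 0" "infdist y (- D) > 0" using pos that by auto
    have "\<psi> ((1 - t) *\<^sub>R x + t *\<^sub>R y) \<le> inverse ((1 - t) * infdist x (- D) + t * infdist y (- D))"
      unfolding \<psi>_def using px that infdist_Compl_concave[OF D_convex D_open ne, of x y t]
      by (intro le_imp_inverse_le) (auto intro: add_pos_pos)
    also have "\<dots> \<le> (1 - t) * \<psi> x + t * \<psi> y"
      using convex_onD[OF convex_on_inverse[of "{0<..}"], of t "infdist x (- D)" "infdist y (- D)"] px that
      by (simp add: \<psi>_def)
    finally have "\<delta> * \<psi> ((1 - t) *\<^sub>R x + t *\<^sub>R y) \<le> \<delta> * ((1 - t) * \<psi> x + t * \<psi> y)"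
      using \<delta>(1) by simp
    moreover have "(norm ((1 - t) *\<^sub>R x + t *\<^sub>R y - q))\<^sup>2 <
      (1 - t) * (norm (x - q))\<^sup>2 + t * (norm (y - q))\<^sup>2"
      unfolding norm_power2_combination using that by simp
    ultimately have "h ((1 - t) *\<^sub>R x + t *\<^sub>R y) < (1 - t) * h x + t * h y"
      unfolding h_def by (simp add: algebra_simps)
    also have "\<dots> \<le> (1 - t) * max (h x) (h y) + t * max (h x) (h y)"
      using that by (intro add_mono mult_left_mono) auto
    finally show ?thesis by (simp add: algebra_simps)
  qed
  have attains: "\<exists>x\<in>C \<inter> D. \<forall>y\<in>C \<inter> D. h x \<le> h y" if C: "closed C" "C \<inter> D \<noteq> {}" for C
  proof -
    obtain p where p: "p \<in> C" "p \<in> D" using C by blast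
    have \<psi>_pos: "\<psi> x > 0" if "x \<in> D" for x using pos[OF that] by (simp add: \<psi>_def)
    have hp: "h p > 0" unfolding h_def using \<psi>_pos p \<delta> by (intro add_nonneg_pos mult_pos_pos) auto
    \<comment> \<open>A point of C whose value is at most \<open>h p\<close> satisfies
      \<open>\<delta> * \<psi> x \<le> h p\<close>, so it keeps a fixed distance from the complement
      of \<open>D\<close>. This makes the open window behave like a compact set.\<close>
    define K where "K = C \<inter> {x. infdist x (- D) \<ge> \<delta> / h p}"
    have "closed {x. infdist x (- D) \<ge> \<delta> / h p}"
      by (intro closed_Collect_le continuous_intros)
    then have "closed K" unfolding K_def using C by auto
    have "\<delta> / h p > 0" using \<delta> hp by simp
    have KD: "K \<subseteq> D"
    proof
      fix x assume "x \<in> K"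
      then have "infdist x (- D) > 0" using \<open>\<delta> / h p > 0\<close> unfolding K_def by auto
      then show "x \<in> D" by (metis ComplI infdist_zero less_irrefl)
    qed
    have "compact K" using \<open>closed K\<close> KD D_bounded bounded_subset compact_eq_bounded_closed by blast
    have inK: "x \<in> K \<longleftrightarrow> \<delta> * \<psi> x \<le> h p" if "x \<in> C" "x \<in> D" for x
      using that pos[OF that(2)] hp by (simp add: K_def \<psi>_def field_simps)
    have "p \<in> K" using inK[OF p] by (simp add: h_def)
    have "continuous_on K h"
      unfolding h_def \<psi>_def using KD pos by (intro continuous_intros) (auto simp: less_imp_neq[symmetric] subset_iff dest!: less_imp_neq)
    then obtain x where x: "x \<in> K" "\<And>y. y \<in> K \<Longrightarrow> h x \<le> h y"
      using continuous_attains_inf[OF \<open>compact K\<close>] \<open>p \<in> K\<close> by blast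
    have "h x \<le> h y" if "y \<in> C \<inter> D" for y
    proof (cases "y \<in> K")
      case False
      then have "h p < \<delta> * \<psi> y" using inK that by auto
      also have "\<dots> \<le> h y" by (simp add: h_def)
      finally show ?thesis using x(2)[OF \<open>p \<in> K\<close>] by simp
    qed (use x in auto)
    then show ?thesis using x KD unfolding K_def by blast
  qed
  have node: "\<exists>y\<in>l \<inter> D. h y < h x" if "x \<in> nodes T \<inter> D" "l \<in> T" "x \<in> l" for x l
    using that \<delta>(3)[of x l] unfolding h_def lines_def by blast
  have line: "h q < h y" if "l \<in> T" "y \<in> l \<inter> D" for l y
  proof -
    have "l \<in> lines" using that unfolding lines_def by blast
    moreover have "\<delta> * \<psi> y > 0" using \<delta>(1) pos[of y] that by (simp add: \<psi>_def)
    ultimately show ?thesis using \<delta>(2)[of l y] that unfolding h_def by simp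
  qed
  show ?thesis
  proof (rule exI[of _ h], intro conjI)
    show "\<forall>x y t. x \<in> D \<longrightarrow> y \<in> D \<longrightarrow> x \<noteq> y \<longrightarrow> 0 < t \<longrightarrow> t < 1 \<longrightarrow>
       h ((1 - t) *\<^sub>R x + t *\<^sub>R y) < max (h x) (h y)" by (intro allI impI quasi)
    show "\<forall>C. closed C \<longrightarrow> C \<inter> D \<noteq> {} \<longrightarrow> (\<exists>x\<in>C \<inter> D. \<forall>y\<in>C \<inter> D. h x \<le> h y)"
      by (intro allI impI attains)
    show "\<forall>x\<in>nodes T \<inter> D. \<forall>l\<in>T. x \<in> l \<longrightarrow> (\<exists>y\<in>l \<inter> D. h y < h x)"
      by (intro ballI impI node)
    show "\<exists>q\<in>D. \<forall>l\<in>T. \<forall>y\<in>l \<inter> D. h q < h y"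
      by (intro bexI[OF _ q(1)] ballI line)
  qed
qed

subsection \<open>Faces and colourings of cells\<close>

lemma realizable:
  assumes "p \<in> D" "\<And>l. w l \<in> {-1, 0, 1}" "signs p \<preceq> w"
  shows "w \<in> signs ` D"
  using realize_signs[OF assms eventually_True] by auto

lemma signs_image_values: "v \<in> signs ` D \<Longrightarrow> v l \<in> {-1, 0, 1}"
  using signs_values by auto

lemma cells_le: "v \<in> cells \<Longrightarrow> v \<preceq> w \<Longrightarrow> v = w"
  unfolding cells_def le_signs_def by auto

lemma segs_le:
  assumes "v \<in> segs" "w \<in> segs" "v \<preceq> w"
  shows "v = w"
proof
  fix l
  have "v (line_of_seg w) = 0" using assms line_of_seg[OF assms(2)] unfolding le_signs_def by metis
  then have "line_of_seg v = line_of_seg w" using line_of_seg[OF assms(1)] by metis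
  then show "v l = w l"
    using assms(3) line_of_seg[OF assms(1)] line_of_seg[OF assms(2)] unfolding le_signs_def by metis
qed

lemma seg_le_cell: "v \<in> segs \<Longrightarrow> w \<in> cells \<Longrightarrow> \<not> w \<preceq> v"
  using cells_le[of w v] unfolding segs_def cells_def by blast

lemma update_cell:
  assumes "v \<in> segs" "e \<in> {-1, 1}"
  shows "v(line_of_seg v := e) \<in> cells"
proof -
  obtain p where p: "p \<in> D" "v = signs p" using assms unfolding segs_def by blast
  have "v \<preceq> v(line_of_seg v := e)" using line_of_seg[OF assms(1)] unfolding le_signs_def by auto
  then have "v(line_of_seg v := e) \<in> signs ` D"
    using p signs_values assms(2) by (intro realizable[of p]) auto
  then show ?thesis using line_of_seg[OF assms(1)] assms(2) unfolding cells_def by auto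
qed

lemma seg_le_update: "v \<in> segs \<Longrightarrow> v \<preceq> v(line_of_seg v := e)"
  using line_of_seg[of v] unfolding le_signs_def by auto

lemma exists_cell_above:
  assumes "p \<in> D" shows "\<exists>v\<in>cells. signs p \<preceq> v"
proof -
  define v where "v = (\<lambda>l. if signs p l = 0 then 1 else signs p l)"
  have "signs p \<preceq> v" unfolding le_signs_def v_def by auto
  moreover have "v \<in> signs ` D" using calculation assms signs_values[of p]
    by (intro realizable[of p]) (auto simp: v_def)
  moreover have "\<forall>l. v l \<noteq> 0" by (simp add: v_def)
  ultimately show ?thesis unfolding cells_def by blast
qed

section \<open>Supports of graphs and the faces around a point\<close>

lemma mem_support_iff:
  assumes "G \<subseteq> segments T D" "x \<in> D"
  shows "x \<in> support G \<longleftrightarrow> (\<exists>v\<in>segs. stratum v \<in> G \<and> signs x \<preceq> v)"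
proof
  assume "x \<in> support G"
  then obtain s where s: "s \<in> G" "x \<in> closure s" unfolding support_def by blast
  then obtain v where "v \<in> segs" "s = stratum v" using assms(1) segments_eq by auto
  then show "\<exists>v\<in>segs. stratum v \<in> G \<and> signs x \<preceq> v" using s closure_stratum by blast
next
  assume "\<exists>v\<in>segs. stratum v \<in> G \<and> signs x \<preceq> v"
  then obtain v where v: "v \<in> segs" "stratum v \<in> G" "signs x \<preceq> v" by blast
  then obtain q where "q \<in> D" "v = signs q" unfolding segs_def by blast
  then have "x \<in> closure (stratum v)" using mem_closure_stratum assms v by blast
  then show "x \<in> support G" using v unfolding support_def by blast
qed

lemma cell_not_in_support: "G \<subseteq> segments T D \<Longrightarrow> x \<in> D \<Longrightarrow> signs x \<in> cells \<Longrightarrow> x \<notin> support G"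
  using mem_support_iff seg_le_cell by blast

lemma seg_in_support_iff:
  "G \<subseteq> segments T D \<Longrightarrow> x \<in> D \<Longrightarrow> signs x \<in> segs \<Longrightarrow> x \<in> support G \<longleftrightarrow> stratum (signs x) \<in> G"
  using mem_support_iff segs_le le_signs_refl by metis

text \<open>Well defined for graphs made of segments: a cell is connected and avoids the support, so
  exactly one component of the complement contains it.\<close>

definition cell_face :: "point set set \<Rightarrow> (point set \<Rightarrow> real) \<Rightarrow> point set" where
  "cell_face G v = (THE F. F \<in> faces D G \<and> stratum v \<subseteq> F)"

lemma connected_insert_stratum:
  assumes "p \<in> D" "v \<in> signs ` D" "signs p \<preceq> v"
  shows "connected (insert p (stratum v))"
proof -
  obtain q where "q \<in> D" "v = signs q" using assms(2) by auto
  then have "p \<in> closure (stratum v)" using mem_closure_stratum[of p q] assms by simp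
  then show ?thesis
    using connected_intermediate_closure[of "stratum v" "insert p (stratum v)"]
      convex_connected[OF convex_stratum[of v]] closure_subset by auto
qed

text \<open>Adding a point of its closure keeps a cell connected. A face can thus be identified from
  any of its points, even one on a segment or at a node, by means of a cell that touches the
  point.\<close>

lemma cell_face_unique:
  assumes "G \<subseteq> segments T D" "v \<in> cells" "p \<in> D - support G" "signs p \<preceq> v" "F \<in> faces D G" "p \<in> F"
  shows "cell_face G v = F" "stratum v \<subseteq> F"
proof -
  have v: "v \<in> signs ` D" using assms(2) unfolding cells_def by auto
  have sub: "stratum v \<subseteq> D - support G"
    using cell_not_in_support[OF assms(1)] assms(2) unfolding stratum_def by auto
  have "connected (insert p (stratum v))" using connected_insert_stratum[OF _ v assms(4)] assms(3) by blast
  then have "insert p (stratum v) \<subseteq> F"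
    using components_maximal[of F "D - support G" "insert p (stratum v)"] sub assms unfolding faces_def by auto
  then show *: "stratum v \<subseteq> F" by simp
  show "cell_face G v = F"
    unfolding cell_face_def
  proof (rule the_equality)
    fix F' assume "F' \<in> faces D G \<and> stratum v \<subseteq> F'"
    then show "F' = F"
      using * stratum_nonempty[OF v] assms(5) components_eq[of F' "D - support G" F] unfolding faces_def by blast
  qed (use * assms in auto)
qed

lemma exists_face:
  assumes "p \<in> D - support G" shows "\<exists>F\<in>faces D G. p \<in> F"
  using assms unfolding faces_def by (metis UnionE Union_components)

lemma cell_face_face:
  assumes "G \<subseteq> segments T D" "v \<in> cells"
  shows "cell_face G v \<in> faces D G" "stratum v \<subseteq> cell_face G v"
proof -
  obtain p where p: "p \<in> D" "v = signs p" using assms unfolding cells_def by blast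
  then have "p \<in> D - support G" using cell_not_in_support assms by auto
  then obtain F where F: "F \<in> faces D G" "p \<in> F" using exists_face by blast
  show "cell_face G v \<in> faces D G" "stratum v \<subseteq> cell_face G v"
    using cell_face_unique[OF assms \<open>p \<in> D - support G\<close> _ F] p F by auto
qed

lemma cell_face_surj:
  assumes "G \<subseteq> segments T D" "F \<in> faces D G"
  shows "\<exists>v\<in>cells. cell_face G v = F"
proof -
  obtain p where p: "p \<in> F" "p \<in> D - support G"
    using assms in_components_nonempty in_components_subset unfolding faces_def by blast
  obtain v where v: "v \<in> cells" "signs p \<preceq> v" using exists_cell_above p by blast
  then show ?thesis using cell_face_unique(1)[OF assms(1) v(1) p(2) v(2) assms(2) p(1)] by blast
qed

lemma cell_face_eq_near:
  assumes "G \<subseteq> segments T D" "v \<in> cells" "w \<in> cells" "p \<in> D - support G" "signs p \<preceq> v" "signs p \<preceq> w"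
  shows "cell_face G v = cell_face G w"
  using exists_face[OF assms(4)] cell_face_unique(1)[OF assms(1)] assms by metis

text \<open>The point p lies on l because the two cells disagree there. Hence the sign vector with a
  zero at l is realised near p, and it is the segment shared by the two cells.\<close>

lemma separating_seg:
  assumes p: "p \<in> D" and v: "v \<in> cells" "w \<in> cells" and le: "signs p \<preceq> v" "signs p \<preceq> w"
    and differ: "\<And>m. m \<noteq> l \<Longrightarrow> v m = w m" "v l \<noteq> w l"
  shows "v(l := 0) \<in> segs" "signs p \<preceq> v(l := 0)" "line_of_seg (v(l := 0)) = l"
    "v = (v(l := 0))(l := v l)" "w = (v(l := 0))(l := w l)" "v l = - w l"
proof -
  have "signs p l = 0" using le differ(2) unfolding le_signs_def by metis
  then show le0: "signs p \<preceq> v(l := 0)" using le unfolding le_signs_def by auto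
  have "v \<in> signs ` D" using v unfolding cells_def by auto
  then have "v(l := 0) \<in> signs ` D"
    using p le0 signs_image_values by (intro realizable[of p]) auto
  then show seg: "v(l := 0) \<in> segs" using v unfolding segs_def cells_def by auto
  show "line_of_seg (v(l := 0)) = l" using line_of_seg[OF seg, of l] by simp
  show "v = (v(l := 0))(l := v l)" "w = (v(l := 0))(l := w l)" using differ by auto
  have "v l \<in> {-1, 1}" "w l \<in> {-1, 1}"
    using v signs_image_values unfolding cells_def by fastforce+
  then show "v l = - w l" using differ by auto
qed

lemma cell_face_eq_across:
  assumes G: "G \<subseteq> segments T D" and v: "v \<in> segs" "stratum v \<notin> G"
  shows "cell_face G (v(line_of_seg v := 1)) = cell_face G (v(line_of_seg v := -1))"
proof -
  obtain p where p: "p \<in> D" "v = signs p" using v unfolding segs_def by blast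
  then have "p \<in> D - support G" using seg_in_support_iff[OF G] v by auto
  then show ?thesis
    using cell_face_eq_near[OF G] update_cell[OF v(1)] seg_le_update[OF v(1)] p by simp
qed

section \<open>The graph of a colouring\<close>

definition graph_of :: "((point set \<Rightarrow> real) \<Rightarrow> nat) \<Rightarrow> point set set" where
  "graph_of \<kappa> = stratum ` {v \<in> segs. \<kappa> (v(line_of_seg v := 1)) \<noteq> \<kappa> (v(line_of_seg v := -1))}"

lemma graph_of_segments: "graph_of \<kappa> \<subseteq> segments T D"
  unfolding graph_of_def segments_eq by auto

lemma stratum_in_graph_of:
  assumes "v \<in> segs"
  shows "stratum v \<in> graph_of \<kappa> \<longleftrightarrow> \<kappa> (v(line_of_seg v := 1)) \<noteq> \<kappa> (v(line_of_seg v := -1))"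
proof
  assume "stratum v \<in> graph_of \<kappa>"
  then obtain w where w: "w \<in> segs" "\<kappa> (w(line_of_seg w := 1)) \<noteq> \<kappa> (w(line_of_seg w := -1))"
    "stratum v = stratum w" unfolding graph_of_def by blast
  then have "v = w" using assms inj_onD[OF inj_on_stratum] unfolding segs_def by auto
  then show "\<kappa> (v(line_of_seg v := 1)) \<noteq> \<kappa> (v(line_of_seg v := -1))" using w by simp
qed (use assms in \<open>auto simp: graph_of_def\<close>)

text \<open>Reduces equality across one line to the two sides of a segment. The function f is the
  colour in \<open>colour_step\<close> and the face in \<open>cell_face_step\<close>.\<close>

lemma eq_across_line:
  assumes "p \<in> D" "v \<in> cells" "w \<in> cells" "signs p \<preceq> v" "signs p \<preceq> w" "\<And>m. m \<noteq> l \<Longrightarrow> v m = w m"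
    and eq: "v(l := 0) \<in> segs \<Longrightarrow> signs p \<preceq> v(l := 0) \<Longrightarrow> line_of_seg (v(l := 0)) = l \<Longrightarrow>
      f (v(l := 1)) = f (v(l := -1))"
  shows "f v = f w"
proof (cases "v l = w l")
  case True
  then have "v = w" using assms(6) by (intro ext) metis
  then show ?thesis by simp
next
  case False
  note s = separating_seg[OF assms(1-6) False]
  have "f (v(l := 1)) = f (v(l := -1))" by (rule eq[OF s(1-3)])
  moreover have "v l = 1 \<or> v l = -1"
    using assms(2) signs_image_values[of v l] unfolding cells_def by auto
  moreover have "v(l := v l) = v" "v(l := w l) = w" using assms(6) by auto
  moreover have "w l = - v l" using s(6) by simp
  ultimately show ?thesis by (metis minus_minus)
qed

lemma colour_step:
  assumes "p \<in> D" "v \<in> cells" "w \<in> cells" "signs p \<preceq> v" "signs p \<preceq> w" "\<And>m. m \<noteq> l \<Longrightarrow> v m = w m"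
    "p \<notin> support (graph_of \<kappa>)"
  shows "\<kappa> v = \<kappa> w"
proof (rule eq_across_line[OF assms(1-6)])
  assume s: "v(l := 0) \<in> segs" "signs p \<preceq> v(l := 0)" "line_of_seg (v(l := 0)) = l"
  have "stratum (v(l := 0)) \<notin> graph_of \<kappa>"
    using assms(7) mem_support_iff[OF graph_of_segments assms(1)] s(1,2) by blast
  then show "\<kappa> (v(l := 1)) = \<kappa> (v(l := -1))"
    using stratum_in_graph_of[OF s(1)] s(3) by simp
qed

text \<open>Two cells touching p differ at most at the two lines through p. Crossing these lines one
  at a time joins them, and as p is off the support no crossed segment belongs to the graph.\<close>

lemma colour_near:
  assumes p: "p \<in> D" and vw: "v \<in> cells" "w \<in> cells" "signs p \<preceq> v" "signs p \<preceq> w"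
    and supp: "p \<notin> support (graph_of \<kappa>)"
  shows "\<kappa> v = \<kappa> w"
proof (cases "\<exists>l1. signs p l1 = 0")
  case False
  then have "signs p \<in> cells" using p unfolding cells_def by auto
  then show ?thesis using cells_le vw by metis
next
  case True
  then obtain l1 where l1: "signs p l1 = 0" by blast
  define x where "x = v(l1 := w l1)"
  have lex: "signs p \<preceq> x" using vw l1 unfolding le_signs_def x_def by auto
  have vD: "v \<in> signs ` D" "w \<in> signs ` D" using vw unfolding cells_def by auto
  have "x \<in> signs ` D"
    using lex p signs_image_values[OF vD(1)] signs_image_values[OF vD(2)]
    by (intro realizable[of p]) (auto simp: x_def)
  then have x: "x \<in> cells" using vw unfolding cells_def x_def by auto
  have "\<kappa> v = \<kappa> x"
    by (rule colour_step[OF p vw(1) x vw(3) lex _ supp, of l1]) (simp add: x_def)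
  also have "\<kappa> x = \<kappa> w"
  proof (cases "\<exists>l2. l2 \<noteq> l1 \<and> signs p l2 = 0")
    case True
    then obtain l2 where l2: "l1 \<noteq> l2" "signs p l2 = 0" by blast
    show ?thesis
    proof (rule colour_step[OF p x vw(2) lex vw(4) _ supp, of l2])
      fix m assume "m \<noteq> l2"
      then have "m = l1 \<or> signs p m \<noteq> 0" using no_three_zeros[OF p l1 l2(2,1)] by blast
      then show "x m = w m" using vw unfolding le_signs_def x_def by (metis fun_upd_apply)
    qed
  next
    case False
    show ?thesis
    proof (rule colour_step[OF p x vw(2) lex vw(4) _ supp, of l1])
      fix m assume "m \<noteq> l1"
      then have "signs p m \<noteq> 0" using False by blast
      then show "x m = w m" using vw unfolding le_signs_def x_def by (metis fun_upd_apply)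
    qed
  qed
  finally show ?thesis .
qed

text \<open>Passage from local to global: choose a cell above each point of S. A cell above a nearby
  point is also above the given one, so the value at the chosen cell is locally constant. The
  predicate P restricts to the cells on one side of a line when S is an edge.\<close>

lemma cells_constant_along:
  assumes S: "connected S" "S \<subseteq> D"
    and above: "\<And>p. p \<in> S \<Longrightarrow> \<exists>u\<in>cells. signs p \<preceq> u \<and> P u"
    and near: "\<And>p u w. p \<in> S \<Longrightarrow> u \<in> cells \<Longrightarrow> w \<in> cells \<Longrightarrow> signs p \<preceq> u \<Longrightarrow> signs p \<preceq> w \<Longrightarrow>
      P u \<Longrightarrow> P w \<Longrightarrow> f u = f w"
    and p: "p \<in> S" "v \<in> cells" "signs p \<preceq> v" "P v" and q: "q \<in> S" "w \<in> cells" "signs q \<preceq> w" "P w"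
  shows "f v = f w"
proof -
  define c where "c a = (SOME u. u \<in> cells \<and> signs a \<preceq> u \<and> P u)" for a
  have c: "c a \<in> cells \<and> signs a \<preceq> c a \<and> P (c a)" if "a \<in> S" for a
  proof -
    have "\<exists>u. u \<in> cells \<and> signs a \<preceq> u \<and> P u" using above[OF that] by blast
    from someI_ex[OF this] show ?thesis unfolding c_def .
  qed
  have "f (c p) = f (c q)"
  proof (rule connected_local_const[OF S(1) p(1) q(1)], rule ballI)
    fix a assume a: "a \<in> S"
    have "\<forall>\<^sub>F b in at a within S. signs a \<preceq> signs b"
      using eventually_le_signs by (rule filter_leD[OF at_within_le_nhds])
    moreover have "\<forall>\<^sub>F b in at a within S. b \<in> S" by (simp add: eventually_at_filter)
    ultimately show "\<forall>\<^sub>F b in at a within S. f (c a) = f (c b)"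
    proof eventually_elim
      case (elim b)
      then have "signs a \<preceq> c b" using c[of b] unfolding le_signs_def by metis
      then show ?case using near[OF a] c[OF a] c[OF elim(2)] by blast
    qed
  qed
  moreover have "f v = f (c p)" "f w = f (c q)" using near p q c[OF p(1)] c[OF q(1)] by blast+
  ultimately show ?thesis by simp
qed

lemma colour_constant_on_faces:
  assumes v: "v \<in> cells" "w \<in> cells" and eq: "cell_face (graph_of \<kappa>) v = cell_face (graph_of \<kappa>) w"
  shows "\<kappa> v = \<kappa> w"
proof -
  define F where "F = cell_face (graph_of \<kappa>) v"
  have F: "F \<in> faces D (graph_of \<kappa>)" "stratum v \<subseteq> F" "stratum w \<subseteq> F"
    using cell_face_face[OF graph_of_segments[of \<kappa>] v(1)] cell_face_face[OF graph_of_segments[of \<kappa>] v(2)] eq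
    unfolding F_def by auto
  have sub: "F \<subseteq> D - support (graph_of \<kappa>)" and con: "connected F"
    using F(1) in_components_subset in_components_connected unfolding faces_def by blast+
  obtain p q where "p \<in> stratum v" "q \<in> stratum w"
    using v stratum_nonempty unfolding cells_def by blast
  then have pq: "p \<in> F" "signs p \<preceq> v" "q \<in> F" "signs q \<preceq> w" using F unfolding stratum_def by auto
  show ?thesis
  proof (rule cells_constant_along[OF con _ _ _ pq(1) v(1) pq(2) TrueI pq(3) v(2) pq(4) TrueI])
    show "F \<subseteq> D" using sub by blast
    show "\<exists>u\<in>cells. signs a \<preceq> u \<and> True" if "a \<in> F" for a using exists_cell_above that sub by blast
    show "\<kappa> x = \<kappa> y" if "a \<in> F" "x \<in> cells" "y \<in> cells" "signs a \<preceq> x" "signs a \<preceq> y" for a x y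
      by (rule colour_near[OF _ that(2-5)]) (use that(1) sub in blast)+
  qed
qed

end

subsection \<open>Vertices\<close>

text \<open>For the four segments at a node, paired by the line they lie on, with R as collinearity:
  it tells when exactly two of them are present and form a straight line.\<close>

lemma four_elements_pairs:
  assumes "distinct [a, b, c, e]" and S: "S = {z \<in> {a, b, c, e}. P z}"
    and R: "R a b" "R b a" "R c e" "R e c"
      "\<not> R a c" "\<not> R a e" "\<not> R b c" "\<not> R b e" "\<not> R c a" "\<not> R c b" "\<not> R e a" "\<not> R e b"
  shows "(\<exists>s t. S = {s, t} \<and> s \<noteq> t \<and> R s t) \<longleftrightarrow>
    P a \<and> P b \<and> \<not> P c \<and> \<not> P e \<or> \<not> P a \<and> \<not> P b \<and> P c \<and> P e" (is "?L \<longleftrightarrow> ?R")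
proof
  assume ?L
  then obtain s t where st: "S = {s, t}" "s \<noteq> t" "R s t" by blast
  then have "s \<in> {a, b, c, e}" "t \<in> {a, b, c, e}" using S by auto
  then have "{s, t} = {a, b} \<or> {s, t} = {c, e}" using st R by auto
  then have "S = {a, b} \<or> S = {c, e}" using st by simp
  moreover have "P z \<longleftrightarrow> z \<in> S" if "z \<in> {a, b, c, e}" for z using S that by simp
  ultimately show ?R using assms(1) by auto
next
  assume ?R
  then have "S = {a, b} \<or> S = {c, e}" using S by auto
  then show ?L using assms(1) R by auto
qed

lemma card_four_elements:
  assumes "distinct [a, b, c, e]"
  shows "card {z \<in> {a, b, c, e}. P z} = of_bool (P a) + of_bool (P b) + of_bool (P c) + of_bool (P e)"
proof -
  have "card {z \<in> {a, b, c, e}. P z} = (\<Sum>z\<in>{a, b, c, e}. if P z then 1 else 0)"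
    by (subst sum.inter_filter[symmetric]) auto
  also have "\<dots> = of_bool (P a) + of_bool (P b) + of_bool (P c) + of_bool (P e)"
    using assms by (simp add: of_bool_def)
  finally show ?thesis .
qed

context tessellated_window
begin

lemma seg_stratum_nonempty: "v \<in> segs \<Longrightarrow> \<exists>p. p \<in> stratum v"
  using stratum_nonempty[of v] unfolding segs_def by simp blast

lemma segments_at_eq:
  assumes "G \<subseteq> segments T D" "x \<in> D"
  shows "segments_at G x = stratum ` {v \<in> segs. stratum v \<in> G \<and> signs x \<preceq> v \<and> signs x \<noteq> v}"
proof -
  have *: "x \<in> closure (stratum v) - stratum v \<longleftrightarrow> signs x \<preceq> v \<and> signs x \<noteq> v" if v: "v \<in> segs" for v
  proof -
    obtain q where "q \<in> D" "v = signs q" using v unfolding segs_def by blast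
    then show ?thesis using mem_closure_stratum[of x q] closure_stratum[of x v] assms(2)
      unfolding stratum_def by auto
  qed
  show ?thesis
  proof
    show "segments_at G x \<subseteq> stratum ` {v \<in> segs. stratum v \<in> G \<and> signs x \<preceq> v \<and> signs x \<noteq> v}"
    proof
      fix s assume s: "s \<in> segments_at G x"
      then have "s \<in> segments T D" using assms(1) unfolding segments_at_def by blast
      then obtain v where "v \<in> segs" "s = stratum v" unfolding segments_eq by blast
      then show "s \<in> stratum ` {v \<in> segs. stratum v \<in> G \<and> signs x \<preceq> v \<and> signs x \<noteq> v}"
        using * s unfolding segments_at_def by blast
    qed
    show "stratum ` {v \<in> segs. stratum v \<in> G \<and> signs x \<preceq> v \<and> signs x \<noteq> v} \<subseteq> segments_at G x"
      using * unfolding segments_at_def by blast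
  qed
qed

text \<open>A segment touching the node keeps one of the two zeros and resolves the other; the signs
  at all remaining lines are forced.\<close>

lemma node_segs:
  assumes x: "x \<in> D" "l1 \<noteq> l2" "signs x l1 = 0" "signs x l2 = 0"
  shows "{v \<in> segs. signs x \<preceq> v \<and> signs x \<noteq> v} =
    {(signs x)(l1 := 1), (signs x)(l1 := -1), (signs x)(l2 := 1), (signs x)(l2 := -1)}"
    (is "?L = ?R")
proof
  have *: "(signs x)(l := e) \<in> ?L"
    if "l \<noteq> m" "signs x l = 0" "signs x m = 0" "e = 1 \<or> e = -1" for l m e
  proof -
    have le: "signs x \<preceq> (signs x)(l := e)" using that unfolding le_signs_def by auto
    have "(signs x)(l := e) \<in> signs ` D"
      using le that signs_values[of x] x by (intro realizable[of x]) auto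
    moreover have "((signs x)(l := e)) k = 0 \<longleftrightarrow> k = m" for k
      using no_three_zeros[OF x(1) that(2,3,1)] that by auto
    ultimately have "(signs x)(l := e) \<in> segs" unfolding segs_def by blast
    moreover have "signs x \<noteq> (signs x)(l := e)" using that by (metis fun_upd_same zero_neq_neg_one zero_neq_one)
    ultimately show ?thesis using le by blast
  qed
  show "?R \<subseteq> ?L"
    using *[OF x(2,3,4)] *[OF x(2)[symmetric] x(4,3)] by auto
  show "?L \<subseteq> ?R"
  proof
    fix v assume "v \<in> ?L"
    then have v: "v \<in> segs" "signs x \<preceq> v" by auto
    have vD: "v l \<in> {-1, 0, 1}" for l using v signs_image_values unfolding segs_def by auto
    have main: "v = (signs x)(m := 1) \<or> v = (signs x)(m := -1)"
      if "v l = 0" "l \<noteq> m" "signs x l = 0" "signs x m = 0" for l m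
    proof -
      have vm: "v m = 1 \<or> v m = -1" using that vD[of m] line_of_seg[OF v(1)] by auto
      have "v k = ((signs x)(m := v m)) k" for k
      proof (cases "k = l \<or> k = m")
        case False
        then have "signs x k \<noteq> 0" using no_three_zeros[OF x(1) that(3,4,2)] by blast
        then show ?thesis using v(2) False unfolding le_signs_def by (metis fun_upd_other)
      qed (use that in auto)
      then have "v = (signs x)(m := v m)" ..
      then show ?thesis using vm by metis
    qed
    have "signs x (line_of_seg v) = 0"
      using v(2) line_of_seg[OF v(1)] unfolding le_signs_def by metis
    then have "line_of_seg v = l1 \<or> line_of_seg v = l2" using no_three_zeros[OF x(1) x(3,4,2)] by blast
    then have "v l1 = 0 \<or> v l2 = 0" using line_of_seg[OF v(1)] by metis
    then show "v \<in> ?R" using main[of l1 l2] main[of l2 l1] x by auto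
  qed
qed

lemma node_seg:
  assumes x: "x \<in> D" "l1 \<noteq> l2" "signs x l1 = 0" "signs x l2 = 0" and e: "e = 1 \<or> e = -1"
  shows "(signs x)(l1 := e) \<in> segs" "signs x \<preceq> (signs x)(l1 := e)" "signs x \<noteq> (signs x)(l1 := e)"
    "line_of_seg ((signs x)(l1 := e)) = l2"
proof -
  have "(signs x)(l1 := e) \<in> {v \<in> segs. signs x \<preceq> v \<and> signs x \<noteq> v}"
    unfolding node_segs[OF x] using e by auto
  then show *: "(signs x)(l1 := e) \<in> segs" "signs x \<preceq> (signs x)(l1 := e)" "signs x \<noteq> (signs x)(l1 := e)" by auto
  show "line_of_seg ((signs x)(l1 := e)) = l2" using line_of_seg[OF *(1), of l2] x by simp
qed

lemma node_segs_distinct: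
  assumes x: "x \<in> D" "l1 \<noteq> l2" "signs x l1 = 0" "signs x l2 = 0"
  shows "distinct [(signs x)(l1 := 1), (signs x)(l1 := -1), (signs x)(l2 := 1), (signs x)(l2 := -1)]"
proof -
  have "((signs x)(l1 := a)) l1 = a" "((signs x)(l2 := a)) l1 = 0" "((signs x)(l2 := a)) l2 = a" for a
    using x by auto
  then show ?thesis by (metis (no_types, opaque_lifting) distinct_length_2_or_more distinct_singleton
      neg_one_eq_numeral_iff one_neq_neg_one zero_neq_neg_one zero_neq_one)
qed

lemma node_strata_distinct:
  assumes x: "x \<in> D" "l1 \<noteq> l2" "signs x l1 = 0" "signs x l2 = 0"
  shows "distinct [stratum ((signs x)(l1 := 1)), stratum ((signs x)(l1 := -1)),
    stratum ((signs x)(l2 := 1)), stratum ((signs x)(l2 := -1))]"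
proof -
  let ?L = "[(signs x)(l1 := 1), (signs x)(l1 := -1), (signs x)(l2 := 1), (signs x)(l2 := -1)]"
  have "set ?L \<subseteq> signs ` D" using node_segs[OF x] unfolding segs_def by auto
  then have "inj_on stratum (set ?L)" using inj_on_stratum inj_on_subset by blast
  then have "distinct (map stratum ?L)" using node_segs_distinct[OF x] distinct_map by blast
  then show ?thesis by simp
qed

text \<open>The endpoint x excludes that \<open>stratum v\<close> is a single point. Two of its
  points determine the line, and collinearity puts a point of the other segment on it.\<close>

lemma collinear_strata_iff:
  assumes v: "v \<in> segs" "w \<in> segs" and x: "x \<in> closure (stratum v) - stratum v"
  shows "collinear (stratum v \<union> stratum w) \<longleftrightarrow> line_of_seg v = line_of_seg w"
proof -
  define l where "l = line_of_seg v"
  have l: "l \<in> T" "v l = 0" using v line_of_seg line_of_seg_lines lines_in_T unfolding l_def by auto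
  have vl: "stratum v \<subseteq> l" using stratum_subset_line[of v l] l by blast
  have "collinear (stratum v \<union> stratum w)" if eq: "line_of_seg v = line_of_seg w"
  proof -
    have "w l = 0" using eq line_of_seg[OF v(2)] unfolding l_def by simp
    then have "stratum w \<subseteq> l" using stratum_subset_line[of w l] by blast
    then have "aff_dim (stratum v \<union> stratum w) \<le> aff_dim l" using vl by (intro aff_dim_subset) auto
    then show ?thesis using line(2)[OF l(1)] collinear_aff_dim[of "stratum v \<union> stratum w"] by linarith
  qed
  moreover have "line_of_seg v = line_of_seg w" if col: "collinear (stratum v \<union> stratum w)"
  proof -
  obtain a where a: "a \<in> stratum v" using seg_stratum_nonempty[OF v(1)] by blast
  have "\<not> stratum v \<subseteq> {a}"
  proof
    assume "stratum v \<subseteq> {a}"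
    then have "stratum v = {a}" using a by blast
    then show False using x by simp
  qed
  then obtain b where b: "b \<in> stratum v" "a \<noteq> b" by blast
  obtain c where c: "c \<in> stratum w" using seg_stratum_nonempty[OF v(2)] by blast
  have "collinear {a, b, c}" using col a b c by (auto intro: collinear_subset)
  then have "c \<in> affine hull {a, b}" using b(2) by (rule collinear_3_imp_in_affine_hull)
  also have "affine hull {a, b} \<subseteq> l" using a b vl line l by (intro hull_minimal) auto
  finally have "w l = 0" using c l signs_zero_iff unfolding stratum_def by auto
  then show "line_of_seg v = line_of_seg w" using line_of_seg[OF v(2)] unfolding l_def by simp
  qed
  ultimately show ?thesis by blast
qed

text \<open>Resolving the sign at \<open>l1\<close> means moving along \<open>l2\<close>: a and b
  stand for the two halves of \<open>l2\<close> at x, c and e for those of \<open>l1\<close>. The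
  two excluded patterns are the straight passages along one line.\<close>

lemma node_graph:
  assumes G: "G \<subseteq> segments T D" and x: "x \<in> D" "l1 \<noteq> l2" "signs x l1 = 0" "signs x l2 = 0"
  defines "a \<equiv> stratum ((signs x)(l1 := 1)) \<in> G" and "b \<equiv> stratum ((signs x)(l1 := -1)) \<in> G"
    and "c \<equiv> stratum ((signs x)(l2 := 1)) \<in> G" and "e \<equiv> stratum ((signs x)(l2 := -1)) \<in> G"
  shows "degree G x = of_bool a + of_bool b + of_bool c + of_bool e"
    "x \<in> support G \<longleftrightarrow> a \<or> b \<or> c \<or> e"
    "x \<in> vertices G \<longleftrightarrow> (a \<or> b \<or> c \<or> e) \<and> \<not> (a \<and> b \<and> \<not> c \<and> \<not> e) \<and> \<not> (\<not> a \<and> \<not> b \<and> c \<and> e)"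
proof -
  let ?a = "(signs x)(l1 := 1)" and ?b = "(signs x)(l1 := -1)"
  let ?c = "(signs x)(l2 := 1)" and ?e = "(signs x)(l2 := -1)"
  have "{v \<in> segs. stratum v \<in> G \<and> signs x \<preceq> v \<and> signs x \<noteq> v} = {v \<in> {?a, ?b, ?c, ?e}. stratum v \<in> G}"
    unfolding node_segs[OF x, symmetric] by blast
  then have "segments_at G x = stratum ` {v \<in> {?a, ?b, ?c, ?e}. stratum v \<in> G}"
    using segments_at_eq[OF G x(1)] by simp
  also have "\<dots> = {z \<in> {stratum ?a, stratum ?b, stratum ?c, stratum ?e}. z \<in> G}" by blast
  finally have S: "segments_at G x = {z \<in> {stratum ?a, stratum ?b, stratum ?c, stratum ?e}. z \<in> G}" .
  note dist = node_strata_distinct[OF x]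
  show "degree G x = of_bool a + of_bool b + of_bool c + of_bool e"
    unfolding degree_def S card_four_elements[OF dist] a_def b_def c_def e_def ..
  have "v \<noteq> signs x" if "v \<in> segs" for v
    using line_of_seg[OF that] x(2-4) by metis
  then have "x \<in> support G \<longleftrightarrow> (\<exists>v\<in>{v \<in> segs. signs x \<preceq> v \<and> signs x \<noteq> v}. stratum v \<in> G)"
    unfolding mem_support_iff[OF G x(1)] by blast
  then show "x \<in> support G \<longleftrightarrow> a \<or> b \<or> c \<or> e"
    unfolding node_segs[OF x] a_def b_def c_def e_def by blast
  have seg: "v \<in> segs" "x \<in> closure (stratum v) - stratum v" if "v \<in> {?a, ?b, ?c, ?e}" for v
  proof -
    have v: "v \<in> segs" "signs x \<preceq> v" "signs x \<noteq> v" using that node_segs[OF x] by auto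
    then obtain q where "q \<in> D" "v = signs q" unfolding segs_def by blast
    then show "x \<in> closure (stratum v) - stratum v"
      using mem_closure_stratum[of x q] v x(1) unfolding stratum_def by auto
    show "v \<in> segs" by fact
  qed
  have col: "collinear (stratum v \<union> stratum w) \<longleftrightarrow> line_of_seg v = line_of_seg w"
    if "v \<in> {?a, ?b, ?c, ?e}" "w \<in> {?a, ?b, ?c, ?e}" for v w
    using collinear_strata_iff[OF seg(1)[OF that(1)] seg(1)[OF that(2)] seg(2)[OF that(1)]] .
  have ln: "line_of_seg ?a = l2" "line_of_seg ?b = l2" "line_of_seg ?c = l1" "line_of_seg ?e = l1"
    using node_seg(4)[OF x] node_seg(4)[OF x(1) x(2)[symmetric] x(4,3)] by auto
  have "(\<exists>s t. segments_at G x = {s, t} \<and> s \<noteq> t \<and> collinear (s \<union> t)) \<longleftrightarrow>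
     a \<and> b \<and> \<not> c \<and> \<not> e \<or> \<not> a \<and> \<not> b \<and> c \<and> e"
    unfolding a_def b_def c_def e_def
    by (rule four_elements_pairs[OF dist S]) (use col ln x(2) in auto)
  moreover have "segments_at G x \<noteq> {} \<longleftrightarrow> a \<or> b \<or> c \<or> e"
    unfolding S a_def b_def c_def e_def by blast
  ultimately show "x \<in> vertices G \<longleftrightarrow> (a \<or> b \<or> c \<or> e) \<and> \<not> (a \<and> b \<and> \<not> c \<and> \<not> e) \<and> \<not> (\<not> a \<and> \<not> b \<and> c \<and> e)"
    unfolding vertices_def by blast
qed

lemma vertex_is_node:
  assumes G: "G \<subseteq> segments T D" and x: "x \<in> D" "segments_at G x \<noteq> {}"
  shows "x \<in> nodes T"
proof -
  obtain v where v: "v \<in> segs" "signs x \<preceq> v" "signs x \<noteq> v"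
    using x(2) unfolding segments_at_eq[OF G x(1)] by blast
  have "signs x \<notin> cells" using cells_le v by metis
  then obtain l where l: "signs x l = 0" using x(1) unfolding cells_def by blast
  have "signs x \<notin> segs" using segs_le v by metis
  then obtain m where "signs x m = 0" "m \<noteq> l" using x(1) l unfolding segs_def by blast
  then show ?thesis using nodes_iff[OF x(1)] l by blast
qed

text \<open>A frontier point is not a node, so both segments lie on the same line. The signs at the
  other lines are nonzero at x, hence common to both segments.\<close>

lemma frontier_segments:
  assumes x: "x \<in> frontier D" and s: "s \<in> segments T D" "t \<in> segments T D" "x \<in> closure s" "x \<in> closure t"
  shows "s = t"
proof -
  obtain v w where v: "v \<in> segs" "s = stratum v" "w \<in> segs" "t = stratum w"
    using s unfolding segments_eq by blast
  have zero: "x \<in> m" if "u \<in> segs" "x \<in> closure (stratum u)" "u m = 0" for u m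
  proof -
    have "m \<in> T" using that line_of_seg[OF that(1)] line_of_seg_lines lines_in_T by metis
    then show ?thesis using stratum_subset_line[of u m] that(3) line_closed closure_minimal that(2) by blast
  qed
  define l where "l = line_of_seg v"
  have l: "l \<in> T" "v l = 0" "x \<in> l"
    using v line_of_seg line_of_seg_lines lines_in_T zero s unfolding l_def by auto
  have "line_of_seg w = l"
  proof (rule ccontr)
    assume "line_of_seg w \<noteq> l"
    moreover have "line_of_seg w \<in> T" "x \<in> line_of_seg w"
      using v line_of_seg line_of_seg_lines lines_in_T zero s by auto
    ultimately have "x \<in> nodes T" using l unfolding nodes_def by blast
    then show False using frontier_nodes x by blast
  qed
  then have wl: "w l = 0" using line_of_seg[OF v(3)] by simp
  have "v m = w m" for m
  proof (cases "m = l")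
    case False
    have "signs x m \<noteq> 0"
    proof
      assume "signs x m = 0"
      then have "m \<in> T" "side m x = 0" unfolding signs_def using lines_in_T
        by (auto split: if_splits simp: sgn_zero_iff)
      then have "x \<in> m" using mem_line_iff by simp
      then have "x \<in> nodes T" using l False \<open>m \<in> T\<close> unfolding nodes_def by blast
      then show False using frontier_nodes x by blast
    qed
    then show ?thesis using closure_stratum[of x v] closure_stratum[of x w] s v
      unfolding le_signs_def by metis
  qed (use l wl in simp)
  then show ?thesis using v by (metis ext)
qed

text \<open>Outside \<open>D\<close> the support consists of ends of single segments. As these are
  vertices, edges stay inside \<open>D\<close>.\<close>

lemma frontier_support:
  assumes G: "G \<subseteq> segments T D" and x: "x \<in> support G" "x \<notin> D"
  shows "x \<in> vertices G" "x \<in> frontier D" "degree G x = 1"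
proof -
  obtain s where s: "s \<in> G" "x \<in> closure s" using x unfolding support_def by blast
  have sD: "s \<subseteq> D" using s G unfolding segments_eq stratum_def by auto
  then have "x \<in> closure D" using s closure_mono by blast
  then show fr: "x \<in> frontier D" using x(2) D_open by (simp add: frontier_def interior_open)
  have "segments_at G x = {s}"
    using frontier_segments[OF fr] s sD x(2) G unfolding segments_at_def by blast
  then show "x \<in> vertices G" "degree G x = 1" unfolding vertices_def degree_def by auto
qed

subsection \<open>Edges\<close>

abbreviation line_support :: "point set set \<Rightarrow> point set \<Rightarrow> point set" where
  "line_support G l \<equiv> support {s \<in> G. s \<subseteq> l}"

lemma subset_line_iff:
  assumes "v \<in> segs" shows "stratum v \<subseteq> l \<and> l \<in> T \<longleftrightarrow> v l = 0"
proof
  assume *: "stratum v \<subseteq> l \<and> l \<in> T"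
  obtain p where "p \<in> stratum v" using seg_stratum_nonempty[OF assms] by blast
  then show "v l = 0" using * signs_zero_iff unfolding stratum_def by auto
next
  assume *: "v l = 0"
  then have "l = line_of_seg v" using line_of_seg[OF assms] by simp
  then show "stratum v \<subseteq> l \<and> l \<in> T"
    using stratum_subset_line[of v l] * line_of_seg_lines[OF assms] lines_in_T by blast
qed

lemma mem_line_support_iff:
  assumes "G \<subseteq> segments T D" "l \<in> T" "x \<in> D"
  shows "x \<in> line_support G l \<longleftrightarrow> (\<exists>v\<in>segs. stratum v \<in> G \<and> v l = 0 \<and> signs x \<preceq> v)"
proof -
  have "x \<in> line_support G l \<longleftrightarrow> (\<exists>v\<in>segs. stratum v \<in> {s \<in> G. s \<subseteq> l} \<and> signs x \<preceq> v)"
    using assms by (intro mem_support_iff) auto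
  then show ?thesis using subset_line_iff assms(2) by blast
qed

lemma line_support_subset_support: "line_support G l \<subseteq> support G"
  unfolding support_def by blast

lemma le_signs_zero: "v \<preceq> w \<Longrightarrow> w l = 0 \<Longrightarrow> v l = 0"
  unfolding le_signs_def by metis

text \<open>An edge contains no vertex, so it meets a node only by running straight through on l.
  Resolving the sign at \<open>l'\<close> gives the two halves of l, which belong to the graph;
  resolving the sign at l gives the halves of \<open>l'\<close>, which do not.\<close>

lemma edge_point:
  assumes G: "G \<subseteq> segments T D" and l: "l \<in> T" and p: "p \<in> line_support G l - vertices G"
  shows "p \<in> D" "signs p l = 0"
    "signs p \<in> segs \<and> stratum (signs p) \<in> G \<or>
     (\<exists>l'. l' \<noteq> l \<and> signs p l' = 0 \<and> stratum ((signs p)(l' := 1)) \<in> G \<and> stratum ((signs p)(l' := -1)) \<in> G \<and>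
       stratum ((signs p)(l := 1)) \<notin> G \<and> stratum ((signs p)(l := -1)) \<notin> G)"
proof -
  have pG: "p \<in> support G" using p line_support_subset_support by blast
  then show pD: "p \<in> D" using frontier_support(1)[OF G] p by blast
  obtain v where v: "v \<in> segs" "stratum v \<in> G" "v l = 0" "signs p \<preceq> v"
    using p mem_line_support_iff[OF G l pD] by blast
  then show pl: "signs p l = 0" using le_signs_zero by blast
  show "signs p \<in> segs \<and> stratum (signs p) \<in> G \<or>
     (\<exists>l'. l' \<noteq> l \<and> signs p l' = 0 \<and> stratum ((signs p)(l' := 1)) \<in> G \<and> stratum ((signs p)(l' := -1)) \<in> G \<and>
       stratum ((signs p)(l := 1)) \<notin> G \<and> stratum ((signs p)(l := -1)) \<notin> G)"
  proof (cases "signs p \<in> segs")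
    case True
    then show ?thesis using seg_in_support_iff[OF G pD] pG by blast
  next
    case False
    then obtain l' where l': "l \<noteq> l'" "signs p l' = 0" using pl pD unfolding segs_def by blast
    have "v \<in> {v \<in> segs. signs p \<preceq> v \<and> signs p \<noteq> v}" using v False by auto
    then have "v \<in> {(signs p)(l := 1), (signs p)(l := -1), (signs p)(l' := 1), (signs p)(l' := -1)}"
      unfolding node_segs[OF pD l'(1) pl l'(2)] .
    moreover have "v \<noteq> (signs p)(l := e)" if "e = 1 \<or> e = -1" for e
      using v(3) that by (metis fun_upd_same zero_neq_neg_one zero_neq_one)
    ultimately have "v = (signs p)(l' := 1) \<or> v = (signs p)(l' := -1)" by blast
    then have "stratum ((signs p)(l' := 1)) \<in> G \<or> stratum ((signs p)(l' := -1)) \<in> G"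
      using v(2) by metis
    then show ?thesis using node_graph(3)[OF G pD l'(1) pl l'(2)] p l' by blast
  qed
qed

lemma seg_not_vertex:
  assumes "G \<subseteq> segments T D" "x \<in> D" "signs x \<in> segs"
  shows "x \<notin> vertices G"
proof -
  have "segments_at G x = {}" unfolding segments_at_eq[OF assms(1,2)] using segs_le[OF assms(3)] by blast
  then show ?thesis unfolding vertices_def by blast
qed

lemma seg_subset_line_support:
  assumes G: "G \<subseteq> segments T D" and v: "v \<in> segs" "stratum v \<in> G" "v l = 0"
  shows "stratum v \<subseteq> line_support G l - vertices G"
proof
  fix p assume "p \<in> stratum v"
  then have p: "p \<in> D" "signs p = v" unfolding stratum_def by auto
  have "l \<in> T" using subset_line_iff[OF v(1)] v(3) by blast
  moreover have "signs p \<preceq> v" using p by simp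
  ultimately have "p \<in> line_support G l" using mem_line_support_iff[OF G _ p(1)] v by blast
  moreover have "p \<notin> vertices G" using seg_not_vertex[OF G p(1)] p v by simp
  ultimately show "p \<in> line_support G l - vertices G" by blast
qed

lemma edge_absorbs_seg:
  assumes G: "G \<subseteq> segments T D" and e: "e \<in> components (line_support G l - vertices G)"
    and v: "v \<in> segs" "stratum v \<in> G" "v l = 0" and p: "p \<in> e" "p \<in> D" "signs p \<preceq> v"
  shows "stratum v \<subseteq> e"
proof -
  have "connected (insert p (stratum v))"
    using connected_insert_stratum p v unfolding segs_def by auto
  moreover have "insert p (stratum v) \<subseteq> line_support G l - vertices G"
    using seg_subset_line_support[OF G v] p(1) e in_components_subset by blast
  ultimately have "insert p (stratum v) \<subseteq> e" using components_maximal[OF e] p(1) by blast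
  then show ?thesis by blast
qed

lemma edge_contains_seg:
  assumes G: "G \<subseteq> segments T D" and l: "l \<in> T" and e: "e \<in> components (line_support G l - vertices G)"
  shows "\<exists>v\<in>segs. stratum v \<in> G \<and> v l = 0 \<and> stratum v \<subseteq> e"
proof -
  obtain p where p: "p \<in> e" "p \<in> line_support G l - vertices G"
    using e in_components_nonempty in_components_subset by blast
  then have pD: "p \<in> D" using edge_point[OF G l] by blast
  then obtain v where "v \<in> segs" "stratum v \<in> G" "v l = 0" "signs p \<preceq> v"
    using p mem_line_support_iff[OF G l pD] by blast
  then show ?thesis using edge_absorbs_seg[OF G e _ _ _ p(1) pD] by blast
qed

lemma seg_in_edge:
  assumes G: "G \<subseteq> segments T D" and v: "v \<in> segs" "stratum v \<in> G"
  shows "\<exists>e\<in>edges T G. stratum v \<subseteq> e"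
proof -
  define l where "l = line_of_seg v"
  have l: "v l = 0" "l \<in> T" using v line_of_seg line_of_seg_lines lines_in_T unfolding l_def by auto
  have "connected (stratum v)" "stratum v \<noteq> {}"
    using convex_connected[OF convex_stratum] seg_stratum_nonempty[OF v(1)] by auto
  moreover have "line_support G l - vertices G \<noteq> {}"
    using calculation(2) seg_subset_line_support[OF G v l(1)] by blast
  ultimately obtain e where "e \<in> components (line_support G l - vertices G)" "stratum v \<subseteq> e"
    using exists_component_superset[OF seg_subset_line_support[OF G v l(1)]] by blast
  then show ?thesis using l(2) unfolding edges_def by blast
qed

lemma cell_face_step:
  assumes G: "G \<subseteq> segments T D" and p: "p \<in> D" "v \<in> cells" "w \<in> cells" "signs p \<preceq> v" "signs p \<preceq> w"
    "\<And>m. m \<noteq> l \<Longrightarrow> v m = w m" and notin: "stratum (v(l := 0)) \<notin> G"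
  shows "cell_face G v = cell_face G w"
proof (rule eq_across_line[OF p])
  assume "v(l := 0) \<in> segs" "signs p \<preceq> v(l := 0)" "line_of_seg (v(l := 0)) = l"
  then show "cell_face G (v(l := 1)) = cell_face G (v(l := -1))"
    using cell_face_eq_across[OF G _ notin] by simp
qed

text \<open>Distinct cells at p on the same side of l occur only at a node. There the segment
  between them lies on the line that crosses the edge, hence not in G.\<close>

lemma cell_face_along_edge:
  assumes G: "G \<subseteq> segments T D" and l: "l \<in> T" and p: "p \<in> line_support G l - vertices G"
    and vw: "v \<in> cells" "w \<in> cells" "signs p \<preceq> v" "signs p \<preceq> w" "v l = w l"
  shows "cell_face G v = cell_face G w"
proof -
  note ep = edge_point[OF G l p]
  show ?thesis
  proof (cases "\<exists>l'. l' \<noteq> l \<and> signs p l' = 0")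
    case False
    have "v m = w m" for m
    proof (cases "m = l")
      case False
      then have "signs p m \<noteq> 0" using \<open>\<nexists>l'. l' \<noteq> l \<and> signs p l' = 0\<close> by blast
      then show ?thesis using vw(3,4) unfolding le_signs_def by metis
    qed (use vw in simp)
    then have "v = w" ..
    then show ?thesis by simp
  next
    case True
    then obtain l' where l': "l' \<noteq> l" "signs p l' = 0" by blast
    then have "signs p \<notin> segs" using ep(2) line_of_seg by metis
    then have notin: "stratum ((signs p)(l := 1)) \<notin> G" "stratum ((signs p)(l := -1)) \<notin> G"
      using ep(3) no_three_zeros[OF ep(1) ep(2) l'(2) l'(1)[symmetric]] by blast+
    have other: "signs p m \<noteq> 0" if "m \<noteq> l" "m \<noteq> l'" for m
      using no_three_zeros[OF ep(1) ep(2) l'(2) l'(1)[symmetric]] that by blast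
    \<comment> \<open>The segment between v and w is the half of \<open>l'\<close> on that side of l
      where both cells lie.\<close>
    have eq: "v(l' := 0) = (signs p)(l := v l)"
    proof
      fix m show "(v(l' := 0)) m = ((signs p)(l := v l)) m"
        using other[of m] vw(3) l' unfolding le_signs_def by (cases "m = l"; cases "m = l'") auto
    qed
    have "v l = 1 \<or> v l = -1"
      using vw(1) signs_image_values[of v l] unfolding cells_def by auto
    then have "stratum (v(l' := 0)) \<notin> G" unfolding eq using notin by metis
    moreover have "v m = w m" if "m \<noteq> l'" for m
      using other[of m] vw(3,4,5) that unfolding le_signs_def by metis
    ultimately show ?thesis using cell_face_step[OF G ep(1) vw(1-4)] by blast
  qed
qed

lemma exists_cell_above_with:
  assumes "p \<in> D" "signs p l = 0" "\<epsilon> = 1 \<or> \<epsilon> = -1" shows "\<exists>v\<in>cells. signs p \<preceq> v \<and> v l = \<epsilon>"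
proof -
  obtain u where u: "u \<in> cells" "signs p \<preceq> u" using exists_cell_above[OF assms(1)] by blast
  define v where "v = u(l := \<epsilon>)"
  have "signs p \<preceq> v" using u(2) assms(2) unfolding le_signs_def v_def by auto
  moreover have "v \<in> signs ` D" using calculation assms u signs_image_values unfolding cells_def
    by (intro realizable[of p]) (auto simp: v_def)
  moreover have "\<forall>m. v m \<noteq> 0" using u(1) assms(3) unfolding cells_def v_def by auto
  moreover have "v l = \<epsilon>" by (simp add: v_def)
  ultimately show ?thesis unfolding cells_def by blast
qed

lemma edge_in_closure_face:
  assumes G: "G \<subseteq> segments T D" and l: "l \<in> T" and e: "e \<in> components (line_support G l - vertices G)"
    and v: "v \<in> segs" "v l = 0" "stratum v \<subseteq> e" and \<epsilon>: "\<epsilon> = 1 \<or> \<epsilon> = -1"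
  shows "e \<subseteq> closure (cell_face G (v(l := \<epsilon>)))"
proof
  fix q assume q: "q \<in> e"
  have sub: "e \<subseteq> line_support G l - vertices G" and con: "connected e"
    using e in_components_subset in_components_connected by blast+
  have above: "\<exists>u\<in>cells. signs p \<preceq> u \<and> u l = \<epsilon>" if "p \<in> e" for p
    using exists_cell_above_with[OF _ _ \<epsilon>] edge_point[OF G l] sub that by blast
  obtain p where p: "p \<in> stratum v" using seg_stratum_nonempty[OF v(1)] by blast
  obtain u where u: "u \<in> cells" "signs q \<preceq> u" "u l = \<epsilon>" using above q by blast
  have lv: "line_of_seg v = l" using line_of_seg[OF v(1)] v(2) by simp
  have "cell_face G (v(l := \<epsilon>)) = cell_face G u"
  proof (rule cells_constant_along[OF con _ above _ _ _ _ _ q u])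
    show "e \<subseteq> D" using edge_point(1)[OF G l] sub by blast
    show "cell_face G x = cell_face G y"
      if "a \<in> e" "x \<in> cells" "y \<in> cells" "signs a \<preceq> x" "signs a \<preceq> y" "x l = \<epsilon>" "y l = \<epsilon>" for a x y
      by (rule cell_face_along_edge[OF G l _ that(2-5)]) (use that sub in auto)
    show "v(l := \<epsilon>) \<in> cells" using update_cell[OF v(1), of \<epsilon>] \<epsilon> lv by auto
    show "signs p \<preceq> v(l := \<epsilon>)" using p seg_le_update[OF v(1)] lv unfolding stratum_def by auto
  qed (use p v in auto)
  moreover have "q \<in> closure (stratum u)"
  proof -
    obtain r where "r \<in> D" "u = signs r" using u unfolding cells_def by blast
    moreover have "q \<in> D" using edge_point(1)[OF G l] q sub by blast
    ultimately show ?thesis using mem_closure_stratum u by blast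
  qed
  ultimately show "q \<in> closure (cell_face G (v(l := \<epsilon>)))"
    using closure_mono[OF cell_face_face(2)[OF G u(1)]] by auto
qed

text \<open>The face has points arbitrarily close to a point of the segment. They avoid the segment,
  which belongs to the graph, so they lie in one of the two cells beside it.\<close>

lemma face_beside_seg:
  assumes G: "G \<subseteq> segments T D" and v: "v \<in> segs" "stratum v \<in> G" "v l = 0"
    and F: "F \<in> faces D G" "stratum v \<subseteq> closure F"
  shows "F = cell_face G (v(l := 1)) \<or> F = cell_face G (v(l := -1))"
proof -
  have lv: "line_of_seg v = l" using line_of_seg[OF v(1)] v(3) by simp
  obtain p where p: "p \<in> stratum v" using seg_stratum_nonempty[OF v(1)] by blast
  then have pD: "p \<in> D" "signs p = v" unfolding stratum_def by auto
  have "p \<in> closure F" using p F by blast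
  then have "\<exists>\<^sub>F q in nhds p. q \<in> F"
    by (simp add: closure_iff_nhds_not_empty frequently_def eventually_nhds) blast
  then have "\<exists>\<^sub>F q in nhds p. q \<in> F \<and> signs p \<preceq> signs q"
    using eventually_le_signs frequently_eventually_frequently by fastforce
  then obtain q where q: "q \<in> F" "v \<preceq> signs q" using pD by (auto dest!: frequently_ex)
  have qD: "q \<in> D - support G" using q(1) F(1) in_components_subset unfolding faces_def by blast
  have "signs q l \<noteq> 0"
  proof
    assume 0: "signs q l = 0"
    have "v m = signs q m" for m
      using q(2) 0 v(3) line_of_seg[OF v(1)] unfolding le_signs_def by metis
    then have "signs q = v" by (metis ext)
    then show False using seg_in_support_iff[OF G, of q] v qD by auto
  qed
  then have "signs q l = 1 \<or> signs q l = -1" using signs_values[of q l] by auto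
  moreover have "signs q = v(l := signs q l)"
  proof
    fix m show "signs q m = (v(l := signs q l)) m"
      using q(2) line_of_seg[OF v(1)] lv unfolding le_signs_def by (cases "m = l") auto
  qed
  moreover have "cell_face G (signs q) = F" if "signs q \<in> cells"
    using cell_face_unique(1)[OF G that qD _ F(1) q(1)] by simp
  ultimately show ?thesis using update_cell[OF v(1)] lv
    by (metis insertCI)
qed

lemma node_graph_of:
  assumes x: "x \<in> D" "l1 \<noteq> l2" "signs x l1 = 0" "signs x l2 = 0" and e: "e = 1 \<or> e = -1"
  shows "stratum ((signs x)(l1 := e)) \<in> graph_of \<kappa> \<longleftrightarrow>
    \<kappa> ((signs x)(l1 := e, l2 := 1)) \<noteq> \<kappa> ((signs x)(l1 := e, l2 := -1))"
  using stratum_in_graph_of[OF node_seg(1)[OF x e]] node_seg(4)[OF x e] by simp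

lemma node_obtain:
  assumes "x \<in> nodes T \<inter> D"
  obtains l1 l2 where "x \<in> D" "l1 \<noteq> l2" "signs x l1 = 0" "signs x l2 = 0"
  using assms nodes_iff[of x] by blast

text \<open>Only degree one has to be excluded: the colours of the four cells form a cycle around
  the node, and a cycle cannot change its value exactly once.\<close>

lemma graph_of_degree:
  assumes "x \<in> vertices (graph_of \<kappa>) \<inter> D"
  shows "degree (graph_of \<kappa>) x \<in> {2, 3, 4}"
proof -
  note G = graph_of_segments[of \<kappa>]
  have "segments_at (graph_of \<kappa>) x \<noteq> {}" using assms unfolding vertices_def by blast
  then have "x \<in> nodes T \<inter> D" using vertex_is_node[OF G] assms by blast
  then obtain l1 l2 where x: "x \<in> D" "l1 \<noteq> l2" "signs x l1 = 0" "signs x l2 = 0" by (rule node_obtain)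
  note x' = x(1) x(2)[symmetric] x(4,3)
  have tw: "(signs x)(l2 := a, l1 := b) = (signs x)(l1 := b, l2 := a)" for a b
    using x(2) by (rule fun_upd_twist[symmetric])
  show ?thesis
    using assms node_graph(3)[OF G x] unfolding node_graph(1)[OF G x]
    unfolding node_graph_of[OF x disjI1[OF refl]] node_graph_of[OF x disjI2[OF refl]]
      node_graph_of[OF x' disjI1[OF refl]] node_graph_of[OF x' disjI2[OF refl]] tw
    by (auto simp: of_bool_def)
qed

lemma edge_between_faces:
  assumes "e \<in> edges T (graph_of \<kappa>)"
  obtains l v where "v \<in> segs" "v l = 0" "stratum v \<in> graph_of \<kappa>" "stratum v \<subseteq> e"
    "e \<subseteq> closure (cell_face (graph_of \<kappa>) (v(l := 1)))" "e \<subseteq> closure (cell_face (graph_of \<kappa>) (v(l := -1)))"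
    "v(l := 1) \<in> cells" "v(l := -1) \<in> cells" "\<kappa> (v(l := 1)) \<noteq> \<kappa> (v(l := -1))"
proof -
  note G = graph_of_segments[of \<kappa>]
  obtain l where l: "l \<in> T" "e \<in> components (line_support (graph_of \<kappa>) l - vertices (graph_of \<kappa>))"
    using assms unfolding edges_def by blast
  obtain v where v: "v \<in> segs" "stratum v \<in> graph_of \<kappa>" "v l = 0" "stratum v \<subseteq> e"
    using edge_contains_seg[OF G l] by blast
  have lv: "line_of_seg v = l" using line_of_seg[OF v(1)] v(3) by simp
  show ?thesis
  proof (rule that[of v l])
    show "e \<subseteq> closure (cell_face (graph_of \<kappa>) (v(l := 1)))" "e \<subseteq> closure (cell_face (graph_of \<kappa>) (v(l := -1)))"
      using edge_in_closure_face[OF G l v(1,3,4)] by auto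
    show "v(l := 1) \<in> cells" "v(l := -1) \<in> cells"
      using update_cell[OF v(1), of 1] update_cell[OF v(1), of "-1"] lv by auto
    show "\<kappa> (v(l := 1)) \<noteq> \<kappa> (v(l := -1))"
      using stratum_in_graph_of[OF v(1), of \<kappa>] v(2) lv by simp
  qed (use v in auto)
qed

subsection \<open>Configurations as colourings\<close>

text \<open>Any cell of a face may represent it, since the cells of a face share their colour by
  \<open>colour_constant_on_faces\<close>. The restriction supplies the value
  \<open>undefined\<close> off the faces that configurations require.\<close>

definition configuration_of :: "((point set \<Rightarrow> real) \<Rightarrow> nat) \<Rightarrow> point set set \<times> (point set \<Rightarrow> nat)" where
  "configuration_of \<kappa> = (graph_of \<kappa>,
     \<lambda>F\<in>faces D (graph_of \<kappa>). \<kappa> (SOME v. v \<in> cells \<and> cell_face (graph_of \<kappa>) v = F))"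

lemma configuration_of_cell:
  assumes "v \<in> cells"
  shows "snd (configuration_of \<kappa>) (cell_face (graph_of \<kappa>) v) = \<kappa> v"
proof -
  define w where "w = (SOME w. w \<in> cells \<and> cell_face (graph_of \<kappa>) w = cell_face (graph_of \<kappa>) v)"
  have "w \<in> cells \<and> cell_face (graph_of \<kappa>) w = cell_face (graph_of \<kappa>) v"
    unfolding w_def
    using assms someI[of "\<lambda>w. w \<in> cells \<and> cell_face (graph_of \<kappa>) w = cell_face (graph_of \<kappa>) v" v] by simp
  then have "\<kappa> w = \<kappa> v" using colour_constant_on_faces assms by blast
  then show ?thesis using cell_face_face(1)[OF graph_of_segments assms]
    unfolding configuration_of_def w_def by simp
qed

lemma configuration_of_admissible:
  assumes \<kappa>: "\<kappa> \<in> cells \<rightarrow>\<^sub>E {1..k}"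
  shows "configuration_of \<kappa> \<in> admissible_configurations T D k"
proof -
  note G = graph_of_segments[of \<kappa>]
  define c where "c = snd (configuration_of \<kappa>)"
  have eq: "configuration_of \<kappa> = (graph_of \<kappa>, c)" unfolding c_def configuration_of_def by simp
  have c: "c (cell_face (graph_of \<kappa>) v) = \<kappa> v" if "v \<in> cells" for v
    using configuration_of_cell[OF that] unfolding c_def .
  have colouring: "c \<in> faces D (graph_of \<kappa>) \<rightarrow>\<^sub>E {1..k}"
  proof (rule PiE_I)
    fix F assume "F \<in> faces D (graph_of \<kappa>)"
    then obtain v where v: "v \<in> cells" "cell_face (graph_of \<kappa>) v = F" using cell_face_surj[OF G] by blast
    then have "c F = \<kappa> v" using c by blast
    then show "c F \<in> {1..k}" using PiE_mem[OF \<kappa> v(1)] by simp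
  next
    fix F assume "F \<notin> faces D (graph_of \<kappa>)"
    then show "c F = undefined" unfolding c_def configuration_of_def by simp
  qed
  have boundary: "degree (graph_of \<kappa>) x = 1" if "x \<in> vertices (graph_of \<kappa>) \<inter> frontier D" for x
  proof -
    have "x \<notin> D" using that D_open by (auto simp: frontier_def interior_open)
    moreover have "x \<in> support (graph_of \<kappa>)"
      using that unfolding vertices_def segments_at_def support_def by blast
    ultimately show ?thesis using frontier_support(3)[OF G] by blast
  qed
  have two_faces: "\<exists>F1\<in>faces D (graph_of \<kappa>). \<exists>F2\<in>faces D (graph_of \<kappa>). F1 \<noteq> F2 \<and> e \<subseteq> closure F1 \<inter> closure F2"
    if e: "e \<in> edges T (graph_of \<kappa>)" for e
  proof -
    obtain l v where v: "v \<in> segs" "v l = 0" "stratum v \<in> graph_of \<kappa>" "stratum v \<subseteq> e"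
      "e \<subseteq> closure (cell_face (graph_of \<kappa>) (v(l := 1)))" "e \<subseteq> closure (cell_face (graph_of \<kappa>) (v(l := -1)))"
      "v(l := 1) \<in> cells" "v(l := -1) \<in> cells" "\<kappa> (v(l := 1)) \<noteq> \<kappa> (v(l := -1))"
      by (rule edge_between_faces[OF e])
    have "cell_face (graph_of \<kappa>) (v(l := 1)) \<noteq> cell_face (graph_of \<kappa>) (v(l := -1))"
      using colour_constant_on_faces[OF v(7,8)] v(9) by blast
    then show ?thesis using v(5,6) cell_face_face(1)[OF G v(7)] cell_face_face(1)[OF G v(8)] by blast
  qed
  have proper: "c F1 \<noteq> c F2"
    if F: "F1 \<in> faces D (graph_of \<kappa>)" "F2 \<in> faces D (graph_of \<kappa>)" "F1 \<noteq> F2"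
      and e: "e \<in> edges T (graph_of \<kappa>)" "e \<subseteq> closure F1 \<inter> closure F2" for F1 F2 e
  proof -
    obtain l v where v: "v \<in> segs" "v l = 0" "stratum v \<in> graph_of \<kappa>" "stratum v \<subseteq> e"
      "e \<subseteq> closure (cell_face (graph_of \<kappa>) (v(l := 1)))" "e \<subseteq> closure (cell_face (graph_of \<kappa>) (v(l := -1)))"
      "v(l := 1) \<in> cells" "v(l := -1) \<in> cells" "\<kappa> (v(l := 1)) \<noteq> \<kappa> (v(l := -1))"
      by (rule edge_between_faces[OF e(1)])
    have "F1 = cell_face (graph_of \<kappa>) (v(l := 1)) \<or> F1 = cell_face (graph_of \<kappa>) (v(l := -1))"
      "F2 = cell_face (graph_of \<kappa>) (v(l := 1)) \<or> F2 = cell_face (graph_of \<kappa>) (v(l := -1))"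
      using face_beside_seg[OF G v(1,3,2)] F e v(4) by auto
    then show ?thesis using F(3) c[OF v(7)] c[OF v(8)] v(9) by auto
  qed
  show ?thesis
    unfolding eq admissible_configurations_def mem_Collect_eq prod.case
  proof (intro conjI ballI impI)
    fix F1 F2 assume "F1 \<in> faces D (graph_of \<kappa>)" "F2 \<in> faces D (graph_of \<kappa>)"
      "F1 \<noteq> F2 \<and> (\<exists>e\<in>edges T (graph_of \<kappa>). e \<subseteq> closure F1 \<inter> closure F2)"
    then show "c F1 \<noteq> c F2" using proper by (elim conjE bexE)
  qed (rule G graph_of_degree boundary colouring two_faces, assumption?)+
qed

lemma configuration_of_inj: "inj_on configuration_of (cells \<rightarrow>\<^sub>E {1..k})"
proof (rule inj_onI)
  fix \<kappa> \<mu> assume *: "\<kappa> \<in> cells \<rightarrow>\<^sub>E {1..k}" "\<mu> \<in> cells \<rightarrow>\<^sub>E {1..k}" "configuration_of \<kappa> = configuration_of \<mu>"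
  then have "graph_of \<kappa> = graph_of \<mu>" unfolding configuration_of_def by blast
  then have "\<kappa> v = \<mu> v" if "v \<in> cells" for v
    using configuration_of_cell[OF that, of \<kappa>] configuration_of_cell[OF that, of \<mu>] *(3) by simp
  then show "\<kappa> = \<mu>" using *(1,2) by (intro PiE_ext) auto
qed

text \<open>Give each cell the colour of its face. By admissibility a segment of G borders two
  distinct faces, of different colours; a segment outside G has the same face on both sides. So the
  graph of this colouring is G.\<close>

lemma configuration_of_surj:
  assumes "\<theta> \<in> admissible_configurations T D k"
  shows "\<exists>\<kappa>\<in>cells \<rightarrow>\<^sub>E {1..k}. configuration_of \<kappa> = \<theta>"
proof -
  obtain G c where \<theta>: "\<theta> = (G, c)" by (cases \<theta>)
  note adm = assms[unfolded \<theta> admissible_configurations_def mem_Collect_eq prod.case]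
  have G: "G \<subseteq> segments T D" using adm by (elim conjE)
  have c: "c \<in> faces D G \<rightarrow>\<^sub>E {1..k}" using adm by (elim conjE)
  have e1: "\<forall>e\<in>edges T G. \<exists>F\<^sub>1\<in>faces D G. \<exists>F\<^sub>2\<in>faces D G. F\<^sub>1 \<noteq> F\<^sub>2 \<and> e \<subseteq> closure F\<^sub>1 \<inter> closure F\<^sub>2"
    using adm by (elim conjE)
  have "\<forall>F\<^sub>1\<in>faces D G. \<forall>F\<^sub>2\<in>faces D G.
      F\<^sub>1 \<noteq> F\<^sub>2 \<and> (\<exists>e\<in>edges T G. e \<subseteq> closure F\<^sub>1 \<inter> closure F\<^sub>2) \<longrightarrow> c F\<^sub>1 \<noteq> c F\<^sub>2"
    using adm by (elim conjE)
  then have e2: "c F\<^sub>1 \<noteq> c F\<^sub>2" if "F\<^sub>1 \<in> faces D G" "F\<^sub>2 \<in> faces D G" "F\<^sub>1 \<noteq> F\<^sub>2" "e \<in> edges T G"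
    "e \<subseteq> closure F\<^sub>1 \<inter> closure F\<^sub>2" for F\<^sub>1 F\<^sub>2 e
    using that(1-3) bexI[of "\<lambda>e. e \<subseteq> closure F\<^sub>1 \<inter> closure F\<^sub>2", OF that(5,4)] by simp
  define \<kappa> where "\<kappa> = (\<lambda>v\<in>cells. c (cell_face G v))"
  have \<kappa>: "\<kappa> \<in> cells \<rightarrow>\<^sub>E {1..k}" using c cell_face_face(1)[OF G] unfolding \<kappa>_def by auto
  have mem: "stratum v \<in> G \<longleftrightarrow> stratum v \<in> graph_of \<kappa>" if v: "v \<in> segs" for v
  proof -
    define l where "l = line_of_seg v"
    have vl: "v l = 0" using line_of_seg[OF v] unfolding l_def by simp
    have cell: "v(l := 1) \<in> cells" "v(l := -1) \<in> cells"
      using update_cell[OF v] unfolding l_def by auto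
    have iff: "stratum v \<in> graph_of \<kappa> \<longleftrightarrow> c (cell_face G (v(l := 1))) \<noteq> c (cell_face G (v(l := -1)))"
      using stratum_in_graph_of[OF v, of \<kappa>] cell unfolding l_def \<kappa>_def by simp
    show ?thesis
    proof (cases "stratum v \<in> G")
      case True
      obtain e where e: "e \<in> edges T G" "stratum v \<subseteq> e" using seg_in_edge[OF G v True] by blast
      obtain F1 F2 where F: "F1 \<in> faces D G" "F2 \<in> faces D G" "F1 \<noteq> F2" "e \<subseteq> closure F1 \<inter> closure F2"
        using bspec[OF e1 e(1)] by blast
      have "F1 = cell_face G (v(l := 1)) \<or> F1 = cell_face G (v(l := -1))"
        "F2 = cell_face G (v(l := 1)) \<or> F2 = cell_face G (v(l := -1))"
        using face_beside_seg[OF G v True vl] F e(2) by auto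
      moreover have "c F1 \<noteq> c F2" by (rule e2[OF F(1-3) e(1) F(4)])
      ultimately have "c (cell_face G (v(l := 1))) \<noteq> c (cell_face G (v(l := -1)))" using F(3) by metis
      then show ?thesis using iff True by blast
    next
      case False
      then have "cell_face G (v(l := 1)) = cell_face G (v(l := -1))"
        using cell_face_eq_across[OF G v] unfolding l_def by simp
      then show ?thesis using iff False by simp
    qed
  qed
  have GG: "graph_of \<kappa> = G"
  proof -
    have "graph_of \<kappa> \<subseteq> stratum ` segs" "G \<subseteq> stratum ` segs"
      using graph_of_segments[of \<kappa>] G segments_eq by auto
    then show ?thesis using mem by blast
  qed
  have "snd (configuration_of \<kappa>) F = c F" for F
  proof (cases "F \<in> faces D G")
    case True
    then obtain v where v: "v \<in> cells" "cell_face G v = F" using cell_face_surj[OF G] by blast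
    then have "snd (configuration_of \<kappa>) F = \<kappa> v" using configuration_of_cell[OF v(1), of \<kappa>] GG by simp
    then show ?thesis using v unfolding \<kappa>_def by simp
  next
    case False
    then show ?thesis using c GG unfolding configuration_of_def by auto
  qed
  then have "snd (configuration_of \<kappa>) = c" ..
  then have "configuration_of \<kappa> = \<theta>" unfolding \<theta> using GG unfolding configuration_of_def by simp
  then show ?thesis using \<kappa> by blast
qed

lemma bij_betw_configuration_of:
  "bij_betw configuration_of (cells \<rightarrow>\<^sub>E {1..k}) (admissible_configurations T D k)"
  unfolding bij_betw_def using configuration_of_inj configuration_of_admissible configuration_of_surj
  by blast

section \<open>Short steps inside the window\<close>

lemma D_combination: "x \<in> D \<Longrightarrow> y \<in> D \<Longrightarrow> 0 \<le> t \<Longrightarrow> t \<le> 1 \<Longrightarrow> (1 - t) *\<^sub>R x + t *\<^sub>R y \<in> D"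
  using D_convex unfolding convex_alt by blast

text \<open>Combined with quasiconvexity, this turns a distant point y that is lower than p into a
  lower point of a stratum touching p.\<close>

lemma step_toward:
  assumes "p \<in> D" "y \<in> D"
  shows "\<exists>t>0. t < 1 \<and> signs p \<preceq> signs ((1 - t) *\<^sub>R p + t *\<^sub>R y) \<and>
    (\<forall>l. signs p l = 0 \<longrightarrow> signs ((1 - t) *\<^sub>R p + t *\<^sub>R y) l = signs y l)"
proof -
  have lim: "((\<lambda>t. (1 - t) *\<^sub>R p + t *\<^sub>R y) \<longlongrightarrow> (1 - 0) *\<^sub>R p + 0 *\<^sub>R y) (at_right 0)"
    by (intro tendsto_intros)
  then have "eventually (\<lambda>t. signs p \<preceq> signs ((1 - t) *\<^sub>R p + t *\<^sub>R y)) (at_right 0)"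
    using eventually_compose_filterlim[OF eventually_le_signs[of p]] by simp
  moreover have "eventually (\<lambda>t. t < 1) (at_right (0::real))"
    by (rule order_tendstoD[OF tendsto_ident_at]) simp
  ultimately have ev: "eventually (\<lambda>t. 0 < t \<and> t < 1 \<and> signs p \<preceq> signs ((1 - t) *\<^sub>R p + t *\<^sub>R y)) (at_right 0)"
    using eventually_at_right_less[of "0::real"] by eventually_elim auto
  obtain t where t: "0 < t \<and> t < 1 \<and> signs p \<preceq> signs ((1 - t) *\<^sub>R p + t *\<^sub>R y)"
    using eventually_happens'[OF trivial_limit_at_right_real ev] ..
  have "signs ((1 - t) *\<^sub>R p + t *\<^sub>R y) l = signs y l" if "signs p l = 0" for l
  proof -
    have L: "l \<in> lines" using signs_zero_lines that by blast
    have "side l p = 0" using that L by (simp add: signs_def sgn_zero_iff)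
    then show ?thesis using t L by (simp add: signs_def sgn_mult side_combination)
  qed
  then show ?thesis using t by blast
qed

end

subsection \<open>Birth points\<close>

locale swept_window = tessellated_window +
  fixes h :: "point \<Rightarrow> real"
  assumes h_quasiconvex: "x \<in> D \<Longrightarrow> y \<in> D \<Longrightarrow> x \<noteq> y \<Longrightarrow> 0 < t \<Longrightarrow> t < 1 \<Longrightarrow>
      h ((1 - t) *\<^sub>R x + t *\<^sub>R y) < max (h x) (h y)"
    and h_attains: "closed C \<Longrightarrow> C \<inter> D \<noteq> {} \<Longrightarrow> \<exists>x\<in>C \<inter> D. \<forall>y\<in>C \<inter> D. h x \<le> h y"
    and h_node: "x \<in> nodes T \<inter> D \<Longrightarrow> l \<in> T \<Longrightarrow> x \<in> l \<Longrightarrow> \<exists>y\<in>l \<inter> D. h y < h x"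
    and h_line: "\<exists>q\<in>D. \<forall>l\<in>T. \<forall>y\<in>l \<inter> D. h q < h y"
begin

text \<open>Once h has increased along a segment, strict quasiconvexity forces a still larger value
  at the far end.\<close>

lemma h_beyond:
  assumes "y \<in> D" "z \<in> D" "0 < t" "t < 1" "x = (1 - t) *\<^sub>R y + t *\<^sub>R z" "h y < h x"
  shows "h x < h z"
proof -
  have "y \<noteq> z"
  proof
    assume "y = z"
    then have "x = y" using assms(5) by (simp add: scaleR_left_diff_distrib)
    then show False using assms(6) by simp
  qed
  then have "h x < max (h y) (h z)" using h_quasiconvex[of y z t] assms by simp
  then show ?thesis using assms(6) by linarith
qed

lemma min_unique:
  assumes "convex C" "x \<in> C \<inter> D" "y \<in> C \<inter> D" "\<And>z. z \<in> C \<inter> D \<Longrightarrow> h x \<le> h z" "h y \<le> h x"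
  shows "x = y"
proof (rule ccontr)
  assume "x \<noteq> y"
  then have "h ((1 - 1/2) *\<^sub>R x + (1/2) *\<^sub>R y) < max (h x) (h y)"
    using assms by (intro h_quasiconvex) auto
  also have "\<dots> = h x" using assms(5) by simp
  finally have "h ((1 - 1/2) *\<^sub>R x + (1/2) *\<^sub>R y) < h x" .
  moreover have "(1 - 1/2) *\<^sub>R x + (1/2) *\<^sub>R y \<in> C \<inter> D"
    using assms D_combination[of x y "1/2"] convexD_alt[OF assms(1), of x y "1/2"] by auto
  ultimately show False using assms(4) by fastforce
qed

text \<open>Taken over the closure inside \<open>D\<close>, since the sweep in general reaches a
  cell first at a boundary point. The definition serves cells and segments alike.\<close>

definition birth :: "(point set \<Rightarrow> real) \<Rightarrow> point" where
  "birth v = (SOME x. x \<in> closure (stratum v) \<inter> D \<and> (\<forall>y\<in>closure (stratum v) \<inter> D. h x \<le> h y))"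

lemma below_iff:
  assumes "v \<in> signs ` D" "x \<in> D"
  shows "x \<in> closure (stratum v) \<longleftrightarrow> signs x \<preceq> v"
proof -
  obtain q where "q \<in> D" "v = signs q" using assms by auto
  then show ?thesis using mem_closure_stratum[of x q] closure_stratum[of x v] assms by auto
qed

lemma birth:
  assumes v: "v \<in> signs ` D"
  shows "birth v \<in> D" "signs (birth v) \<preceq> v" "\<And>y. y \<in> D \<Longrightarrow> signs y \<preceq> v \<Longrightarrow> h (birth v) \<le> h y"
proof -
  obtain q where "q \<in> stratum v" using stratum_nonempty[OF v] by blast
  moreover have "stratum v \<subseteq> D" unfolding stratum_def by blast
  ultimately have "q \<in> closure (stratum v) \<inter> D" using closure_subset by blast
  then have "\<exists>x. x \<in> closure (stratum v) \<inter> D \<and> (\<forall>y\<in>closure (stratum v) \<inter> D. h x \<le> h y)"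
    using h_attains[of "closure (stratum v)"] by auto
  from someI_ex[OF this]
  have *: "birth v \<in> closure (stratum v) \<inter> D \<and> (\<forall>y\<in>closure (stratum v) \<inter> D. h (birth v) \<le> h y)"
    unfolding birth_def[symmetric] .
  then show 1: "birth v \<in> D" by blast
  show "signs (birth v) \<preceq> v" using * below_iff[OF v 1] by blast
  show "h (birth v) \<le> h y" if "y \<in> D" "signs y \<preceq> v" for y
    using * below_iff[OF v that(1)] that by blast
qed

lemma birth_eqI:
  assumes v: "v \<in> signs ` D" and x: "x \<in> D" "signs x \<preceq> v" "\<And>y. y \<in> D \<Longrightarrow> signs y \<preceq> v \<Longrightarrow> h x \<le> h y"
  shows "birth v = x"
proof -
  note b = birth[OF v]
  have "convex (closure (stratum v))" using convex_stratum by (rule convex_closure)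
  then show ?thesis
    using min_unique[of "closure (stratum v)" "birth v" x] b below_iff[OF v] x b by blast
qed

lemma birth_less:
  assumes v: "v \<in> signs ` D" and y: "y \<in> D" "signs y \<preceq> v" "y \<noteq> birth v"
  shows "h (birth v) < h y"
proof (rule ccontr)
  assume "\<not> ?thesis"
  then have "birth v = y" using birth[OF v] y(1,2) by (intro birth_eqI[OF v]) force+
  then show False using y by simp
qed

text \<open>If y is lower, so are the points near the birth point in the direction of y. They are
  outside the closure of the stratum, so some line through the birth point has y on a forbidden
  side. Applied to a few test points y, this determines v at the lines through its birth
  point.\<close>

lemma birth_no_descent:
  assumes v: "v \<in> signs ` D" and y: "y \<in> D" "h y < h (birth v)"
  shows "\<exists>l. signs (birth v) l = 0 \<and> signs y l \<noteq> 0 \<and> signs y l \<noteq> v l"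
proof -
  define p where "p = birth v"
  have p: "p \<in> D" "signs p \<preceq> v" "p \<noteq> y" using birth[OF v] y unfolding p_def by auto
  obtain t where t: "t > 0" "t < 1" "signs p \<preceq> signs ((1 - t) *\<^sub>R p + t *\<^sub>R y)"
    "\<And>l. signs p l = 0 \<Longrightarrow> signs ((1 - t) *\<^sub>R p + t *\<^sub>R y) l = signs y l"
    using step_toward[OF p(1) y(1)] by blast
  define z where "z = (1 - t) *\<^sub>R p + t *\<^sub>R y"
  have zD: "z \<in> D" unfolding z_def using D_combination p(1) y(1) t by simp
  have "h z < max (h p) (h y)" unfolding z_def using h_quasiconvex p y t by blast
  then have "h z < h p" using y(2) unfolding p_def by simp
  then have "\<not> signs z \<preceq> v" using birth(3)[OF v zD] unfolding p_def by fastforce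
  then obtain l where l: "signs z l \<noteq> 0" "signs z l \<noteq> v l" unfolding le_signs_def by blast
  have pl: "signs p l = 0"
    using l p(2) t(3) unfolding z_def le_signs_def by metis
  then have "signs z l = signs y l" using t(4) unfolding z_def by blast
  then show ?thesis using l pl unfolding p_def by metis
qed

section \<open>Minima on lines and on the window\<close>

definition line_birth :: "point set \<Rightarrow> point" where
  "line_birth l = (SOME x. x \<in> l \<inter> D \<and> (\<forall>y\<in>l \<inter> D. h x \<le> h y))"

text \<open>By \<open>h_node\<close> the minimum on a line is not a node, so it lies inside a
  segment, where the sweep enters the line.\<close>

lemma line_birth:
  assumes l: "l \<in> lines"
  shows "line_birth l \<in> D" "signs (line_birth l) l = 0" "\<And>y. y \<in> D \<Longrightarrow> signs y l = 0 \<Longrightarrow> h (line_birth l) \<le> h y"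
    "line_birth l \<notin> nodes T" "signs (line_birth l) \<in> segs"
    "line_of_seg (signs (line_birth l)) = l" "birth (signs (line_birth l)) = line_birth l"
proof -
  have lT: "l \<in> T" "l \<inter> D \<noteq> {}" using l unfolding lines_def by auto
  have "\<exists>x. x \<in> l \<inter> D \<and> (\<forall>y\<in>l \<inter> D. h x \<le> h y)"
    using h_attains[OF line_closed[OF lT(1)] lT(2)] by blast
  from someI_ex[OF this]
  have *: "line_birth l \<in> l \<inter> D \<and> (\<forall>y\<in>l \<inter> D. h (line_birth l) \<le> h y)"
    unfolding line_birth_def[symmetric] .
  then show 1: "line_birth l \<in> D" by blast
  show 2: "signs (line_birth l) l = 0" using * signs_zero_iff[OF 1] lT by blast
  show 3: "h (line_birth l) \<le> h y" if "y \<in> D" "signs y l = 0" for y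
    using * that signs_zero_iff[OF that(1)] by blast
  show 4: "line_birth l \<notin> nodes T"
  proof
    assume "line_birth l \<in> nodes T"
    then obtain y where y: "y \<in> l \<inter> D" "h y < h (line_birth l)" using h_node[OF _ lT(1)] * by blast
    then have "h (line_birth l) \<le> h y" using * by blast
    then show False using y(2) by simp
  qed
  then show 5: "signs (line_birth l) \<in> segs" using segs_iff[OF 1 lT(1)] * by blast
  then show 6: "line_of_seg (signs (line_birth l)) = l" using line_of_seg 2 by metis
  show "birth (signs (line_birth l)) = line_birth l"
    using 1 3 2 by (intro birth_eqI) (auto dest: le_signs_zero)
qed

definition origin :: point where
  "origin = (SOME x. x \<in> D \<and> (\<forall>y\<in>D. h x \<le> h y))"

lemma origin: "origin \<in> D" "\<And>y. y \<in> D \<Longrightarrow> h origin \<le> h y" "signs origin \<in> cells"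
  "birth (signs origin) = origin"
proof -
  have "\<exists>x. x \<in> D \<and> (\<forall>y\<in>D. h x \<le> h y)" using h_attains[of UNIV] D_nonempty by auto
  from someI_ex[OF this] have *: "origin \<in> D \<and> (\<forall>y\<in>D. h origin \<le> h y)"
    unfolding origin_def[symmetric] .
  then show 1: "origin \<in> D" "\<And>y. y \<in> D \<Longrightarrow> h origin \<le> h y" by auto
  have "signs origin l \<noteq> 0" for l
  proof
    assume "signs origin l = 0"
    then have "l \<in> T" "origin \<in> l \<inter> D" using signs_zero_iff[OF 1(1)] 1(1) by auto
    then obtain q where "q \<in> D" "h q < h origin" using h_line by blast
    then show False using 1(2) by fastforce
  qed
  then show "signs origin \<in> cells" unfolding cells_def using 1(1) by blast
  show "birth (signs origin) = origin" using 1 by (intro birth_eqI) auto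
qed

lemma origin_less: "y \<in> D \<Longrightarrow> y \<noteq> origin \<Longrightarrow> h origin < h y"
  using min_unique[of UNIV origin y] origin(1,2) by fastforce

section \<open>Incoming and outgoing sides at a node\<close>

lemma cross_line:
  assumes x: "x \<in> D" "l1 \<noteq> l2" "signs x l1 = 0" "signs x l2 = 0"
    and y: "y \<in> D" "signs y l1 = 0" and z: "z \<in> D" "signs z l1 = 0"
    and opp: "signs y l2 = - signs z l2" "signs z l2 \<noteq> 0"
  shows "\<exists>t>0. t < 1 \<and> x = (1 - t) *\<^sub>R y + t *\<^sub>R z"
proof -
  have T: "l1 \<in> T" "x \<in> l1" "l2 \<in> T" "x \<in> l2" "y \<in> l1" "z \<in> l1"
    using x y z signs_zero_iff by auto
  have L: "l2 \<in> lines" using signs_zero_lines x by blast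
  define a b where "a = side l2 y" and "b = side l2 z"
  have ab: "a \<noteq> 0" "b \<noteq> 0" "sgn a = - sgn b"
    using opp L by (auto simp: signs_def a_def b_def)
  \<comment> \<open>The zero of the affine interpolation between a and b, where the segment from y
    to z crosses \<open>l2\<close>.\<close>
  define t where "t = a / (a - b)"
  have opp': "a > 0 \<and> b < 0 \<or> a < 0 \<and> b > 0" using ab by (auto simp: sgn_if split: if_splits)
  then have t: "0 < t" "t < 1" unfolding t_def by (auto simp: field_simps)
  have "(1 - t) * a + t * b = 0" using opp' unfolding t_def by (auto simp: field_simps)
  then have "(1 - t) *\<^sub>R y + t *\<^sub>R z \<in> l2"
    using mem_line_iff[OF T(3)] by (simp add: side_combination a_def b_def)
  moreover have "(1 - t) *\<^sub>R y + t *\<^sub>R z \<in> l1"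
    using mem_line_iff[OF T(1)] T by (simp add: side_combination)
  ultimately have "x = (1 - t) *\<^sub>R y + t *\<^sub>R z" using lines_meet_once[OF T(1,3) x(2)] T by blast
  then show ?thesis using t by blast
qed

text \<open>At a node \<open>x\<close> on the lines \<open>l\<close> and \<open>m\<close>, \<open>incoming x l\<close> is the side of \<open>l\<close> on which \<open>h\<close> is smaller
  along \<open>m\<close>.\<close>

definition incoming :: "point \<Rightarrow> point set \<Rightarrow> real" where
  "incoming x l = (if \<exists>y\<in>D. signs y = (signs x)(l := 1) \<and> h y < h x then 1 else -1)"

lemma incoming_values: "incoming x l = 1 \<or> incoming x l = -1" "- incoming x l = 1 \<or> - incoming x l = -1"
  "incoming x l \<noteq> 0"
  unfolding incoming_def by auto

text \<open>Take a lower point on \<open>l1\<close>, which \<open>h_node\<close> provides, and move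
  it close to x. If it is on the negative side of \<open>l2\<close>, a lower point on the positive
  half would put x between two lower points, against quasiconvexity; this justifies the default
  value -1 of \<open>incoming\<close>.\<close>

lemma exists_incoming:
  assumes x: "x \<in> D" "l1 \<noteq> l2" "signs x l1 = 0" "signs x l2 = 0"
  shows "\<exists>y\<in>D. signs y = (signs x)(l2 := incoming x l2) \<and> h y < h x"
proof -
  have "l1 \<in> T" "x \<in> l1" using x signs_zero_iff by auto
  moreover have "x \<in> nodes T \<inter> D" using nodes_iff[OF x(1)] x by blast
  ultimately have T: "l1 \<in> T" "x \<in> l1" "x \<in> nodes T \<inter> D" by auto
  obtain y where y: "y \<in> l1" "y \<in> D" "h y < h x" using h_node[OF T(3,1,2)] by blast
  have "x \<noteq> y" using y by auto
  obtain t where t: "t > 0" "t < 1" "signs x \<preceq> signs ((1 - t) *\<^sub>R x + t *\<^sub>R y)"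
    "\<And>l. signs x l = 0 \<Longrightarrow> signs ((1 - t) *\<^sub>R x + t *\<^sub>R y) l = signs y l"
    using step_toward[OF x(1) y(2)] by blast
  define z where "z = (1 - t) *\<^sub>R x + t *\<^sub>R y"
  have zD: "z \<in> D" unfolding z_def using D_combination x(1) y(2) t by simp
  have "h z < max (h x) (h y)" unfolding z_def using h_quasiconvex x y t \<open>x \<noteq> y\<close> by blast
  then have hz: "h z < h x" using y(3) by simp
  have z1: "signs z l1 = 0" unfolding z_def t(4)[OF x(3)] using signs_zero_iff[OF y(2)] T(1) y(1) by blast
  have z2: "signs z l2 \<noteq> 0"
  proof
    assume "signs z l2 = 0"
    then have "z = x" using lines_meet_once[of l1 l2 z x] x z1 signs_zero_iff[OF zD] signs_zero_iff[OF x(1)] by blast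
    then show False using hz by simp
  qed
  have "signs z m = ((signs x)(l2 := signs z l2)) m" for m
  proof (cases "m = l1 \<or> m = l2")
    case True
    then show ?thesis using z1 x by auto
  next
    case False
    then have "signs x m \<noteq> 0" using no_three_zeros[OF x(1,3,4,2)] by blast
    then show ?thesis using t(3) False unfolding z_def le_signs_def by (metis fun_upd_other)
  qed
  then have z: "signs z = (signs x)(l2 := signs z l2)" ..
  show ?thesis
  proof (cases "signs z l2 = 1")
    case True
    then show ?thesis using z zD hz unfolding incoming_def by auto
  next
    case False
    then have "signs z l2 = -1" using signs_values[of z l2] z2 by auto
    then have z': "signs z = (signs x)(l2 := -1)" using z by simp
    have "\<not> (\<exists>y\<in>D. signs y = (signs x)(l2 := 1) \<and> h y < h x)"
    proof
      assume "\<exists>y\<in>D. signs y = (signs x)(l2 := 1) \<and> h y < h x"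
      then obtain w where w: "w \<in> D" "signs w = (signs x)(l2 := 1)" "h w < h x" by blast
      then obtain s where s: "s > 0" "s < 1" "x = (1 - s) *\<^sub>R w + s *\<^sub>R z"
        using cross_line[OF x w(1) _ zD z1] z' x by auto
      then have "h x < h z" using h_beyond[OF w(1) zD] w by blast
      then show False using hz by simp
    qed
    then show ?thesis using z' zD hz unfolding incoming_def by auto
  qed
qed

lemma outgoing_greater:
  assumes x: "x \<in> D" "l1 \<noteq> l2" "signs x l1 = 0" "signs x l2 = 0"
    and z: "z \<in> D" "signs z l1 = 0" "signs z l2 = - incoming x l2"
  shows "h x < h z"
proof -
  obtain y where y: "y \<in> D" "signs y = (signs x)(l2 := incoming x l2)" "h y < h x"
    using exists_incoming[OF x] by blast
  then obtain s where s: "s > 0" "s < 1" "x = (1 - s) *\<^sub>R y + s *\<^sub>R z"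
    using cross_line[OF x y(1) _ z(1,2)] z(3) x incoming_values(3)[of x l2] by auto
  then show ?thesis using h_beyond[OF y(1) z(1)] y by blast
qed

lemma birth_outgoing_seg:
  assumes x: "x \<in> D" "l1 \<noteq> l2" "signs x l1 = 0" "signs x l2 = 0"
  shows "birth ((signs x)(l2 := - incoming x l2)) = x"
proof (rule birth_eqI)
  have s: "(signs x)(l2 := - incoming x l2) \<in> segs" "signs x \<preceq> (signs x)(l2 := - incoming x l2)"
    using node_seg[OF x(1) x(2)[symmetric] x(4,3) incoming_values(2)] by auto
  then show "(signs x)(l2 := - incoming x l2) \<in> signs ` D" unfolding segs_def by blast
  show "signs x \<preceq> (signs x)(l2 := - incoming x l2)" by (rule s)
  fix y assume y: "y \<in> D" "signs y \<preceq> (signs x)(l2 := - incoming x l2)"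
  then have y1: "signs y l1 = 0" using x unfolding le_signs_def by (metis fun_upd_other)
  have "signs y l2 = 0 \<or> signs y l2 = - incoming x l2"
    using y(2) unfolding le_signs_def by (metis fun_upd_same)
  then show "h x \<le> h y"
  proof
    assume "signs y l2 = 0"
    then have "y = x"
      using lines_meet_once[of l1 l2 y x] x y1 signs_zero_iff[OF y(1)] signs_zero_iff[OF x(1)] by blast
    then show ?thesis by simp
  qed (use outgoing_greater[OF x y(1) y1] in auto)
qed (rule x)

text \<open>At a node this is the quadrant enclosed by the two outgoing halves, the last of the four
  to be reached.\<close>

definition outgoing_cell :: "point \<Rightarrow> point set \<Rightarrow> real" where
  "outgoing_cell x l = (if signs x l = 0 then - incoming x l else signs x l)"

lemma outgoing_cell_eq:
  assumes x: "x \<in> D" "l1 \<noteq> l2" "signs x l1 = 0" "signs x l2 = 0"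
  shows "outgoing_cell x = (signs x)(l1 := - incoming x l1, l2 := - incoming x l2)"
  using no_three_zeros[OF x(1,3,4,2)] x by (auto simp: outgoing_cell_def fun_eq_iff)

lemma outgoing_cell: "x \<in> D \<Longrightarrow> outgoing_cell x \<in> cells" "signs x \<preceq> outgoing_cell x"
proof -
  show le: "signs x \<preceq> outgoing_cell x" unfolding le_signs_def outgoing_cell_def by auto
  assume x: "x \<in> D"
  have "outgoing_cell x \<in> signs ` D"
    using le x signs_values[of x] by (intro realizable[of x]) (auto simp: outgoing_cell_def incoming_def)
  moreover have "outgoing_cell x l \<noteq> 0" for l
    using incoming_values(3)[of x l] by (auto simp: outgoing_cell_def)
  ultimately show "outgoing_cell x \<in> cells" unfolding cells_def by blast
qed

text \<open>A lower point on each of the two incoming half-lines and a point of the outgoing quadrant have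
  \<open>x\<close> in their convex hull.\<close>

lemma birth_outgoing_cell:
  assumes x: "x \<in> D" "l1 \<noteq> l2" "signs x l1 = 0" "signs x l2 = 0"
  shows "birth (outgoing_cell x) = x"
proof (rule birth_eqI)
  show "outgoing_cell x \<in> signs ` D" using outgoing_cell(1)[OF x(1)] unfolding cells_def by blast
  show "x \<in> D" "signs x \<preceq> outgoing_cell x" using x outgoing_cell(2) by auto
  have T: "l1 \<in> T" "x \<in> l1" "l2 \<in> T" "x \<in> l2" using x signs_zero_iff by auto
  have L: "l1 \<in> lines" "l2 \<in> lines" using signs_zero_lines x by auto
  fix z assume z: "z \<in> D" "signs z \<preceq> outgoing_cell x"
  then have z12: "signs z l1 = 0 \<or> signs z l1 = - incoming x l1" "signs z l2 = 0 \<or> signs z l2 = - incoming x l2"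
    using x unfolding le_signs_def outgoing_cell_def by metis+
  show "h x \<le> h z"
  proof (cases "z = x")
    case False
    obtain y1 where y1: "y1 \<in> D" "signs y1 = (signs x)(l1 := incoming x l1)" "h y1 < h x"
      using exists_incoming[OF x(1) x(2)[symmetric] x(4,3)] by blast
    obtain y2 where y2: "y2 \<in> D" "signs y2 = (signs x)(l2 := incoming x l2)" "h y2 < h x"
      using exists_incoming[OF x] by blast
    have sy: "sgn (side l1 y1) = incoming x l1" "side l2 y1 = 0" "side l1 y2 = 0" "sgn (side l2 y2) = incoming x l2"
      using fun_cong[OF y1(2), of l1] fun_cong[OF y1(2), of l2]
        fun_cong[OF y2(2), of l1] fun_cong[OF y2(2), of l2] L x by (auto simp: signs_def sgn_zero_iff)
    have sz: "side l1 z = 0 \<or> sgn (side l1 z) = - incoming x l1" "side l2 z = 0 \<or> sgn (side l2 z) = - incoming x l2"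
      using z12 L by (auto simp: signs_def sgn_zero_iff)
    \<comment> \<open>With these weights \<open>z + p *\<^sub>R y1 + q *\<^sub>R y2\<close>, divided
      by \<open>1 + p + q\<close>, lies on both lines and therefore equals x.\<close>
    define p q where "p = - side l1 z / side l1 y1" and "q = - side l2 z / side l2 y2"
    have ne: "side l1 y1 \<noteq> 0" "side l2 y2 \<noteq> 0" using sy incoming_values by (metis sgn_0)+
    have "p \<ge> 0" "q \<ge> 0"
      using sz sy ne incoming_values(1)[of x l1] incoming_values(1)[of x l2] unfolding p_def q_def
      by (auto simp: sgn_if divide_simps split: if_splits)
    have "\<not> (p = 0 \<and> q = 0)"
    proof
      assume "p = 0 \<and> q = 0"
      then have "z \<in> l1" "z \<in> l2" using ne T mem_line_iff unfolding p_def q_def by auto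
      then show False using False lines_meet_once[OF T(1,3) x(2)] T by blast
    qed
    then have pq: "p + q > 0" using \<open>p \<ge> 0\<close> \<open>q \<ge> 0\<close> by linarith
    define s where "s = q / (p + q)"
    have s: "0 \<le> s" "s \<le> 1" "(1 - s) * (p + q) = p" "s * (p + q) = q"
      using pq \<open>p \<ge> 0\<close> \<open>q \<ge> 0\<close> unfolding s_def by (auto simp: field_simps)
    \<comment> \<open>The share of \<open>y1\<close> and \<open>y2\<close> in this combination. It
      is lower than x by quasiconvexity, so \<open>h_beyond\<close> applies to the segment from w
      through x to z.\<close>
    define w where "w = (1 - s) *\<^sub>R y1 + s *\<^sub>R y2"
    have wD: "w \<in> D" unfolding w_def using D_combination y1 y2 s by blast
    have hw: "h w < h x"
    proof (cases "s = 0 \<or> s = 1 \<or> y1 = y2")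
      case True
      then have "w = y1 \<or> w = y2" unfolding w_def by (auto simp: scaleR_left_diff_distrib)
      then show ?thesis using y1 y2 by blast
    next
      case False
      then have "h w < max (h y1) (h y2)" unfolding w_def using h_quasiconvex[OF y1(1) y2(1)] s by auto
      then show ?thesis using y1 y2 by linarith
    qed
    define t where "t = 1 / (1 + p + q)"
    have t: "0 < t" "t < 1" "1 - t = t * (p + q)" using pq unfolding t_def by (auto simp: field_simps)
    define u where "u = (1 - t) *\<^sub>R w + t *\<^sub>R z"
    have su: "side l u = t * ((p + q) * ((1 - s) * side l y1 + s * side l y2) + side l z)" for l
    proof -
      have "side l u = (1 - t) * ((1 - s) * side l y1 + s * side l y2) + t * side l z"
        unfolding u_def w_def side_combination ..
      then show ?thesis unfolding t(3) by (simp add: algebra_simps)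
    qed
    have "side l1 u = t * ((1 - s) * (p + q) * side l1 y1 + side l1 z)"
      unfolding su sy by (simp add: mult.commute)
    also have "\<dots> = 0" unfolding s(3) using ne by (simp add: p_def)
    finally have "u \<in> l1" using mem_line_iff T by simp
    have "side l2 u = t * (s * (p + q) * side l2 y2 + side l2 z)"
      unfolding su sy by (simp add: mult.commute)
    also have "\<dots> = 0" unfolding s(4) using ne by (simp add: q_def)
    finally have "u \<in> l2" using mem_line_iff T by simp
    then have "x = (1 - t) *\<^sub>R w + t *\<^sub>R z" using lines_meet_once[OF T(1,3) x(2)] T \<open>u \<in> l1\<close> unfolding u_def by blast
    then show ?thesis using h_beyond[OF wD z(1) t(1,2)] hw by fastforce
  qed simp
qed

section \<open>Cells born on a line\<close>

definition far_cell :: "point set \<Rightarrow> point set \<Rightarrow> real" where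
  "far_cell l = (signs (line_birth l))(l := - signs origin l)"

lemma origin_side: "signs origin l = 1 \<or> signs origin l = -1"
  using origin(3) signs_values[of origin l] unfolding cells_def by auto

lemma far_cell: "l \<in> lines \<Longrightarrow> far_cell l \<in> cells"
  using update_cell[OF line_birth(5), of l "- signs origin l"] line_birth(6)[of l] origin_side[of l]
  unfolding far_cell_def by auto

text \<open>The segment from \<open>origin\<close> to a point z beyond l crosses l at a point c.
  There h is at least its minimum on l, and less than the larger of its values at the two ends,
  which is \<open>h z\<close>.\<close>

lemma birth_far_cell:
  assumes l: "l \<in> lines"
  shows "birth (far_cell l) = line_birth l"
proof (rule birth_eqI)
  note b = line_birth[OF l]
  show "far_cell l \<in> signs ` D" using far_cell[OF l] unfolding cells_def by blast
  show "line_birth l \<in> D" by (rule b)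
  show "signs (line_birth l) \<preceq> far_cell l"
    using b(2) unfolding le_signs_def far_cell_def by auto
  fix z assume z: "z \<in> D" "signs z \<preceq> far_cell l"
  then have "signs z l = 0 \<or> signs z l = - signs origin l"
    unfolding le_signs_def far_cell_def by (metis fun_upd_same)
  then show "h (line_birth l) \<le> h z"
  proof
    assume opp: "signs z l = - signs origin l"
    have lT: "l \<in> T" using l lines_in_T by blast
    define a b where "a = side l origin" and "b = side l z"
    have "a > 0 \<and> b < 0 \<or> a < 0 \<and> b > 0"
      using opp l origin_side[of l] unfolding a_def b_def by (auto simp: signs_def sgn_if split: if_splits)
    moreover define t where "t = a / (a - b)"
    ultimately have t: "0 < t" "t < 1" "(1 - t) * a + t * b = 0" by (auto simp: field_simps)
    define c where "c = (1 - t) *\<^sub>R origin + t *\<^sub>R z"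
    have cD: "c \<in> D" unfolding c_def using D_combination origin z t by simp
    have "side l c = 0" unfolding c_def side_combination using t(3) by (simp add: a_def b_def)
    then have "signs c l = 0" using l by (simp add: signs_def)
    then have "h (line_birth l) \<le> h c" using line_birth(3)[OF l cD] by blast
    moreover have "h c < max (h origin) (h z)"
      unfolding c_def using opp origin_side[of l] origin(1) z t
      by (intro h_quasiconvex) auto
    ultimately show ?thesis using origin(2)[OF z(1)] by linarith
  qed (use line_birth(3)[OF l z(1)] in auto)
qed

section \<open>Classification of birth points\<close>

lemma update_eqI: "(\<And>m. m \<noteq> l \<Longrightarrow> v m = w m) \<Longrightarrow> v l = e \<Longrightarrow> v = w(l := e)"
  by (rule ext) auto

text \<open>Lower test points in \<open>birth_no_descent\<close> leave one possibility for each
  number of lines through the birth point. The origin excludes other points off the lines and the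
  near side of a line; the minimum of a line excludes other points on that line alone; lower points
  on the incoming halves exclude all quadrants of a node but the outgoing one.\<close>

lemma cell_birth_cases:
  assumes v: "v \<in> cells"
  shows "v = signs origin \<or> (\<exists>l\<in>lines. v = far_cell l) \<or> (\<exists>x\<in>nodes T \<inter> D. v = outgoing_cell x)"
proof -
  have vD: "v \<in> signs ` D" using v unfolding cells_def by blast
  define p where "p = birth v"
  have p: "p \<in> D" "signs p \<preceq> v" using birth[OF vD] unfolding p_def by auto
  note nd = birth_no_descent[OF vD, folded p_def]
  have opp: "v l = - e" if "v l \<noteq> e" "e = 1 \<or> e = -1" for l e
    using that v signs_image_values[OF vD, of l] unfolding cells_def by auto
  show ?thesis
  proof (cases "\<exists>l. signs p l = 0")
    case False
    then have "p = origin" using nd[OF origin(1)] origin_less[OF p(1)] by blast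
    moreover have "signs p \<in> cells" using False p(1) unfolding cells_def by blast
    then have "signs p = v" using cells_le p(2) by blast
    ultimately show ?thesis by blast
  next
    case True
    then obtain l where l: "signs p l = 0" by blast
    then have L: "l \<in> lines" using signs_zero_lines by blast
    show ?thesis
    proof (cases "\<exists>m. m \<noteq> l \<and> signs p m = 0")
      case False
      then have uniq: "m = l" if "signs p m = 0" for m using that by blast
      have "\<not> h (line_birth l) < h p"
        using nd[OF line_birth(1)[OF L]] uniq line_birth(2)[OF L] by blast
      then have pl: "p = line_birth l"
        using birth_less[of "signs (line_birth l)" p] line_birth[OF L] p(1) l
          min_unique[of l "line_birth l" p] line(1)[OF lines_in_T[OF L]] affine_imp_convex
          signs_zero_iff by (smt (verit, best) Int_iff)
      have "p \<noteq> origin" using l origin(3) unfolding cells_def by auto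
      then have "v l \<noteq> signs origin l" using nd[OF origin(1)] origin_less[OF p(1)] uniq by metis
      then have "v l = - signs origin l" using opp origin_side by blast
      moreover have "v m = signs p m" if "m \<noteq> l" for m
        using p(2) uniq that unfolding le_signs_def by metis
      ultimately have "v = far_cell l" unfolding far_cell_def pl[symmetric] by (intro update_eqI)
      then show ?thesis using L by blast
    next
      case True
      then obtain m where m: "l \<noteq> m" "signs p m = 0" by blast
      note x = p(1) m(1) l m(2)
      have v_inc: "v b \<noteq> incoming p b" if ab: "a \<noteq> b" "signs p a = 0" "signs p b = 0" for a b
      proof -
        obtain y where y: "y \<in> D" "signs y = (signs p)(b := incoming p b)" "h y < h p"
          using exists_incoming[OF p(1) ab] by blast
        then obtain c where c: "signs p c = 0" "signs y c \<noteq> 0" "signs y c \<noteq> v c" using nd by blast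
        then have "c = b" using y(2) by (metis fun_upd_other)
        then show ?thesis using c y(2) by (metis fun_upd_same)
      qed
      have "v k = outgoing_cell p k" for k
      proof (cases "signs p k = 0")
        case True
        then have "k = l \<or> k = m" using no_three_zeros[OF p(1) l m(2,1)] by blast
        then have "v k \<noteq> incoming p k" using v_inc[OF m(1) l m(2)] v_inc[OF m(1)[symmetric] m(2) l] by blast
        then show ?thesis using opp incoming_values(1) True unfolding outgoing_cell_def by simp
      next
        case False
        then show ?thesis using p(2) unfolding le_signs_def outgoing_cell_def by (simp, metis)
      qed
      then have "v = outgoing_cell p" ..
      moreover have "p \<in> nodes T \<inter> D" using nodes_iff[OF p(1)] x by blast
      ultimately show ?thesis by blast
    qed
  qed
qed

lemma seg_birth_cases:
  assumes v: "v \<in> segs"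
  shows "(\<exists>l\<in>lines. v = signs (line_birth l)) \<or>
    (\<exists>x\<in>nodes T \<inter> D. \<exists>l. signs x l = 0 \<and> v = (signs x)(l := - incoming x l))"
proof -
  have vD: "v \<in> signs ` D" using v unfolding segs_def by blast
  define p where "p = birth v"
  have p: "p \<in> D" "signs p \<preceq> v" using birth[OF vD] unfolding p_def by auto
  note nd = birth_no_descent[OF vD, folded p_def]
  define l where "l = line_of_seg v"
  have vl: "v l = 0" using line_of_seg[OF v] unfolding l_def by simp
  then have l: "signs p l = 0" using p(2) le_signs_zero by blast
  then have L: "l \<in> lines" using signs_zero_lines by blast
  show ?thesis
  proof (cases "\<exists>m. m \<noteq> l \<and> signs p m = 0")
    case False
    then have uniq: "m = l" if "signs p m = 0" for m using that by blast
    have "\<not> h (line_birth l) < h p"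
      using nd[OF line_birth(1)[OF L]] uniq line_birth(2)[OF L] by blast
    then have pl: "p = line_birth l"
      using line_birth[OF L] p(1) l
          min_unique[of l "line_birth l" p] line(1)[OF lines_in_T[OF L]] affine_imp_convex
          signs_zero_iff by (smt (verit, best) Int_iff)
    have "v m = signs p m" for m
      using p(2) uniq vl l unfolding le_signs_def by metis
    then have "v = signs (line_birth l)" unfolding pl ..
    then show ?thesis using L by blast
  next
    case True
    then obtain m where m: "l \<noteq> m" "signs p m = 0" by blast
    note x = p(1) m(1) l m(2)
    obtain y where y: "y \<in> D" "signs y = (signs p)(m := incoming p m)" "h y < h p"
      using exists_incoming[OF x] by blast
    then obtain c where c: "signs p c = 0" "signs y c \<noteq> 0" "signs y c \<noteq> v c" using nd by blast
    then have "c = m" using y(2) by (metis fun_upd_other)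
    then have "v m \<noteq> incoming p m" using c y(2) by (metis fun_upd_same)
    moreover have "v m \<noteq> 0" using line_of_seg[OF v, of m] m(1) unfolding l_def by auto
    ultimately have "v m = - incoming p m"
      using signs_image_values[OF vD, of m] incoming_values(1)[of p m] by auto
    moreover have "v k = signs p k" if "k \<noteq> m" for k
    proof (cases "k = l")
      case False
      then have "signs p k \<noteq> 0" using no_three_zeros[OF p(1) l m(2,1)] that by blast
      then show ?thesis using p(2) unfolding le_signs_def by metis
    qed (use vl l in simp)
    ultimately have "v = (signs p)(m := - incoming p m)" by (intro update_eqI)
    moreover have "p \<in> nodes T \<inter> D" using nodes_iff[OF p(1)] x by blast
    ultimately show ?thesis using m by blast
  qed
qed

end

subsection \<open>Edges and their starting segments\<close>

text \<open>Yields bijections without explicit formulas. The relation R is containment of a segment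
  in an edge, or incidence of a node with an edge and a line crossing it.\<close>

lemma bij_betw_of_matching:
  assumes "\<And>a. a \<in> A \<Longrightarrow> \<exists>b\<in>B. R a b" "\<And>b. b \<in> B \<Longrightarrow> \<exists>a\<in>A. R a b"
    and "\<And>a b b'. a \<in> A \<Longrightarrow> b \<in> B \<Longrightarrow> b' \<in> B \<Longrightarrow> R a b \<Longrightarrow> R a b' \<Longrightarrow> b = b'"
    and "\<And>a a' b. a \<in> A \<Longrightarrow> a' \<in> A \<Longrightarrow> b \<in> B \<Longrightarrow> R a b \<Longrightarrow> R a' b \<Longrightarrow> a = a'"
  shows "\<exists>g. bij_betw g A B \<and> (\<forall>a\<in>A. R a (g a))"
proof -
  obtain g where g: "\<And>a. a \<in> A \<Longrightarrow> g a \<in> B \<and> R a (g a)" using assms(1) by metis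
  have "inj_on g A" unfolding inj_on_def using g assms(4) by metis
  moreover have "g ` A = B"
  proof
    show "B \<subseteq> g ` A"
    proof
      fix b assume b: "b \<in> B"
      then obtain a where a: "a \<in> A" "R a b" using assms(2) by blast
      then have "g a = b" using assms(3)[OF a(1) _ b] g by blast
      then show "b \<in> g ` A" using a by blast
    qed
  qed (use g in blast)
  ultimately show ?thesis using g unfolding bij_betw_def by blast
qed

text \<open>Summing out the coordinates in decreasing order of \<open>b\<close>.\<close>

lemma sum_PiE_triangular:
  fixes b :: "'a \<Rightarrow> 'b::linorder" and f :: "'a \<Rightarrow> ('a \<Rightarrow> 'c) \<Rightarrow> 'd::comm_semiring_1"
  assumes "finite I"
    and "\<And>i g g'. i \<in> I \<Longrightarrow> (\<And>j. j \<in> I \<Longrightarrow> j = i \<or> b j < b i \<Longrightarrow> g j = g' j) \<Longrightarrow> f i g = f i g'"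
    and "\<And>i g. i \<in> I \<Longrightarrow> (\<And>j. j \<in> I \<Longrightarrow> b j < b i \<Longrightarrow> g j \<in> K) \<Longrightarrow> (\<Sum>c\<in>K. f i (g(i := c))) = s i"
  shows "(\<Sum>g\<in>I \<rightarrow>\<^sub>E K. \<Prod>i\<in>I. f i g) = (\<Prod>i\<in>I. s i)"
  using assms
proof (induction I rule: finite_ranking_induct[where f = b])
  case (insert x S)
  show ?case
  proof (cases "x \<in> S")
    case True
    then have eq: "insert x S = S" by blast
    show ?thesis unfolding eq by (rule insert.IH[OF insert.prems[unfolded eq]])
  next
    case False
    note dep = insert.prems(1) and tot = insert.prems(2)
    \<comment> \<open>As x has the largest rank, the terms \<open>f i\<close> with i in S do not
      involve the coordinate x, and the induction hypothesis applies to them.\<close>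
    have small: "j \<in> S" if "j \<in> insert x S" "j = i \<or> b j < b i" "i \<in> S" for i j
    proof (rule ccontr)
      assume "j \<notin> S"
      then have "j = x" "x \<noteq> i" using that False by auto
      then show False using that insert.hyps(2)[OF that(3)] by auto
    qed
    have IH: "(\<Sum>g\<in>S \<rightarrow>\<^sub>E K. \<Prod>i\<in>S. f i g) = (\<Prod>i\<in>S. s i)"
    proof (rule insert.IH)
      fix i and g g' :: "'a \<Rightarrow> 'c" assume i: "i \<in> S" and eq: "\<And>j. j \<in> S \<Longrightarrow> j = i \<or> b j < b i \<Longrightarrow> g j = g' j"
      show "f i g = f i g'" by (rule dep) (use i eq small in blast)+
    next
      fix i and g :: "'a \<Rightarrow> 'c" assume i: "i \<in> S" and mem: "\<And>j. j \<in> S \<Longrightarrow> b j < b i \<Longrightarrow> g j \<in> K"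
      show "(\<Sum>c\<in>K. f i (g(i := c))) = s i" by (rule tot) (use i mem small in blast)+
    qed
    have inj: "inj_on (\<lambda>(c, g). g(x := c)) (K \<times> (S \<rightarrow>\<^sub>E K))"
      using inj_combinator[OF False, of "\<lambda>_. K"] by simp
    have fx: "f i (g(x := c)) = f i g" if "i \<in> S" for i g c
      by (rule dep) (use that small[OF _ _ that] False in auto)
    have "(\<Sum>g\<in>insert x S \<rightarrow>\<^sub>E K. \<Prod>i\<in>insert x S. f i g) =
        (\<Sum>(c, g)\<in>K \<times> (S \<rightarrow>\<^sub>E K). \<Prod>i\<in>insert x S. f i (g(x := c)))"
      unfolding PiE_insert_eq by (subst sum.reindex[OF inj]) (simp add: case_prod_beta o_def)
    also have "\<dots> = (\<Sum>c\<in>K. \<Sum>g\<in>S \<rightarrow>\<^sub>E K. \<Prod>i\<in>insert x S. f i (g(x := c)))"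
      by (simp add: sum.cartesian_product)
    also have "\<dots> = (\<Sum>g\<in>S \<rightarrow>\<^sub>E K. \<Sum>c\<in>K. f x (g(x := c)) * (\<Prod>i\<in>S. f i g))"
      using False insert.hyps(1) fx by (subst sum.swap) simp
    also have "\<dots> = (\<Sum>g\<in>S \<rightarrow>\<^sub>E K. s x * (\<Prod>i\<in>S. f i g))"
    proof (rule sum.cong[OF refl])
      fix g assume g: "g \<in> S \<rightarrow>\<^sub>E K"
      have "(\<Sum>c\<in>K. f x (g(x := c))) = s x"
        by (rule tot) (use g in \<open>auto simp: PiE_mem\<close>)
      then show "(\<Sum>c\<in>K. f x (g(x := c)) * (\<Prod>i\<in>S. f i g)) = s x * (\<Prod>i\<in>S. f i g)"
        by (simp add: sum_distrib_right[symmetric])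
    qed
    also have "\<dots> = s x * (\<Prod>i\<in>S. s i)" by (simp add: sum_distrib_left[symmetric] IH)
    also have "\<dots> = (\<Prod>i\<in>insert x S. s i)" using False insert.hyps(1) by simp
    finally show ?thesis .
  qed
qed simp

section \<open>Segments inside edges and primary edges\<close>

context tessellated_window
begin

lemma line_support_subset: "l \<in> T \<Longrightarrow> line_support G l \<subseteq> l"
  unfolding support_def using line_closed closure_minimal by blast

lemma convex_on_line:
  assumes "l \<in> T" "e \<subseteq> l" "connected e" shows "convex e"
proof -
  have "aff_dim e \<le> 1" using aff_dim_subset[OF assms(2)] line(2)[OF assms(1)] by simp
  then show ?thesis using assms(3) convex_connected_collinear[of e] collinear_aff_dim[of e] by blast
qed

lemma other_line_nonzero:
  assumes "v \<in> segs" "v l = 0" "m \<noteq> l" shows "v m \<noteq> 0"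
  using line_of_seg[OF assms(1)] assms(2,3) by metis

lemma edges_line:
  assumes "e \<in> edges T G"
  obtains l where "l \<in> T" "e \<in> components (line_support G l - vertices G)" "e \<subseteq> l" "convex e"
proof -
  obtain l where l: "l \<in> T" "e \<in> components (line_support G l - vertices G)"
    using assms unfolding edges_def by blast
  have "e \<subseteq> l" using in_components_subset[OF l(2)] line_support_subset[OF l(1)] by blast
  moreover have "convex e" using convex_on_line[OF l(1) calculation in_components_connected[OF l(2)]] .
  ultimately show ?thesis using that l by blast
qed

lemma primary_edges_line:
  assumes "e \<in> primary_edges T G"
  obtains l where "l \<in> T" "e \<in> components (line_support G l)" "e \<subseteq> l" "convex e"
proof -
  obtain l where l: "l \<in> T" "e \<in> components (line_support G l)"
    using assms unfolding primary_edges_def by blast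
  have "e \<subseteq> l" using in_components_subset[OF l(2)] line_support_subset[OF l(1)] by blast
  moreover have "convex e" using convex_on_line[OF l(1) calculation in_components_connected[OF l(2)]] .
  ultimately show ?thesis using that l by blast
qed

lemma primary_edge_absorbs_seg:
  assumes e: "e \<in> components (line_support G l)" and l: "l \<in> T"
    and v: "v \<in> segs" "stratum v \<in> G" "v l = 0" and p: "p \<in> e" "p \<in> closure (stratum v)"
  shows "closure (stratum v) \<subseteq> e"
proof -
  have "connected (closure (stratum v))"
    using convex_connected[OF convex_stratum] by (rule connected_imp_connected_closure)
  moreover have "stratum v \<subseteq> l" using subset_line_iff[OF v(1)] v(3) by blast
  then have "closure (stratum v) \<subseteq> line_support G l" using v(2) unfolding support_def by blast
  ultimately show ?thesis using components_maximal[OF e] p by blast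
qed

lemma primary_edge_contains_seg:
  assumes G: "G \<subseteq> segments T D" and l: "l \<in> T" and e: "e \<in> components (line_support G l)"
  shows "\<exists>v\<in>segs. stratum v \<in> G \<and> v l = 0 \<and> stratum v \<subseteq> e"
proof -
  obtain p where p: "p \<in> e" "p \<in> line_support G l"
    using e in_components_nonempty in_components_subset by blast
  then obtain s where s: "s \<in> G" "s \<subseteq> l" "p \<in> closure s" unfolding support_def by blast
  then obtain v where v: "v \<in> segs" "s = stratum v" using G segments_eq by auto
  have "v l = 0" using subset_line_iff[OF v(1)] s(2) l unfolding v(2) by blast
  then show ?thesis
    using primary_edge_absorbs_seg[OF e l v(1)] s v p(1) closure_subset by blast
qed

lemma seg_in_primary_edge:
  assumes v: "v \<in> segs" "stratum v \<in> G"
  shows "\<exists>e\<in>primary_edges T G. stratum v \<subseteq> e"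
proof -
  define l where "l = line_of_seg v"
  have l: "v l = 0" "l \<in> T" using v line_of_seg line_of_seg_lines lines_in_T unfolding l_def by auto
  obtain p where p: "p \<in> stratum v" using seg_stratum_nonempty[OF v(1)] by blast
  have "stratum v \<subseteq> l" using subset_line_iff[OF v(1)] l by blast
  then have "p \<in> line_support G l" using v(2) p closure_subset unfolding support_def by blast
  then obtain e where e: "e \<in> components (line_support G l)" "p \<in> e"
    using Union_components[of "line_support G l"] by blast
  then have "closure (stratum v) \<subseteq> e"
    using primary_edge_absorbs_seg[OF e(1) l(2) v l(1) e(2)] p closure_subset by blast
  then show ?thesis using l(2) e(1) closure_subset unfolding primary_edges_def by blast
qed

end

section \<open>Products over cells and segments by birth point\<close>

context swept_window
begin

lemma birth_outgoing_cell_node: "x \<in> nodes T \<inter> D \<Longrightarrow> birth (outgoing_cell x) = x"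
  using birth_outgoing_cell nodes_iff[of x] by blast

lemma far_cell_not_origin: "l \<in> lines \<Longrightarrow> far_cell l \<noteq> signs origin"
  using origin_side[of l] unfolding far_cell_def by (metis fun_upd_same minus_equation_iff one_neq_neg_one)

lemma outgoing_cell_not_origin:
  assumes "x \<in> nodes T \<inter> D" shows "outgoing_cell x \<noteq> signs origin"
proof
  assume "outgoing_cell x = signs origin"
  then have "origin = x" using birth_outgoing_cell_node[OF assms] origin(4) by simp
  then show False using origin(3) nodes_iff[of x] assms unfolding cells_def by auto
qed

text \<open>A bijective form of the count of cells as one plus the number of lines plus the number
  of nodes; birth points keep the three kinds apart. It lets the factors of lines and nodes be
  attached to cells.\<close>

lemma prod_cells:
  fixes f :: "(point set \<Rightarrow> real) \<Rightarrow> 'a::comm_monoid_mult"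
  shows "(\<Prod>v\<in>cells. f v) = f (signs origin) * (\<Prod>l\<in>lines. f (far_cell l)) * (\<Prod>x\<in>nodes T \<inter> D. f (outgoing_cell x))"
proof -
  note bx = birth_outgoing_cell_node
  have inj1: "inj_on far_cell lines"
    by (rule inj_on_inverseI[of _ "\<lambda>v. line_of_seg (signs (birth v))"]) (simp add: birth_far_cell line_birth(6))
  have inj2: "inj_on outgoing_cell (nodes T \<inter> D)"
    by (rule inj_on_inverseI[of _ birth]) (rule bx)
  have eq: "cells = insert (signs origin) (far_cell ` lines \<union> outgoing_cell ` (nodes T \<inter> D))"
    using cell_birth_cases origin(3) far_cell outgoing_cell(1) by blast
  have disj: "far_cell ` lines \<inter> outgoing_cell ` (nodes T \<inter> D) = {}"
  proof -
    have False if "l \<in> lines" "x \<in> nodes T \<inter> D" "far_cell l = outgoing_cell x" for l x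
      using birth_far_cell[OF that(1)] bx[OF that(2)] line_birth(4)[OF that(1)] that by auto
    then show ?thesis by blast
  qed
  have notin: "signs origin \<notin> far_cell ` lines \<union> outgoing_cell ` (nodes T \<inter> D)"
    using far_cell_not_origin outgoing_cell_not_origin by (auto dest: sym)
  show ?thesis
    unfolding eq using notin finite_lines finite_nodes disj inj1 inj2
    by (simp add: prod.union_disjoint prod.reindex mult.assoc)
qed

text \<open>Every line has one segment born at its minimum, and every node gives birth to one
  segment on each of its two lines.\<close>

lemma prod_segs:
  fixes f :: "(point set \<Rightarrow> real) \<Rightarrow> 'a::comm_monoid_mult"
  shows "(\<Prod>v\<in>segs. f v) = (\<Prod>l\<in>lines. f (signs (line_birth l))) *
    (\<Prod>x\<in>nodes T \<inter> D. \<Prod>l | signs x l = 0. f ((signs x)(l := - incoming x l)))"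
proof -
  define P where "P = (SIGMA x:nodes T \<inter> D. {l. signs x l = 0})"
  define out where "out = (\<lambda>(x, l). (signs x)(l := - incoming x l))"
  have fin: "finite {l. signs x l = 0}" for x
    using finite_lines signs_zero_lines by (metis (mono_tags, lifting) finite_subset mem_Collect_eq subsetI)
  then have finP: "finite P" unfolding P_def using finite_nodes by auto
  have out: "out z \<in> segs \<and> birth (out z) = fst z" if "z \<in> P" for z
  proof -
    obtain x l where xl: "z = (x, l)" by (cases z)
    then have z: "z = (x, l)" "x \<in> nodes T \<inter> D" "signs x l = 0" using that unfolding P_def by auto
    then obtain m where m: "x \<in> D" "m \<noteq> l" "signs x m = 0" "signs x l = 0" by (metis node_obtain)
    show ?thesis
      using node_seg(1)[OF m(1) m(2)[symmetric] m(4,3) incoming_values(2)] birth_outgoing_seg[OF m]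
      unfolding z(1) out_def by simp
  qed
  have "inj_on out P"
  proof (rule inj_onI)
    fix y z assume yz: "y \<in> P" "z \<in> P" "out y = out z"
    then have f: "fst y = fst z" using out by metis
    obtain x l where y: "y = (x, l)" "signs x l = 0" using yz(1) unfolding P_def by auto
    obtain m where z: "z = (x, m)" using f y(1) by (cases z) auto
    have "(signs x)(l := - incoming x l) = (signs x)(m := - incoming x m)"
      using yz(3) unfolding y(1) z out_def by simp
    then have "l = m" using y(2) incoming_values(3)[of x l] by (metis fun_upd_def neg_equal_0_iff_equal)
    then show "y = z" using y z by simp
  qed
  have inj1: "inj_on (\<lambda>l. signs (line_birth l)) lines"
    by (rule inj_on_inverseI[of _ line_of_seg]) (rule line_birth(6))
  have eq: "segs = (\<lambda>l. signs (line_birth l)) ` lines \<union> out ` P"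
  proof
    show "segs \<subseteq> (\<lambda>l. signs (line_birth l)) ` lines \<union> out ` P"
    proof
      fix v assume "v \<in> segs"
      then show "v \<in> (\<lambda>l. signs (line_birth l)) ` lines \<union> out ` P"
        using seg_birth_cases[of v] unfolding P_def out_def by force
    qed
    show "(\<lambda>l. signs (line_birth l)) ` lines \<union> out ` P \<subseteq> segs" using out line_birth(5) by blast
  qed
  have disj: "(\<lambda>l. signs (line_birth l)) ` lines \<inter> out ` P = {}"
  proof -
    have False if "l \<in> lines" "z \<in> P" "signs (line_birth l) = out z" for l z
      using line_birth(4,7)[OF that(1)] out[OF that(2)] that unfolding P_def by auto
    then show ?thesis by blast
  qed
  have "(\<Prod>v\<in>segs. f v) = (\<Prod>l\<in>lines. f (signs (line_birth l))) * (\<Prod>z\<in>P. f (out z))"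
    unfolding eq using finite_lines finP disj inj1 \<open>inj_on out P\<close>
    by (simp add: prod.union_disjoint prod.reindex)
  also have "(\<Prod>z\<in>P. f (out z)) = (\<Prod>x\<in>nodes T \<inter> D. \<Prod>l | signs x l = 0. f ((signs x)(l := - incoming x l)))"
    unfolding P_def out_def using finite_nodes fin by (subst prod.Sigma) (auto simp: case_prod_beta)
  finally show ?thesis .
qed

text \<open>For a segment whose birth point is a node, the preceding segment is the one on the opposite side
  of this node on the same line.\<close>

definition preceding :: "(point set \<Rightarrow> real) \<Rightarrow> point set \<Rightarrow> real" where
  "preceding v l = (if signs (birth v) l = 0 then - v l else v l)"

lemma preceding_outgoing:
  assumes x: "x \<in> D" "l \<noteq> m" "signs x l = 0" "signs x m = 0"
  shows "preceding ((signs x)(m := - incoming x m)) = (signs x)(m := incoming x m)"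
  unfolding preceding_def birth_outgoing_seg[OF x] using x by auto

lemma seg_birth_node:
  assumes v: "v \<in> segs" "v l = 0" "birth v \<in> nodes T"
  obtains m where "birth v \<in> D" "l \<noteq> m" "signs (birth v) l = 0" "signs (birth v) m = 0"
    "v = (signs (birth v))(m := - incoming (birth v) m)"
proof -
  have "v \<noteq> signs (line_birth l')" if "l' \<in> lines" for l'
    using line_birth(4,7)[OF that] v(3) by auto
  then obtain x m where x: "x \<in> nodes T \<inter> D" "signs x m = 0" "v = (signs x)(m := - incoming x m)"
    using seg_birth_cases[OF v(1)] by blast
  have "l \<noteq> m" using v(2) x(3) incoming_values(3)[of x m] by auto
  then have l: "signs x l = 0" using v(2) x(3) by simp
  have "birth v = x" using birth_outgoing_seg[of x l m] x l \<open>l \<noteq> m\<close> by auto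
  then show ?thesis using that[of m] x l \<open>l \<noteq> m\<close> by auto
qed

lemma seg_birth_not_node:
  assumes v: "v \<in> segs" "v l = 0" "birth v \<notin> nodes T"
  shows "v = signs (line_birth l)"
  using seg_birth_cases[OF v(1)]
proof
  assume "\<exists>l\<in>lines. v = signs (line_birth l)"
  then show ?thesis using v(2) line_of_seg[OF v(1)] line_birth(6) by metis
next
  assume "\<exists>x\<in>nodes T \<inter> D. \<exists>l. signs x l = 0 \<and> v = (signs x)(l := - incoming x l)"
  then obtain x m where x: "x \<in> nodes T \<inter> D" "signs x m = 0" "v = (signs x)(m := - incoming x m)" by blast
  then obtain k where "x \<in> D" "k \<noteq> m" "signs x k = 0" by (metis node_obtain)
  then have "birth v = x" using birth_outgoing_seg[of x k m] x by simp
  then show ?thesis using x v(3) by blast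
qed

text \<open>The later of two segments on a line starts at a node that separates it from the earlier
  one. Hence a convex set on the line that contains both also contains this node, which limits an
  edge to a single start.\<close>

lemma later_seg:
  assumes v: "v \<in> segs" "v l = 0" and w: "w \<in> segs" "w l = 0" and ne: "v \<noteq> w"
    and le: "h (birth v) \<le> h (birth w)" and y: "y \<in> stratum v" and z: "z \<in> stratum w"
  shows "birth w \<in> nodes T" "\<exists>t>0. t < 1 \<and> birth w = (1 - t) *\<^sub>R y + t *\<^sub>R z"
    "\<And>m. signs (birth w) m = 0 \<Longrightarrow> signs y m = preceding w m"
proof -
  have vD: "v \<in> signs ` D" "w \<in> signs ` D" using v w unfolding segs_def by auto
  have L: "l \<in> lines" using v line_of_seg[OF v(1)] line_of_seg_lines by metis
  have lT: "l \<in> T" using L lines_in_T by blast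
  have bv: "birth v \<in> D" "signs (birth v) l = 0" using birth[OF vD(1)] le_signs_zero v(2) by blast+
  show node: "birth w \<in> nodes T"
  proof (rule ccontr)
    assume "birth w \<notin> nodes T"
    then have ww: "w = signs (line_birth l)" using seg_birth_not_node[OF w] by blast
    then have bw: "birth w = line_birth l" using line_birth(7)[OF L] by simp
    have "birth w = birth v"
      using min_unique[of l "line_birth l" "birth v"] line_birth(1-3)[OF L] le bv
        affine_imp_convex[OF line(1)[OF lT]] signs_zero_iff unfolding bw by (smt (verit, best) Int_iff)
    then have "birth v \<notin> nodes T" using \<open>birth w \<notin> nodes T\<close> by simp
    then show False using seg_birth_not_node[OF v] ww ne by blast
  qed
  obtain m where m: "birth w \<in> D" "l \<noteq> m" "signs (birth w) l = 0" "signs (birth w) m = 0"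
    "w = (signs (birth w))(m := - incoming (birth w) m)"
    by (rule seg_birth_node[OF w node])
  have wm: "w m = - incoming (birth w) m" using m(5) by (metis fun_upd_same)
  have vm: "v m \<noteq> 0" using other_line_nonzero[OF v] m(2) by blast
  \<comment> \<open>The birth point of v is not on the outgoing side of m, where h exceeds its value
    at \<open>birth w\<close>. If the birth points coincide, v would be the outgoing half of l as
    well and equal w.\<close>
  have vm_inc: "v m = incoming (birth w) m"
  proof (cases "birth v = birth w")
    case True
    obtain m' where m': "birth v \<in> D" "l \<noteq> m'" "signs (birth v) l = 0" "signs (birth v) m' = 0"
      "v = (signs (birth v))(m' := - incoming (birth v) m')"
      using seg_birth_node[OF v] node True by metis
    have "m' = m" using no_three_zeros[OF m(1,3,4,2)] m'(2,4) True by metis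
    then have "v = w" using m' m True by simp
    then show ?thesis using ne by blast
  next
    case False
    then have b0: "signs (birth v) m \<noteq> 0"
      using lines_meet_once[of l m "birth v" "birth w"] m bv signs_zero_iff by blast
    moreover have "signs (birth v) m \<noteq> - incoming (birth w) m"
      using outgoing_greater[OF m(1-4) bv] le by fastforce
    moreover have "v m = signs (birth v) m" using birth(2)[OF vD(1)] b0 unfolding le_signs_def by metis
    ultimately show ?thesis using signs_image_values[OF vD(1), of m] incoming_values(1)[of "birth w" m] by auto
  qed
  have sy: "signs y = v" "y \<in> D" and sz: "signs z = w" "z \<in> D" using y z unfolding stratum_def by auto
  show "\<exists>t>0. t < 1 \<and> birth w = (1 - t) *\<^sub>R y + t *\<^sub>R z"
    using cross_line[OF m(1-4) sy(2) _ sz(2)] sy sz v(2) w(2) vm_inc wm incoming_values(3) by simp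
  fix k assume k: "signs (birth w) k = 0"
  then have "k = l \<or> k = m" using no_three_zeros[OF m(1,3,4,2)] by blast
  then show "signs y k = preceding w k"
    unfolding preceding_def using k sy v(2) w(2) vm_inc wm by auto
qed

text \<open>The segments through which the sweep enters an edge. A segment born off the nodes is the
  first on its line; at a node an edge begins only if the node is a vertex.\<close>

definition edge_starts :: "point set set \<Rightarrow> (point set \<Rightarrow> real) set" where
  "edge_starts G = {v \<in> segs. stratum v \<in> G \<and> (birth v \<in> nodes T \<longrightarrow> birth v \<in> vertices G)}"

text \<open>A primary edge continues through vertices, so at a node it begins only if the preceding
  segment of the same line is missing from the graph.\<close>

definition primary_edge_starts :: "point set set \<Rightarrow> (point set \<Rightarrow> real) set" where
  "primary_edge_starts G =
    {v \<in> segs. stratum v \<in> G \<and> (birth v \<in> nodes T \<longrightarrow> stratum (preceding v) \<notin> G)}"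

lemma exists_min_birth:
  assumes "V \<subseteq> segs" "V \<noteq> {}"
  obtains v where "v \<in> V" "\<And>w. w \<in> V \<Longrightarrow> h (birth v) \<le> h (birth w)"
proof -
  have fin: "finite V" using assms(1) finite_segs finite_subset by blast
  show ?thesis
    using that[of "arg_min_on (\<lambda>v. h (birth v)) V"] arg_min_least[OF fin assms(2), where f = "\<lambda>v. h (birth v)"]
      arg_min_if_finite(1)[OF fin assms(2), where f = "\<lambda>v. h (birth v)"]
    by blast
qed

lemma preceding_seg:
  assumes v: "v \<in> segs" "v l = 0" "birth v \<in> nodes T"
  shows "preceding v \<in> segs" "preceding v l = 0" "signs (birth v) \<preceq> preceding v" 
    "h (birth (preceding v)) < h (birth v)"
proof -
  obtain m where m: "birth v \<in> D" "l \<noteq> m" "signs (birth v) l = 0" "signs (birth v) m = 0"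
    "v = (signs (birth v))(m := - incoming (birth v) m)"
    by (rule seg_birth_node[OF v])
  have eq: "preceding v = (signs (birth v))(m := incoming (birth v) m)"
    using preceding_outgoing[OF m(1-4)] m(5) by simp
  note ns = node_seg[OF m(1) m(2)[symmetric] m(4,3) incoming_values(1)]
  show "preceding v \<in> segs" "preceding v l = 0" "signs (birth v) \<preceq> preceding v"
    unfolding eq using ns m by auto
  obtain y where y: "y \<in> D" "signs y = preceding v" "h y < h (birth v)"
    using exists_incoming[OF m(1-4)] unfolding eq by blast
  then have "h (birth (preceding v)) \<le> h y" by (intro birth) (auto intro: rev_image_eqI)
  then show "h (birth (preceding v)) < h (birth v)" using y by simp
qed

text \<open>The earliest segment in an edge is a start: a birth node that is no vertex is passed
  straight, and the preceding segment, which is earlier, would lie in the edge too. A second start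
  would be born at a node inside the convex edge, where there are no vertices.\<close>

lemma edges_matching:
  assumes G: "G \<subseteq> segments T D"
  shows "\<exists>g. bij_betw g (edges T G) (edge_starts G) \<and> (\<forall>e\<in>edges T G. stratum (g e) \<subseteq> e)"
proof (rule bij_betw_of_matching)
  fix e assume "e \<in> edges T G"
  then obtain l where l: "l \<in> T" "e \<in> components (line_support G l - vertices G)" "e \<subseteq> l" "convex e"
    by (rule edges_line)
  define V where "V = {v \<in> segs. stratum v \<in> G \<and> v l = 0 \<and> stratum v \<subseteq> e}"
  have "V \<noteq> {}" using edge_contains_seg[OF G l(1,2)] unfolding V_def by blast
  then obtain v where v: "v \<in> V" "\<And>w. w \<in> V \<Longrightarrow> h (birth v) \<le> h (birth w)"
    using exists_min_birth[of V] unfolding V_def by blast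
  then have vs: "v \<in> segs" "stratum v \<in> G" "v l = 0" "stratum v \<subseteq> e" unfolding V_def by auto
  have "birth v \<in> vertices G" if node: "birth v \<in> nodes T"
  proof (rule ccontr)
    assume nv: "birth v \<notin> vertices G"
    obtain m where m: "birth v \<in> D" "l \<noteq> m" "signs (birth v) l = 0" "signs (birth v) m = 0"
      "v = (signs (birth v))(m := - incoming (birth v) m)"
      by (rule seg_birth_node[OF vs(1,3) node])
    have lev: "signs (birth v) \<preceq> v" using birth(2) vs(1) unfolding segs_def by blast
    then have supp: "birth v \<in> line_support G l - vertices G"
      using mem_line_support_iff[OF G l(1) m(1)] vs nv by blast
    have "connected (insert (birth v) (stratum v))"
      using connected_insert_stratum[OF m(1) _ lev] vs(1) unfolding segs_def by blast
    moreover have "insert (birth v) (stratum v) \<subseteq> line_support G l - vertices G"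
      using supp seg_subset_line_support[OF G vs(1-3)] by blast
    ultimately have be: "birth v \<in> e"
      using components_maximal[OF l(2)] vs(4) seg_stratum_nonempty[OF vs(1)] by blast
    have pre: "preceding v = (signs (birth v))(m := incoming (birth v) m)"
      using preceding_outgoing[OF m(1-4)] m(5) by simp
    have "stratum ((signs (birth v))(m := 1)) \<in> G \<and> stratum ((signs (birth v))(m := -1)) \<in> G"
      using node_graph(3)[OF G m(1-4)] nv vs(2) m(5) incoming_values(2)[of "birth v" m] by metis
    then have "stratum (preceding v) \<in> G" unfolding pre using incoming_values(1)[of "birth v" m] by auto
    moreover note ps = preceding_seg[OF vs(1,3) node]
    ultimately have "stratum (preceding v) \<subseteq> e" using edge_absorbs_seg[OF G l(2) _ _ _ be m(1)] by blast
    then have "preceding v \<in> V" unfolding V_def using ps \<open>stratum (preceding v) \<in> G\<close> by blast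
    then show False using v(2) ps(4) by fastforce
  qed
  then show "\<exists>v\<in>edge_starts G. stratum v \<subseteq> e" using vs unfolding edge_starts_def by blast
next
  fix v assume "v \<in> edge_starts G"
  then show "\<exists>e\<in>edges T G. stratum v \<subseteq> e" using seg_in_edge[OF G] unfolding edge_starts_def by blast
next
  fix e v w assume e: "e \<in> edges T G" and vw: "v \<in> edge_starts G" "w \<in> edge_starts G" "stratum v \<subseteq> e" "stratum w \<subseteq> e"
  obtain l where l: "l \<in> T" "e \<in> components (line_support G l - vertices G)" "e \<subseteq> l" "convex e"
    using e by (rule edges_line)
  have *: False if vw: "v \<in> edge_starts G" "w \<in> edge_starts G" "stratum v \<subseteq> e" "stratum w \<subseteq> e"
    and ne: "v \<noteq> w" and le: "h (birth v) \<le> h (birth w)" for v w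
  proof -
    have s: "v \<in> segs" "w \<in> segs" using vw unfolding edge_starts_def by auto
    have z: "v l = 0" "w l = 0" using subset_line_iff[OF s(1)] subset_line_iff[OF s(2)] vw l by blast+
    obtain y where y: "y \<in> stratum v" using seg_stratum_nonempty[OF s(1)] by blast
    obtain z' where z': "z' \<in> stratum w" using seg_stratum_nonempty[OF s(2)] by blast
    note ls = later_seg[OF s(1) z(1) s(2) z(2) ne le y z']
    obtain t where t: "t > 0" "t < 1" "birth w = (1 - t) *\<^sub>R y + t *\<^sub>R z'" using ls(2) by blast
    have "birth w \<in> e" unfolding t(3) using convexD_alt[OF l(4), of y z' t] y z' vw t by auto
    then have "birth w \<notin> vertices G" using in_components_subset[OF l(2)] by blast
    then show False using vw(2) ls(1) unfolding edge_starts_def by blast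
  qed
  show "v = w" using *[OF vw] *[OF vw(2,1,4,3)] by fastforce
next
  fix e f v assume e: "e \<in> edges T G" "f \<in> edges T G" and v: "v \<in> edge_starts G" "stratum v \<subseteq> e" "stratum v \<subseteq> f"
  obtain l where l: "l \<in> T" "e \<in> components (line_support G l - vertices G)" "e \<subseteq> l"
    using e(1) by (rule edges_line)
  obtain k where k: "k \<in> T" "f \<in> components (line_support G k - vertices G)" "f \<subseteq> k"
    using e(2) by (rule edges_line)
  have s: "v \<in> segs" using v unfolding edge_starts_def by auto
  have "v l = 0" "v k = 0" using subset_line_iff[OF s] v l k by blast+
  then have "l = k" using line_of_seg[OF s] by metis
  then show "e = f" using components_eq[OF l(2)] k(2) seg_stratum_nonempty[OF s] v by blast
qed

text \<open>The argument for edges, with continuation at a node detected by the preceding segment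
  instead of the absence of a vertex.\<close>

lemma primary_edges_matching:
  assumes G: "G \<subseteq> segments T D"
  shows "\<exists>g. bij_betw g (primary_edges T G) (primary_edge_starts G) \<and> (\<forall>e\<in>primary_edges T G. stratum (g e) \<subseteq> e)"
proof (rule bij_betw_of_matching)
  fix e assume "e \<in> primary_edges T G"
  then obtain l where l: "l \<in> T" "e \<in> components (line_support G l)" "e \<subseteq> l" "convex e"
    by (rule primary_edges_line)
  define V where "V = {v \<in> segs. stratum v \<in> G \<and> v l = 0 \<and> stratum v \<subseteq> e}"
  have "V \<noteq> {}" using primary_edge_contains_seg[OF G l(1,2)] unfolding V_def by blast
  then obtain v where v: "v \<in> V" "\<And>w. w \<in> V \<Longrightarrow> h (birth v) \<le> h (birth w)"
    using exists_min_birth[of V] unfolding V_def by blast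
  then have vs: "v \<in> segs" "stratum v \<in> G" "v l = 0" "stratum v \<subseteq> e" unfolding V_def by auto
  have "stratum (preceding v) \<notin> G" if node: "birth v \<in> nodes T"
  proof
    assume on: "stratum (preceding v) \<in> G"
    note ps = preceding_seg[OF vs(1,3) node]
    have vD: "v \<in> signs ` D" "preceding v \<in> signs ` D" using vs(1) ps(1) unfolding segs_def by auto
    obtain p where p: "p \<in> stratum v" using seg_stratum_nonempty[OF vs(1)] by blast
    have "birth v \<in> closure (stratum v)" "birth v \<in> closure (stratum (preceding v))"
      using below_iff[OF vD(1)] below_iff[OF vD(2)] birth(1,2)[OF vD(1)] ps(3) by auto
    moreover have "closure (stratum v) \<subseteq> e"
      using primary_edge_absorbs_seg[OF l(2,1) vs(1-3), of p] p vs(4) closure_subset by blast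
    ultimately have "closure (stratum (preceding v)) \<subseteq> e"
      using primary_edge_absorbs_seg[OF l(2,1) ps(1) on ps(2)] by blast
    then have "preceding v \<in> V" unfolding V_def using ps on closure_subset by blast
    then show False using v(2) ps(4) by fastforce
  qed
  then show "\<exists>v\<in>primary_edge_starts G. stratum v \<subseteq> e" using vs unfolding primary_edge_starts_def by blast
next
  fix v assume "v \<in> primary_edge_starts G"
  then show "\<exists>e\<in>primary_edges T G. stratum v \<subseteq> e"
    using seg_in_primary_edge unfolding primary_edge_starts_def by blast
next
  fix e v w assume e: "e \<in> primary_edges T G"
    and vw: "v \<in> primary_edge_starts G" "w \<in> primary_edge_starts G" "stratum v \<subseteq> e" "stratum w \<subseteq> e"
  obtain l where l: "l \<in> T" "e \<in> components (line_support G l)" "e \<subseteq> l" "convex e"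
    using e by (rule primary_edges_line)
  have *: False if vw: "v \<in> primary_edge_starts G" "w \<in> primary_edge_starts G" "stratum v \<subseteq> e" "stratum w \<subseteq> e"
    and ne: "v \<noteq> w" and le: "h (birth v) \<le> h (birth w)" for v w
  proof -
    have s: "v \<in> segs" "w \<in> segs" using vw unfolding primary_edge_starts_def by auto
    have z: "v l = 0" "w l = 0" using subset_line_iff[OF s(1)] subset_line_iff[OF s(2)] vw l by blast+
    obtain y where y: "y \<in> stratum v" using seg_stratum_nonempty[OF s(1)] by blast
    obtain z' where z': "z' \<in> stratum w" using seg_stratum_nonempty[OF s(2)] by blast
    note ls = later_seg[OF s(1) z(1) s(2) z(2) ne le y z']
    obtain t where t: "t > 0" "t < 1" "birth w = (1 - t) *\<^sub>R y + t *\<^sub>R z'" using ls(2) by blast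
    have be: "birth w \<in> e" unfolding t(3) using convexD_alt[OF l(4), of y z' t] y z' vw t by auto
    have wD: "w \<in> signs ` D" using s(2) unfolding segs_def by blast
    have yD: "y \<in> D" using y unfolding stratum_def by blast
    obtain r where r: "r > 0" "r < 1" "signs (birth w) \<preceq> signs ((1 - r) *\<^sub>R birth w + r *\<^sub>R y)"
      "\<And>m. signs (birth w) m = 0 \<Longrightarrow> signs ((1 - r) *\<^sub>R birth w + r *\<^sub>R y) m = signs y m"
      using step_toward[OF birth(1)[OF wD] yD] by blast
    \<comment> \<open>A point of the primary edge just before the birth of w, on the way back to the
      earlier segment. Its sign vector is \<open>preceding w\<close>, so the preceding segment
      belongs to G.\<close>
    define u where "u = (1 - r) *\<^sub>R birth w + r *\<^sub>R y"
    have ue: "u \<in> e" unfolding u_def using convexD_alt[OF l(4), of "birth w" y r] be y vw r by auto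
    have uD: "u \<in> D" unfolding u_def using D_combination birth(1)[OF wD] yD r by simp
    have "signs u m = preceding w m" for m
    proof (cases "signs (birth w) m = 0")
      case True
      then show ?thesis using ls(3)[OF True] r(4)[OF True] unfolding u_def by simp
    next
      case False
      then show ?thesis using r(3) birth(2)[OF wD] unfolding u_def preceding_def le_signs_def by metis
    qed
    then have su: "signs u = preceding w" ..
    have "u \<in> line_support G l" using ue in_components_subset[OF l(2)] by blast
    then have "u \<in> support G" using line_support_subset_support by blast
    then have "stratum (preceding w) \<in> G"
      using seg_in_support_iff[OF G uD] preceding_seg(1)[OF s(2) z(2) ls(1)] su by simp
    then show False using vw(2) ls(1) unfolding primary_edge_starts_def by blast
  qed
  show "v = w" using *[OF vw] *[OF vw(2,1,4,3)] by fastforce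
next
  fix e f v assume e: "e \<in> primary_edges T G" "f \<in> primary_edges T G"
    and v: "v \<in> primary_edge_starts G" "stratum v \<subseteq> e" "stratum v \<subseteq> f"
  obtain l where l: "l \<in> T" "e \<in> components (line_support G l)" "e \<subseteq> l"
    using e(1) by (rule primary_edges_line)
  obtain k where k: "k \<in> T" "f \<in> components (line_support G k)" "f \<subseteq> k"
    using e(2) by (rule primary_edges_line)
  have s: "v \<in> segs" using v unfolding primary_edge_starts_def by auto
  have "v l = 0" "v k = 0" using subset_line_iff[OF s] v l k by blast+
  then have "l = k" using line_of_seg[OF s] by metis
  then show "e = f" using components_eq[OF l(2)] k(2) seg_stratum_nonempty[OF s] v by blast
qed

end

subsection \<open>Weights\<close>

lemma sum_except_two:
  fixes f :: "'a \<Rightarrow> real"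
  assumes "finite K" "u \<in> K" "d \<in> K" "u \<noteq> d" "\<And>c. c \<in> K \<Longrightarrow> c \<noteq> u \<Longrightarrow> c \<noteq> d \<Longrightarrow> f c = z"
  shows "(\<Sum>c\<in>K. f c) = f u + f d + (real (card K) - 2) * z"
proof -
  have "card K \<ge> card {u, d}" using assms by (intro card_mono) auto
  then have c2: "card K \<ge> 2" using assms(4) by simp
  have "(\<Sum>c\<in>K. f c) = f u + (f d + (\<Sum>c\<in>K - {u} - {d}. f c))"
    using assms by (simp add: sum.remove[of K u] sum.remove[of "K - {u}" d])
  also have "(\<Sum>c\<in>K - {u} - {d}. f c) = (\<Sum>c\<in>K - {u} - {d}. z)"
    using assms by (intro sum.cong) auto
  also have "\<dots> = (real (card K) - 2) * z" using assms c2 by (simp add: of_nat_diff)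
  finally show ?thesis by simp
qed

lemma sum_except_one:
  fixes f :: "'a \<Rightarrow> real"
  assumes "finite K" "u \<in> K" "\<And>c. c \<in> K \<Longrightarrow> c \<noteq> u \<Longrightarrow> f c = z"
  shows "(\<Sum>c\<in>K. f c) = f u + (real (card K) - 1) * z"
proof -
  have c1: "card K \<ge> 1" using assms card_gt_0_iff[of K] by fastforce
  have "(\<Sum>c\<in>K. f c) = f u + (\<Sum>c\<in>K - {u}. f c)"
    using assms by (simp add: sum.remove[of K u])
  also have "(\<Sum>c\<in>K - {u}. f c) = (\<Sum>c\<in>K - {u}. z)"
    using assms by (intro sum.cong) auto
  also have "\<dots> = (real (card K) - 1) * z" using assms c1 by (simp add: of_nat_diff)
  finally show ?thesis by simp
qed

text \<open>The convention for zero times infinity agrees with \<open>0 ^ 0 = 1\<close>: for n = 0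
  the second alternative holds even at x = 0.\<close>

lemma ereal_times_ln_ereal:
  assumes "0 \<le> x"
  shows "ereal (real n) * ln_ereal x = -\<infinity> \<and> x ^ n = 0 \<or>
    (\<exists>r. ereal (real n) * ln_ereal x = ereal r \<and> exp r = x ^ n)"
proof (cases "x = 0")
  case True
  then show ?thesis by (cases "n = 0") (auto simp: ln_ereal_def intro: exI[of _ 0])
next
  case False
  then have "exp (real n * ln x) = x ^ n" using assms by (simp add: exp_of_nat_mult)
  then show ?thesis using False by (auto simp: ln_ereal_def)
qed

lemma exp_sum_ln:
  fixes f :: "'a \<Rightarrow> real"
  assumes "\<And>i. i \<in> I \<Longrightarrow> f i > 0"
  shows "exp (\<Sum>i\<in>I. ln (f i)) = (\<Prod>i\<in>I. f i)"
  using assms by (cases "finite I") (auto simp: exp_sum)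

text \<open>Here \<open>i\<^sub>1\<close>, \<open>i\<^sub>2\<close> and \<open>o\<^sub>1\<close>, \<open>o\<^sub>2\<close> tell whether the incoming and outgoing segments on the two lines
  through a node belong to the graph, and \<open>p\<^sub>1\<close>, \<open>p\<^sub>2\<close> are the activities of these lines.\<close>

definition local_weight :: "nat \<Rightarrow> real \<Rightarrow> real \<Rightarrow> real \<Rightarrow> bool \<Rightarrow> bool \<Rightarrow> bool \<Rightarrow> bool \<Rightarrow> real" where
  "local_weight k \<alpha> p\<^sub>1 p\<^sub>2 i\<^sub>1 i\<^sub>2 o\<^sub>1 o\<^sub>2 =
    (let n = of_bool i\<^sub>1 + of_bool i\<^sub>2 + of_bool o\<^sub>1 + of_bool o\<^sub>2 :: nat;
         s\<^sub>1 = (i\<^sub>1 \<and> o\<^sub>1 \<and> \<not> i\<^sub>2 \<and> \<not> o\<^sub>2); s\<^sub>2 = (i\<^sub>2 \<and> o\<^sub>2 \<and> \<not> i\<^sub>1 \<and> \<not> o\<^sub>1);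
         v = (n \<noteq> 0 \<and> \<not> s\<^sub>1 \<and> \<not> s\<^sub>2)
     in (if v \<and> n = 2 then \<alpha> else 1) * (if v \<and> n = 3 then (real k - 1) * alpha_T k \<alpha> else 1) *
        (if v \<and> n = 4 then (real k - 1) * alpha_X \<alpha> else 1) *
        (if s\<^sub>1 then 1 - epsilon k \<alpha> * p\<^sub>2 else if s\<^sub>2 then 1 - epsilon k \<alpha> * p\<^sub>1 else 1) *
        (if n \<noteq> 0 then inverse (1 - \<alpha> / (real k - 1) * (p\<^sub>1 * p\<^sub>2)) else 1) *
        ((if o\<^sub>1 \<and> v then 1 / (real k - 1) else 1) * (if o\<^sub>1 \<and> \<not> i\<^sub>1 then p\<^sub>1 else 1)) *
        ((if o\<^sub>2 \<and> v then 1 / (real k - 1) else 1) * (if o\<^sub>2 \<and> \<not> i\<^sub>2 then p\<^sub>2 else 1)))"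

text \<open>The choice of \<open>alpha_T\<close>, \<open>alpha_X\<close> and \<open>epsilon\<close> makes the total weight of the colours of the
  outgoing cell independent of the colours of the three other cells at the node.\<close>

lemma sum_local_weight:
  fixes L U B :: nat
  assumes k: "k \<ge> 2" and \<alpha>: "0 \<le> \<alpha>" "\<alpha> \<le> 1" and p: "0 < p\<^sub>1" "p\<^sub>1 < 1" "0 < p\<^sub>2" "p\<^sub>2 < 1"
    and c: "L \<in> {1..k}" "U \<in> {1..k}" "B \<in> {1..k}"
  shows "(\<Sum>R\<in>{1..k}. local_weight k \<alpha> p\<^sub>1 p\<^sub>2 (L \<noteq> U) (L \<noteq> B) (B \<noteq> R) (U \<noteq> R)) =
    inverse (1 - \<alpha> / (real k - 1) * (p\<^sub>1 * p\<^sub>2))" (is "(\<Sum>R\<in>_. ?f R) = inverse ?d")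
proof -
  define n where "n = real k - 1"
  have n: "n \<ge> 1" "real k = n + 1" using k unfolding n_def by auto
  have "p\<^sub>1 * p\<^sub>2 < 1" using p by (metis mult_strict_mono' mult_1 less_imp_le)
  moreover have "\<alpha> / n \<le> 1" "\<alpha> / n \<ge> 0" using \<alpha> n by (auto simp: divide_simps)
  ultimately have d: "1 - \<alpha> / n * (p\<^sub>1 * p\<^sub>2) > 0" using p
    by (smt (verit) mult_left_le_one_le mult_pos_pos)
  have card: "real (card {1..k}) = n + 1" "finite {1..k}" using n by auto
  have k1: "real k - 1 = n" and k2: "real k - 2 = n - 1" unfolding n_def by auto
  note w = local_weight_def Let_def alpha_T_def alpha_X_def epsilon_def of_bool_def
  \<comment> \<open>L is the colour of the cell between the two incoming halves, U and B are those
    of its neighbours, R is that of the newborn cell. Which of L, U and B agree decides which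
    incoming segments are present.\<close>
  consider "U = L" "B = L" | "U \<noteq> L" "B = L" | "U = L" "B \<noteq> L" | "U \<noteq> L" "U = B" | "U \<noteq> L" "B \<noteq> L" "U \<noteq> B"
    by blast
  then have "?d * (\<Sum>R\<in>{1..k}. ?f R) = 1"
  proof cases
    case 1
    \<comment> \<open>Nothing comes in. Either R agrees and the node stays empty, or a V-vertex
      starts two edges; the total \<open>1 + \<alpha> / n * (p\<^sub>1 * p\<^sub>2) / ?d\<close> is
      \<open>inverse ?d\<close>.\<close>
    have sum: "(\<Sum>R\<in>{1..k}. ?f R) = ?f L + n * local_weight k \<alpha> p\<^sub>1 p\<^sub>2 False False True True"
      using 1 c card by (subst sum_except_one[of _ L]) auto
    have f1: "?f L = local_weight k \<alpha> p\<^sub>1 p\<^sub>2 False False False False" using 1 by simp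
    show ?thesis unfolding sum f1 using n d by (simp add: w k1 k2 divide_simps)
  next
    case 2
    \<comment> \<open>One segment comes in and runs straight on, turns at a V-vertex or branches at
      a T-vertex. Up to \<open>inverse ?d\<close>, the last two have total weight
      \<open>epsilon\<close> times the activity of the other line, which is what the straight
      passage lacks to 1.\<close>
    have sum: "(\<Sum>R\<in>{1..k}. ?f R) = ?f U + ?f L + (n - 1) * local_weight k \<alpha> p\<^sub>1 p\<^sub>2 True False True True"
      using 2 c card by (subst sum_except_two[of _ U L]) auto
    have f1: "?f U = local_weight k \<alpha> p\<^sub>1 p\<^sub>2 True False True False" using 2 by auto
    have f2: "?f L = local_weight k \<alpha> p\<^sub>1 p\<^sub>2 True False False True" using 2 by auto
    show ?thesis unfolding sum f1 f2 using n d by (simp add: w k1 k2 divide_simps) (simp add: algebra_simps)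
  next
    case 3
    have sum: "(\<Sum>R\<in>{1..k}. ?f R) = ?f L + ?f B + (n - 1) * local_weight k \<alpha> p\<^sub>1 p\<^sub>2 False True True True"
      using 3 c card by (subst sum_except_two[of _ L B]) auto
    have f1: "?f L = local_weight k \<alpha> p\<^sub>1 p\<^sub>2 False True True False" using 3 by auto
    have f2: "?f B = local_weight k \<alpha> p\<^sub>1 p\<^sub>2 False True False True" using 3 by auto
    show ?thesis unfolding sum f1 f2 using n d by (simp add: w k1 k2 divide_simps) (simp add: algebra_simps)
  next
    case 4
    \<comment> \<open>Two segments come in with equal outer colours. Up to
      \<open>inverse ?d\<close>, they join in a V-vertex of weight \<alpha> or cross in an X-vertex,
      of total weight \<open>alpha_X\<close> over n colours; these sum to 1.\<close>
    have sum: "(\<Sum>R\<in>{1..k}. ?f R) = ?f U + n * local_weight k \<alpha> p\<^sub>1 p\<^sub>2 True True True True"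
      using 4 c card by (subst sum_except_one[of _ U]) auto
    have f1: "?f U = local_weight k \<alpha> p\<^sub>1 p\<^sub>2 True True False False" using 4 by auto
    show ?thesis unfolding sum f1 using n d by (simp add: w k1 k2 divide_simps) (simp add: algebra_simps)
  next
    case 5
    \<comment> \<open>Two segments come in between three colours. Up to \<open>inverse ?d\<close>, R
      equal to U or to B gives a T-vertex of weight \<open>alpha_T\<close>, and the other n - 1
      colours give X-vertices of weight \<open>alpha_X / n\<close>. That these sum to 1 is the
      definition of \<open>alpha_T\<close>.\<close>
    have sum: "(\<Sum>R\<in>{1..k}. ?f R) = ?f U + ?f B + (n - 1) * local_weight k \<alpha> p\<^sub>1 p\<^sub>2 True True True True"
      using 5 c card by (subst sum_except_two[of _ U B]) auto
    have f1: "?f U = local_weight k \<alpha> p\<^sub>1 p\<^sub>2 True True True False" using 5 by auto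
    have f2: "?f B = local_weight k \<alpha> p\<^sub>1 p\<^sub>2 True True False True" using 5 by auto
    show ?thesis unfolding sum f1 f2 using n d by (simp add: w k1 k2 divide_simps) (simp add: algebra_simps)
  qed
  then show ?thesis by (metis inverse_unique)
qed

section \<open>Lines crossing edges, and vertices, as data at nodes\<close>

context tessellated_window
begin

text \<open>Resolving the sign at l gives a segment on the other line through x. At a node where G
  runs straight, the condition therefore singles out the line that crosses G.\<close>

definition crossing_line :: "point set set \<Rightarrow> point \<Rightarrow> point set" where
  "crossing_line G x = (THE l. signs x l = 0 \<and> stratum ((signs x)(l := 1)) \<in> G)"

lemma crossing_line_eqI:
  assumes x: "x \<in> D" "l \<noteq> m" "signs x l = 0" "signs x m = 0"
    and "stratum ((signs x)(m := 1)) \<in> G" "stratum ((signs x)(l := 1)) \<notin> G"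
  shows "crossing_line G x = m"
  unfolding crossing_line_def
  using assms(4-) no_three_zeros[OF x(1,3,4,2)] by (intro the_equality) blast+

lemma node_on_edge:
  assumes G: "G \<subseteq> segments T D" and l: "l \<in> T" and x: "x \<in> line_support G l - vertices G"
    and m: "m \<noteq> l" "signs x m = 0"
  shows "x \<in> D" "signs x l = 0" "stratum ((signs x)(m := 1)) \<in> G" "stratum ((signs x)(l := 1)) \<notin> G"
proof -
  note ep = edge_point[OF G l x]
  show "x \<in> D" "signs x l = 0" using ep by auto
  have "signs x \<notin> segs" using ep(2) m line_of_seg by metis
  then obtain m' where m': "m' \<noteq> l" "signs x m' = 0" "stratum ((signs x)(m' := 1)) \<in> G" "stratum ((signs x)(l := 1)) \<notin> G"
    using ep(3) by blast
  moreover have "m' = m" using no_three_zeros[OF ep(1,2) m(2) m(1)[symmetric] m'(2)] m'(1) by blast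
  ultimately show "stratum ((signs x)(m := 1)) \<in> G" "stratum ((signs x)(l := 1)) \<notin> G" by auto
qed

abbreviation crossings :: "point set set \<Rightarrow> (point set \<times> point set) set" where
  "crossings G \<equiv> (SIGMA e:edges T G. {l \<in> T. l \<inter> e \<noteq> {} \<and> \<not> e \<subseteq> l})"

text \<open>A line crosses an edge at a node where the graph runs straight. Conversely, such a node
  lies on one edge and one line crosses it there. The double sum over edges and lines thus becomes a
  sum over nodes.\<close>

lemma crossings_matching:
  assumes G: "G \<subseteq> segments T D"
  shows "\<exists>g. bij_betw g (crossings G)
      {x \<in> nodes T \<inter> D. x \<in> support G \<and> x \<notin> vertices G} \<and>
    (\<forall>z\<in>(crossings G). g z \<in> fst z \<and> g z \<in> snd z)"
proof (rule bij_betw_of_matching)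
  fix z assume "z \<in> crossings G"
  then obtain e m where z: "z = (e, m)" "e \<in> edges T G" "m \<in> T" "m \<inter> e \<noteq> {}" "\<not> e \<subseteq> m" by blast
  obtain l where l: "l \<in> T" "e \<in> components (line_support G l - vertices G)" "e \<subseteq> l"
    using z(2) by (rule edges_line)
  obtain x where x: "x \<in> m" "x \<in> e" using z(4) by blast
  have xs: "x \<in> line_support G l - vertices G" using x(2) in_components_subset[OF l(2)] by blast
  have "m \<noteq> l" using z(5) l(3) by blast
  then have "x \<in> nodes T" using x l z(3) unfolding nodes_def by blast
  moreover have "x \<in> D" using edge_point(1)[OF G l(1) xs] .
  ultimately show "\<exists>x\<in>{x \<in> nodes T \<inter> D. x \<in> support G \<and> x \<notin> vertices G}. x \<in> fst z \<and> x \<in> snd z"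
    using x xs z(1) line_support_subset_support by auto
next
  fix x assume x: "x \<in> {x \<in> nodes T \<inter> D. x \<in> support G \<and> x \<notin> vertices G}"
  then have xD: "x \<in> D" by blast
  obtain v where v: "v \<in> segs" "stratum v \<in> G" "signs x \<preceq> v" using x mem_support_iff[OF G xD] by blast
  define l where "l = line_of_seg v"
  have l: "v l = 0" "l \<in> T" using v line_of_seg line_of_seg_lines lines_in_T unfolding l_def by auto
  have xl: "signs x l = 0" using le_signs_zero v(3) l(1) by blast
  have "x \<in> nodes T" using x by blast
  then obtain l1 l2 where l12: "l1 \<noteq> l2" "signs x l1 = 0" "signs x l2 = 0" using nodes_iff[OF xD] by blast
  then obtain m where m: "m \<noteq> l" "signs x m = 0" by metis
  have "x \<in> line_support G l - vertices G"
    using mem_line_support_iff[OF G l(2) xD] v l(1) x by blast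
  then obtain e where e: "e \<in> components (line_support G l - vertices G)" "x \<in> e"
    using Union_components[of "line_support G l - vertices G"] by blast
  have mT: "m \<in> T" "x \<in> m" using m xD signs_zero_iff by auto
  have "stratum v \<subseteq> e" using edge_absorbs_seg[OF G e(1) v(1,2) l(1) e(2) xD v(3)] .
  then have "\<not> e \<subseteq> m" using subset_line_iff[OF v(1), of m] mT other_line_nonzero[OF v(1) l(1) m(1)] by blast
  moreover have "e \<in> edges T G" using e(1) l(2) unfolding edges_def by blast
  ultimately have "(e, m) \<in> crossings G" using mT e(2) by blast
  then show "\<exists>z\<in>(crossings G). x \<in> fst z \<and> x \<in> snd z"
    using mT e(2) by (intro bexI[of _ "(e, m)"]) auto
next
  fix z x y assume "z \<in> crossings G"
  then obtain e m where z: "z = (e, m)" "e \<in> edges T G" "m \<in> T" "m \<inter> e \<noteq> {}" "\<not> e \<subseteq> m" by blast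
  assume xy: "x \<in> fst z \<and> x \<in> snd z" "y \<in> fst z \<and> y \<in> snd z"
  obtain l where l: "l \<in> T" "e \<subseteq> l" using z(2) by (rule edges_line)
  have "m \<noteq> l" using z(5) l(2) by blast
  then show "x = y" using lines_meet_once[OF l(1) z(3)] xy l(2) unfolding z(1) by auto
next
  fix z z' x assume zz: "z \<in> crossings G"
    "z' \<in> crossings G"
    and x: "x \<in> {x \<in> nodes T \<inter> D. x \<in> support G \<and> x \<notin> vertices G}"
    and xz: "x \<in> fst z \<and> x \<in> snd z" "x \<in> fst z' \<and> x \<in> snd z'"
  obtain e m where z: "z = (e, m)" "e \<in> edges T G" "m \<in> T" "\<not> e \<subseteq> m" using zz(1) by blast
  obtain e' m' where z': "z' = (e', m')" "e' \<in> edges T G" "m' \<in> T" "\<not> e' \<subseteq> m'" using zz(2) by blast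
  obtain l where l: "l \<in> T" "e \<in> components (line_support G l - vertices G)" "e \<subseteq> l"
    using z(2) by (rule edges_line)
  obtain l' where l': "l' \<in> T" "e' \<in> components (line_support G l' - vertices G)" "e' \<subseteq> l'"
    using z'(2) by (rule edges_line)
  have ml: "m \<noteq> l" "m' \<noteq> l'" using z(4) l(3) z'(4) l'(3) by auto
  have xD: "x \<in> D" using x by blast
  have m0: "signs x m = 0" "signs x m' = 0" using xz signs_zero_iff[OF xD] z z' by auto
  have sx: "x \<in> line_support G l - vertices G" "x \<in> line_support G l' - vertices G"
    using xz z(1) z'(1) in_components_subset[OF l(2)] in_components_subset[OF l'(2)] by auto
  note n = node_on_edge[OF G l(1) sx(1) ml(1) m0(1)] and n' = node_on_edge[OF G l'(1) sx(2) ml(2) m0(2)]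
  have "crossing_line G x = m" by (rule crossing_line_eqI[OF n(1) ml(1)[symmetric] n(2) m0(1) n(3,4)])
  moreover have "crossing_line G x = m'" by (rule crossing_line_eqI[OF n(1) ml(2)[symmetric] n'(2) m0(2) n'(3,4)])
  ultimately have "m = m'" by simp
  then have "l = l'" using no_three_zeros[OF xD n(2) m0(1) ml(1)[symmetric] n'(2)] ml(2) by blast
  then have "e = e'" using components_eq[OF l(2)] l'(2) xz z(1) z'(1) by auto
  then show "z = z'" using z z' \<open>m = m'\<close> by simp
qed

lemma prod_crossings:
  fixes f :: "point set \<Rightarrow> 'a::comm_monoid_mult"
  assumes G: "G \<subseteq> segments T D" and fin: "finite (edges T G)"
  shows "(\<Prod>e\<in>edges T G. \<Prod>l | l \<in> T \<and> l \<inter> e \<noteq> {} \<and> \<not> e \<subseteq> l. f l) =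
    (\<Prod>x\<in>nodes T \<inter> D. if x \<in> support G \<and> x \<notin> vertices G then f (crossing_line G x) else 1)"
proof -
  define A where "A = crossings G"
  define B where "B = {x \<in> nodes T \<inter> D. x \<in> support G \<and> x \<notin> vertices G}"
  obtain g where g: "bij_betw g A B" "\<And>z. z \<in> A \<Longrightarrow> g z \<in> fst z \<and> g z \<in> snd z"
    using crossings_matching[OF G] unfolding A_def B_def by blast
  have fin_l: "finite {l \<in> T. l \<inter> e \<noteq> {} \<and> \<not> e \<subseteq> l}" if e: "e \<in> edges T G" for e
  proof -
    obtain l where l: "l \<in> T" "e \<in> components (line_support G l - vertices G)"
      using e by (rule edges_line)
    have "e \<subseteq> D" using edge_point(1)[OF G l(1)] in_components_subset[OF l(2)] by blast
    then have "{l \<in> T. l \<inter> e \<noteq> {} \<and> \<not> e \<subseteq> l} \<subseteq> lines" unfolding lines_def by blast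
    then show ?thesis using finite_lines finite_subset by blast
  qed
  have "(\<Prod>e\<in>edges T G. \<Prod>l | l \<in> T \<and> l \<inter> e \<noteq> {} \<and> \<not> e \<subseteq> l. f l) = (\<Prod>z\<in>A. f (snd z))"
    unfolding A_def using fin fin_l by (subst prod.Sigma) (auto simp: case_prod_beta)
  also have "\<dots> = (\<Prod>z\<in>A. f (crossing_line G (g z)))"
  proof (rule prod.cong[OF refl])
    fix z assume z: "z \<in> A"
    obtain e m where em: "z = (e, m)" "e \<in> edges T G" "m \<in> T" "\<not> e \<subseteq> m" using z unfolding A_def by blast
    obtain l where l: "l \<in> T" "e \<in> components (line_support G l - vertices G)" "e \<subseteq> l"
      using em(2) by (rule edges_line)
    have ml: "m \<noteq> l" using em(4) l(3) by blast
    have "g z \<in> B" using g(1) z unfolding bij_betw_def by blast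
    then have "g z \<in> D" unfolding B_def by blast
    then have m0: "signs (g z) m = 0" using g(2)[OF z] em signs_zero_iff by auto
    have "g z \<in> line_support G l - vertices G"
      using g(2)[OF z] em(1) in_components_subset[OF l(2)] by auto
    note n = node_on_edge[OF G l(1) this ml m0]
    have "crossing_line G (g z) = m" by (rule crossing_line_eqI[OF n(1) ml[symmetric] n(2) m0 n(3,4)])
    then show "f (snd z) = f (crossing_line G (g z))" using em(1) by simp
  qed
  also have "\<dots> = (\<Prod>x\<in>B. f (crossing_line G x))" by (rule prod.reindex_bij_betw[OF g(1)])
  also have "\<dots> = (\<Prod>x\<in>nodes T \<inter> D. if x \<in> support G \<and> x \<notin> vertices G then f (crossing_line G x) else 1)"
    unfolding B_def using finite_nodes by (rule prod.inter_filter)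
  finally show ?thesis .
qed

lemma card_vertices:
  fixes a :: "'a::comm_monoid_mult"
  assumes G: "G \<subseteq> segments T D"
  shows "a ^ card {x \<in> vertices G \<inter> D. degree G x = n} =
    (\<Prod>x\<in>nodes T \<inter> D. if x \<in> vertices G \<and> degree G x = n then a else 1)"
proof -
  have "{x \<in> vertices G \<inter> D. degree G x = n} = {x \<in> nodes T \<inter> D. x \<in> vertices G \<and> degree G x = n}"
    using vertex_is_node[OF G] unfolding vertices_def by blast
  then show ?thesis using finite_nodes by (simp add: prod.inter_filter[symmetric])
qed

lemma support_nodes: "G \<subseteq> segments T D \<Longrightarrow> nodes T \<inter> support G = {x \<in> nodes T \<inter> D. x \<in> support G}"
  using frontier_support(2)[of G] frontier_nodes by blast

end

section \<open>The cells around a birth point\<close>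

context swept_window
begin

lemma node_graph_signed:
  assumes G: "G \<subseteq> segments T D" and x: "x \<in> D" "l1 \<noteq> l2" "signs x l1 = 0" "signs x l2 = 0"
    and \<eta>: "\<eta>1 = 1 \<or> \<eta>1 = -1" "\<eta>2 = 1 \<or> \<eta>2 = -1"
  defines "a \<equiv> stratum ((signs x)(l1 := \<eta>1)) \<in> G" and "b \<equiv> stratum ((signs x)(l1 := - \<eta>1)) \<in> G"
    and "c \<equiv> stratum ((signs x)(l2 := \<eta>2)) \<in> G" and "e \<equiv> stratum ((signs x)(l2 := - \<eta>2)) \<in> G"
  shows "degree G x = of_bool a + of_bool b + of_bool c + of_bool e"
    "x \<in> support G \<longleftrightarrow> a \<or> b \<or> c \<or> e"
    "x \<in> vertices G \<longleftrightarrow> (a \<or> b \<or> c \<or> e) \<and> \<not> (a \<and> b \<and> \<not> c \<and> \<not> e) \<and> \<not> (\<not> a \<and> \<not> b \<and> c \<and> e)"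
proof -
  define A B C E where "A \<longleftrightarrow> stratum ((signs x)(l1 := 1)) \<in> G" and "B \<longleftrightarrow> stratum ((signs x)(l1 := -1)) \<in> G"
    and "C \<longleftrightarrow> stratum ((signs x)(l2 := 1)) \<in> G" and "E \<longleftrightarrow> stratum ((signs x)(l2 := -1)) \<in> G"
  note graph = node_graph[OF G x, folded A_def B_def C_def E_def]
  have ab: "a = A \<and> b = B \<or> a = B \<and> b = A"
    using \<eta>(1) by (elim disjE) (simp_all add: a_def b_def A_def B_def)
  have ce: "c = C \<and> e = E \<or> c = E \<and> e = C"
    using \<eta>(2) by (elim disjE) (simp_all add: c_def e_def C_def E_def)
  show "degree G x = of_bool a + of_bool b + of_bool c + of_bool e"
    unfolding graph(1) using ab ce by (elim disjE) simp_all
  show "x \<in> support G \<longleftrightarrow> a \<or> b \<or> c \<or> e"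
    unfolding graph(2) using ab ce by blast
  show "x \<in> vertices G \<longleftrightarrow> (a \<or> b \<or> c \<or> e) \<and> \<not> (a \<and> b \<and> \<not> c \<and> \<not> e) \<and> \<not> (\<not> a \<and> \<not> b \<and> c \<and> e)"
    unfolding graph(3) using ab ce by blast
qed

lemma node_graph_of_signed:
  assumes x: "x \<in> D" "l1 \<noteq> l2" "signs x l1 = 0" "signs x l2 = 0"
    and e: "e = 1 \<or> e = -1" "\<eta> = 1 \<or> \<eta> = -1"
  shows "stratum ((signs x)(l1 := e)) \<in> graph_of \<kappa> \<longleftrightarrow>
    \<kappa> ((signs x)(l1 := e, l2 := \<eta>)) \<noteq> \<kappa> ((signs x)(l1 := e, l2 := - \<eta>))"
  using node_graph_of[OF x e(1), of \<kappa>] e(2) by auto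

lemma node_cells:
  assumes x: "x \<in> D" "l1 \<noteq> l2" "signs x l1 = 0" "signs x l2 = 0"
    and \<eta>: "\<eta>1 = 1 \<or> \<eta>1 = -1" "\<eta>2 = 1 \<or> \<eta>2 = -1"
  shows "(signs x)(l1 := \<eta>1, l2 := \<eta>2) \<in> cells"
  using update_cell[OF node_seg(1)[OF x \<eta>(1)], of \<eta>2] node_seg(4)[OF x \<eta>(1)] \<eta>(2) by auto

lemma birth_before_node:
  assumes x: "x \<in> D" "l1 \<noteq> l2" "signs x l1 = 0" "signs x l2 = 0" and \<eta>: "\<eta> = 1 \<or> \<eta> = -1"
  shows "h (birth ((signs x)(l1 := \<eta>, l2 := incoming x l2))) < h x"
proof -
  obtain y where y: "y \<in> D" "signs y = (signs x)(l2 := incoming x l2)" "h y < h x"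
    using exists_incoming[OF x] by blast
  have "signs y \<preceq> (signs x)(l1 := \<eta>, l2 := incoming x l2)"
    unfolding y(2) le_signs_def using x by auto
  moreover have "(signs x)(l1 := \<eta>, l2 := incoming x l2) \<in> signs ` D"
    using node_cells[OF x \<eta> incoming_values(1)] unfolding cells_def by blast
  ultimately have "h (birth ((signs x)(l1 := \<eta>, l2 := incoming x l2))) \<le> h y" using birth(3) y(1) by blast
  then show ?thesis using y(3) by simp
qed

definition near_cell :: "point set \<Rightarrow> point set \<Rightarrow> real" where
  "near_cell l = (signs (line_birth l))(l := signs origin l)"

text \<open>A short step from the minimum of l towards the origin enters this cell and lowers h, so
  the cell is born before l is reached.\<close>

lemma near_cell:
  assumes l: "l \<in> lines"
  shows "near_cell l \<in> cells" "h (birth (near_cell l)) < h (line_birth l)"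
proof -
  note b = line_birth[OF l]
  show c: "near_cell l \<in> cells"
    using update_cell[OF b(5), of "signs origin l"] b(6) origin_side[of l] unfolding near_cell_def by auto
  have ne: "line_birth l \<noteq> origin" using b(2) origin(3) unfolding cells_def by auto
  obtain t where t: "t > 0" "t < 1" "signs (line_birth l) \<preceq> signs ((1 - t) *\<^sub>R line_birth l + t *\<^sub>R origin)"
    "\<And>m. signs (line_birth l) m = 0 \<Longrightarrow> signs ((1 - t) *\<^sub>R line_birth l + t *\<^sub>R origin) m = signs origin m"
    using step_toward[OF b(1) origin(1)] by blast
  define u where "u = (1 - t) *\<^sub>R line_birth l + t *\<^sub>R origin"
  have "h u < max (h (line_birth l)) (h origin)"
    unfolding u_def using b(1) origin(1) ne t by (intro h_quasiconvex) auto
  then have hu: "h u < h (line_birth l)" using origin(2)[OF b(1)] by simp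
  have "signs u m = near_cell l m" for m
  proof (cases "m = l")
    case True
    then show ?thesis using t(4)[OF b(2)] unfolding u_def near_cell_def by simp
  next
    case False
    then have "signs (line_birth l) m \<noteq> 0" using line_of_seg[OF b(5)] b(6) by metis
    then show ?thesis using t(3) False unfolding u_def near_cell_def le_signs_def by (metis fun_upd_other)
  qed
  then have "signs u = near_cell l" ..
  moreover have "u \<in> D" unfolding u_def using D_combination b(1) origin(1) t by simp
  ultimately have "h (birth (near_cell l)) \<le> h u"
    using birth(3)[of "near_cell l" u] c unfolding cells_def by simp
  then show "h (birth (near_cell l)) < h (line_birth l)" using hu by simp
qed

lemma line_birth_in_graph_of:
  assumes l: "l \<in> lines"
  shows "stratum (signs (line_birth l)) \<in> graph_of \<kappa> \<longleftrightarrow> \<kappa> (near_cell l) \<noteq> \<kappa> (far_cell l)"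
  using stratum_in_graph_of[OF line_birth(5)[OF l], of \<kappa>] line_birth(6)[OF l] origin_side[of l]
  unfolding near_cell_def far_cell_def by auto

end

section \<open>Factorisation of the weight of a configuration\<close>

locale consistent_field = swept_window T D h for T D h +
  fixes \<pi> :: "point set \<Rightarrow> real" and k :: nat and \<alpha> :: real
  assumes activity: "l \<in> T \<Longrightarrow> 0 < \<pi> l \<and> \<pi> l < 1"
    and k: "k \<ge> 2" and \<alpha>: "0 \<le> \<alpha>" "\<alpha> \<le> 1"
begin

lemma node_activity_node:
  assumes x: "x \<in> D" "l1 \<noteq> l2" "signs x l1 = 0" "signs x l2 = 0"
  shows "node_activity T \<pi> x = \<pi> l1 * \<pi> l2" "{l. signs x l = 0} = {l1, l2}"
proof -
  show eq: "{l. signs x l = 0} = {l1, l2}" using no_three_zeros[OF x(1,3,4,2)] x by blast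
  have "{l \<in> T. x \<in> l} = {l. signs x l = 0}" using signs_zero_iff[OF x(1)] by blast
  then show "node_activity T \<pi> x = \<pi> l1 * \<pi> l2"
    unfolding node_activity_def eq using x(2) by simp
qed

text \<open>With q = (k - 2) / (k - 1), \<open>epsilon\<close> is the convex combination of \<alpha>
  and \<open>alpha_T\<close> with weights 1 - q and q, and both lie between 0 and 1.\<close>

lemma alpha_T_pos: "alpha_T k \<alpha> > 0" and epsilon_bounds: "0 \<le> epsilon k \<alpha>" "epsilon k \<alpha> \<le> 1"
proof -
  define q where "q = (real k - 2) / (real k - 1)"
  have q: "0 \<le> q" "q < 1" using k unfolding q_def by (auto simp: divide_simps)
  have r: "\<alpha> / (real k - 1) = (1 - q) * \<alpha>" using k unfolding q_def by (simp add: field_simps)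
  have "q * (1 - \<alpha>) \<le> q" using q \<alpha> by (intro mult_left_le) auto
  then have "q * (1 - \<alpha>) < 1" "q * (1 - \<alpha>) \<ge> 0" using q \<alpha> by auto
  then have T: "alpha_T k \<alpha> > 0" "alpha_T k \<alpha> \<le> 1"
    unfolding alpha_T_def alpha_X_def q_def[symmetric] by auto
  show "alpha_T k \<alpha> > 0" by fact
  have e: "epsilon k \<alpha> = (1 - q) * \<alpha> + q * alpha_T k \<alpha>" unfolding epsilon_def r q_def by simp
  show "0 \<le> epsilon k \<alpha>" unfolding e using q \<alpha> T by simp
  have "(1 - q) * \<alpha> + q * alpha_T k \<alpha> \<le> (1 - q) * 1 + q * 1"
    using q \<alpha> T by (intro add_mono mult_left_mono) auto
  then show "epsilon k \<alpha> \<le> 1" unfolding e by simp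
qed

lemma crossing_factor_pos: "l \<in> T \<Longrightarrow> 1 - epsilon k \<alpha> * \<pi> l > 0"
  using activity[of l] epsilon_bounds by (smt (verit) mult_left_le_one_le)

lemma node_factor_pos:
  assumes "x \<in> nodes T \<inter> D"
  shows "1 - \<alpha> / (real k - 1) * node_activity T \<pi> x > 0"
proof -
  obtain l1 l2 where x: "x \<in> D" "l1 \<noteq> l2" "signs x l1 = 0" "signs x l2 = 0"
    using assms by (rule node_obtain)
  then have p: "0 < \<pi> l1" "\<pi> l1 < 1" "0 < \<pi> l2" "\<pi> l2 < 1" using activity signs_zero_iff by auto
  then have "\<pi> l1 * \<pi> l2 < 1" by (metis mult_strict_mono' mult_1 less_imp_le)
  moreover have "\<alpha> / (real k - 1) \<le> 1" "\<alpha> / (real k - 1) \<ge> 0" using \<alpha> k by (auto simp: divide_simps)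
  ultimately show ?thesis unfolding node_activity_node(1)[OF x] using p
    by (smt (verit) mult_left_le_one_le mult_pos_pos)
qed

text \<open>Everything charged to a node: its vertex or crossing factor, its factor from the last
  sum of \<open>Phi\<close>, and for each segment born there 1 / (k - 1) if it starts an edge and
  the activity if it starts a primary edge.\<close>

definition node_weight :: "point set set \<Rightarrow> point \<Rightarrow> real" where
  "node_weight G x =
    (if x \<in> vertices G \<and> degree G x = 2 then \<alpha> else 1) *
    (if x \<in> vertices G \<and> degree G x = 3 then (real k - 1) * alpha_T k \<alpha> else 1) *
    (if x \<in> vertices G \<and> degree G x = 4 then (real k - 1) * alpha_X \<alpha> else 1) *
    (if x \<in> support G \<and> x \<notin> vertices G then 1 - epsilon k \<alpha> * \<pi> (crossing_line G x) else 1) *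
    (if x \<in> support G then inverse (1 - \<alpha> / (real k - 1) * node_activity T \<pi> x) else 1) *
    (\<Prod>l | signs x l = 0.
      (if (signs x)(l := - incoming x l) \<in> edge_starts G then 1 / (real k - 1) else 1) *
      (if (signs x)(l := - incoming x l) \<in> primary_edge_starts G
       then \<pi> (line_of_seg ((signs x)(l := - incoming x l))) else 1))"

text \<open>The segment at the minimum of a line is not born at a node, so when present it starts
  both an edge and a primary edge.\<close>

definition line_weight :: "point set set \<Rightarrow> point set \<Rightarrow> real" where
  "line_weight G l = (if stratum (signs (line_birth l)) \<in> G then 1 / (real k - 1) * \<pi> l else 1)"

lemma finite_edges: "G \<subseteq> segments T D \<Longrightarrow> finite (edges T G)"
  using edges_matching[of G] finite_segs bij_betw_finite
  unfolding edge_starts_def by (metis (no_types, lifting) finite_subset mem_Collect_eq subsetI)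

text \<open>If \<open>Phi\<close> is infinite, a power of \<alpha> or of
  \<open>(real k - 1) * alpha_X \<alpha>\<close> on the right vanishes. Otherwise all terms are
  finite and the exponential turns sums into products.\<close>

lemma exp_uminus_Phi:
  assumes G: "G \<subseteq> segments T D"
  shows "exp_uminus (Phi T \<pi> D k \<alpha> (G, c)) =
    \<alpha> ^ N_V D G * ((real k - 1) * alpha_T k \<alpha>) ^ N_T D G * ((real k - 1) * alpha_X \<alpha>) ^ N_X D G *
    (1 / (real k - 1)) ^ card (edges T G) *
    (\<Prod>e\<in>edges T G. \<Prod>l | l \<in> T \<and> l \<inter> e \<noteq> {} \<and> \<not> e \<subseteq> l. 1 - epsilon k \<alpha> * \<pi> l) *
    (\<Prod>x\<in>nodes T \<inter> support G. inverse (1 - \<alpha> / (real k - 1) * node_activity T \<pi> x))"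
proof -
  define A where "A = real (card (edges T G)) * ln (real k - 1)"
  define B where "B = (\<Sum>e\<in>edges T G. \<Sum>l | l \<in> T \<and> l \<inter> e \<noteq> {} \<and> \<not> e \<subseteq> l. ln (1 - epsilon k \<alpha> * \<pi> l))"
  define C where "C = (\<Sum>x\<in>nodes T \<inter> support G. ln (1 - \<alpha> / (real k - 1) * node_activity T \<pi> x))"
  have "exp (- A) = inverse ((real k - 1) ^ card (edges T G))"
    using k unfolding A_def by (simp add: exp_minus exp_of_nat_mult)
  then have A: "exp (- A) = (1 / (real k - 1)) ^ card (edges T G)"
    by (simp add: power_inverse inverse_eq_divide power_one_over)
  have B: "exp B = (\<Prod>e\<in>edges T G. \<Prod>l | l \<in> T \<and> l \<inter> e \<noteq> {} \<and> \<not> e \<subseteq> l. 1 - epsilon k \<alpha> * \<pi> l)"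
    unfolding B_def exp_sum[OF finite_edges[OF G]]
    using crossing_factor_pos by (intro prod.cong refl exp_sum_ln) auto
  have "exp C = (\<Prod>x\<in>nodes T \<inter> support G. 1 - \<alpha> / (real k - 1) * node_activity T \<pi> x)"
    unfolding C_def support_nodes[OF G] by (intro exp_sum_ln node_factor_pos) blast
  then have C: "exp (- C) = (\<Prod>x\<in>nodes T \<inter> support G. inverse (1 - \<alpha> / (real k - 1) * node_activity T \<pi> x))"
    by (simp add: exp_minus prod_inversef[symmetric] o_def)
  define v where "v = ereal (real (N_V D G)) * ln_ereal \<alpha>"
  define t where "t = ereal (real (N_T D G)) * ln_ereal ((real k - 1) * alpha_T k \<alpha>)"
  define x where "x = ereal (real (N_X D G)) * ln_ereal ((real k - 1) * alpha_X \<alpha>)"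
  have Phi: "Phi T \<pi> D k \<alpha> (G, c) = - v - t - x + ereal A - ereal B + ereal C"
    unfolding Phi_def A_def B_def C_def v_def t_def x_def by simp
  have v: "v = -\<infinity> \<and> \<alpha> ^ N_V D G = 0 \<or> (\<exists>r. v = ereal r \<and> exp r = \<alpha> ^ N_V D G)"
    unfolding v_def using \<alpha> by (intro ereal_times_ln_ereal)
  have "(real k - 1) * alpha_T k \<alpha> > 0" using k alpha_T_pos by simp
  then have t: "\<exists>r. t = ereal r \<and> exp r = ((real k - 1) * alpha_T k \<alpha>) ^ N_T D G"
    using ereal_times_ln_ereal[of "(real k - 1) * alpha_T k \<alpha>" "N_T D G"] unfolding t_def by auto
  have x: "x = -\<infinity> \<and> ((real k - 1) * alpha_X \<alpha>) ^ N_X D G = 0 \<or>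
      (\<exists>r. x = ereal r \<and> exp r = ((real k - 1) * alpha_X \<alpha>) ^ N_X D G)"
    unfolding x_def using \<alpha> k by (intro ereal_times_ln_ereal) (simp add: alpha_X_def)
  obtain rt where rt: "t = ereal rt" "exp rt = ((real k - 1) * alpha_T k \<alpha>) ^ N_T D G" using t by blast
  show ?thesis
  proof (cases "v = -\<infinity> \<or> x = -\<infinity>")
    case True
    then have "\<alpha> ^ N_V D G * ((real k - 1) * alpha_X \<alpha>) ^ N_X D G = 0" using v x by auto
    moreover have "Phi T \<pi> D k \<alpha> (G, c) = \<infinity>"
      unfolding Phi rt using True v x by auto
    ultimately show ?thesis unfolding exp_uminus_def by auto
  next
    case False
    then obtain rv rx where rv: "v = ereal rv" "exp rv = \<alpha> ^ N_V D G"
      and rx: "x = ereal rx" "exp rx = ((real k - 1) * alpha_X \<alpha>) ^ N_X D G" using v x by blast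
    have "exp_uminus (Phi T \<pi> D k \<alpha> (G, c)) = exp (rv + rt + rx + - A + B + - C)"
      unfolding Phi rv rt rx exp_uminus_def by (simp add: algebra_simps)
    also have "\<dots> = exp rv * exp rt * exp rx * exp (- A) * exp B * exp (- C)" by (simp only: exp_add)
    finally show ?thesis unfolding rv(2) rt(2) rx(2) A B C .
  qed
qed

lemma prod_primary_edges:
  assumes G: "G \<subseteq> segments T D"
  shows "(\<Prod>e\<in>primary_edges T G. \<pi> (line_of T e)) =
    (\<Prod>v\<in>segs. if v \<in> primary_edge_starts G then \<pi> (line_of_seg v) else 1)"
proof -
  obtain g where g: "bij_betw g (primary_edges T G) (primary_edge_starts G)"
    "\<And>e. e \<in> primary_edges T G \<Longrightarrow> stratum (g e) \<subseteq> e"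
    using primary_edges_matching[OF G] by blast
  have "line_of T e = line_of_seg (g e)" if e: "e \<in> primary_edges T G" for e
  proof -
    obtain l where l: "l \<in> T" "e \<subseteq> l" using e by (rule primary_edges_line)
    have s: "g e \<in> segs" using g(1) e unfolding bij_betw_def primary_edge_starts_def by blast
    have eq: "m = line_of_seg (g e)" if "m \<in> T \<and> e \<subseteq> m" for m
      using subset_line_iff[OF s, of m] line_of_seg[OF s, of m] that g(2)[OF e] by blast
    then have "l = line_of_seg (g e)" using l by blast
    then show ?thesis unfolding line_of_def using l eq by (intro the_equality) auto
  qed
  then have "(\<Prod>e\<in>primary_edges T G. \<pi> (line_of T e)) = (\<Prod>e\<in>primary_edges T G. \<pi> (line_of_seg (g e)))"
    by simp
  also have "\<dots> = (\<Prod>v\<in>primary_edge_starts G. \<pi> (line_of_seg v))" by (rule prod.reindex_bij_betw[OF g(1)])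
  also have "primary_edge_starts G = {v \<in> segs. v \<in> primary_edge_starts G}"
    unfolding primary_edge_starts_def by blast
  also have "(\<Prod>v\<in>{v \<in> segs. v \<in> primary_edge_starts G}. \<pi> (line_of_seg v)) =
      (\<Prod>v\<in>segs. if v \<in> primary_edge_starts G then \<pi> (line_of_seg v) else 1)"
    by (rule prod.inter_filter[OF finite_segs])
  finally show ?thesis .
qed

lemma power_card_edges:
  fixes a :: real
  assumes G: "G \<subseteq> segments T D"
  shows "a ^ card (edges T G) = (\<Prod>v\<in>segs. if v \<in> edge_starts G then a else 1)"
proof -
  have "card (edges T G) = card {v \<in> segs. v \<in> edge_starts G}"
    using edges_matching[OF G] bij_betw_same_card unfolding edge_starts_def
    by (metis (no_types, lifting) Collect_cong mem_Collect_eq)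
  then show ?thesis using prod.inter_filter[OF finite_segs, of "\<lambda>_. a" "\<lambda>v. v \<in> edge_starts G"] by simp
qed

text \<open>The factors of edges and primary edges pass to their starting segments, which
  \<open>prod_segs\<close> distributes over the birth points. The remaining factors are products
  over nodes by \<open>card_vertices\<close>, \<open>prod_crossings\<close> and
  \<open>support_nodes\<close>.\<close>

lemma configuration_weight:
  assumes G: "G \<subseteq> segments T D"
  shows "exp_uminus (Phi T \<pi> D k \<alpha> (G, c)) * (\<Prod>e\<in>primary_edges T G. \<pi> (line_of T e)) =
    (\<Prod>l\<in>lines. line_weight G l) * (\<Prod>x\<in>nodes T \<inter> D. node_weight G x)"
proof -
  define f where "f v = (if v \<in> edge_starts G then 1 / (real k - 1) else 1) *
    (if v \<in> primary_edge_starts G then \<pi> (line_of_seg v) else 1)" for v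
  have "(1 / (real k - 1)) ^ card (edges T G) * (\<Prod>e\<in>primary_edges T G. \<pi> (line_of T e)) = (\<Prod>v\<in>segs. f v)"
    unfolding f_def prod.distrib power_card_edges[OF G] prod_primary_edges[OF G] ..
  also have "\<dots> = (\<Prod>l\<in>lines. f (signs (line_birth l))) *
      (\<Prod>x\<in>nodes T \<inter> D. \<Prod>l | signs x l = 0. f ((signs x)(l := - incoming x l)))"
    by (rule prod_segs)
  also have "(\<Prod>l\<in>lines. f (signs (line_birth l))) = (\<Prod>l\<in>lines. line_weight G l)"
    by (rule prod.cong[OF refl])
      (simp add: f_def line_weight_def edge_starts_def primary_edge_starts_def line_birth)
  finally have fw: "(1 / (real k - 1)) ^ card (edges T G) * (\<Prod>e\<in>primary_edges T G. \<pi> (line_of T e)) =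
    (\<Prod>l\<in>lines. line_weight G l) *
      (\<Prod>x\<in>nodes T \<inter> D. \<Prod>l | signs x l = 0. f ((signs x)(l := - incoming x l)))" .
  have "exp_uminus (Phi T \<pi> D k \<alpha> (G, c)) * (\<Prod>e\<in>primary_edges T G. \<pi> (line_of T e)) =
    \<alpha> ^ N_V D G * ((real k - 1) * alpha_T k \<alpha>) ^ N_T D G * ((real k - 1) * alpha_X \<alpha>) ^ N_X D G *
    (\<Prod>e\<in>edges T G. \<Prod>l | l \<in> T \<and> l \<inter> e \<noteq> {} \<and> \<not> e \<subseteq> l. 1 - epsilon k \<alpha> * \<pi> l) *
    (\<Prod>x\<in>nodes T \<inter> support G. inverse (1 - \<alpha> / (real k - 1) * node_activity T \<pi> x)) *
    ((1 / (real k - 1)) ^ card (edges T G) * (\<Prod>e\<in>primary_edges T G. \<pi> (line_of T e)))"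
    unfolding exp_uminus_Phi[OF G] by (simp only: mult_ac)
  also have "\<dots> = (\<Prod>l\<in>lines. line_weight G l) * (\<Prod>x\<in>nodes T \<inter> D. node_weight G x)"
    unfolding fw node_weight_def f_def[symmetric] prod.distrib N_V_def N_T_def N_X_def card_vertices[OF G]
      prod_crossings[OF G finite_edges[OF G]] support_nodes[OF G] prod.inter_filter[OF finite_nodes]
    by (simp only: mult_ac)
  finally show ?thesis .
qed

text \<open>The colouring enters only through the four cells that meet at the node. This locality is
  what the summation over colours relies on.\<close>

lemma node_weight_eq:
  assumes x: "x \<in> D" "l1 \<noteq> l2" "signs x l1 = 0" "signs x l2 = 0"
  shows "node_weight (graph_of \<kappa>) x = local_weight k \<alpha> (\<pi> l1) (\<pi> l2)
    (\<kappa> ((signs x)(l1 := incoming x l1, l2 := incoming x l2)) \<noteq> \<kappa> ((signs x)(l1 := - incoming x l1, l2 := incoming x l2)))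
    (\<kappa> ((signs x)(l1 := incoming x l1, l2 := incoming x l2)) \<noteq> \<kappa> ((signs x)(l1 := incoming x l1, l2 := - incoming x l2)))
    (\<kappa> ((signs x)(l1 := incoming x l1, l2 := - incoming x l2)) \<noteq> \<kappa> (outgoing_cell x))
    (\<kappa> ((signs x)(l1 := - incoming x l1, l2 := incoming x l2)) \<noteq> \<kappa> (outgoing_cell x))"
proof -
  let ?G = "graph_of \<kappa>"
  note G = graph_of_segments[of \<kappa>]
  note x' = x(1) x(2)[symmetric] x(4,3)
  define i1 i2 o1 o2 where "i1 \<longleftrightarrow> stratum ((signs x)(l2 := incoming x l2)) \<in> ?G"
    and "i2 \<longleftrightarrow> stratum ((signs x)(l1 := incoming x l1)) \<in> ?G"
    and "o1 \<longleftrightarrow> stratum ((signs x)(l2 := - incoming x l2)) \<in> ?G"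
    and "o2 \<longleftrightarrow> stratum ((signs x)(l1 := - incoming x l1)) \<in> ?G"
  have tw: "(signs x)(l2 := a, l1 := b) = (signs x)(l1 := b, l2 := a)" for a b
    using x(2) by (rule fun_upd_twist[symmetric])
  note inc1 = incoming_values(1)[of x l1] and inc2 = incoming_values(1)[of x l2]
    and out1 = incoming_values(2)[of x l1] and out2 = incoming_values(2)[of x l2]
  have colours: "\<kappa> ((signs x)(l1 := incoming x l1, l2 := incoming x l2)) \<noteq> \<kappa> ((signs x)(l1 := - incoming x l1, l2 := incoming x l2)) \<longleftrightarrow> i1"
    "\<kappa> ((signs x)(l1 := incoming x l1, l2 := incoming x l2)) \<noteq> \<kappa> ((signs x)(l1 := incoming x l1, l2 := - incoming x l2)) \<longleftrightarrow> i2"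
    "\<kappa> ((signs x)(l1 := incoming x l1, l2 := - incoming x l2)) \<noteq> \<kappa> (outgoing_cell x) \<longleftrightarrow> o1"
    "\<kappa> ((signs x)(l1 := - incoming x l1, l2 := incoming x l2)) \<noteq> \<kappa> (outgoing_cell x) \<longleftrightarrow> o2"
    unfolding i1_def i2_def o1_def o2_def outgoing_cell_eq[OF x]
      node_graph_of_signed[OF x inc1 inc2] node_graph_of_signed[OF x out1 inc2]
      node_graph_of_signed[OF x' inc2 inc1] node_graph_of_signed[OF x' out2 inc1] tw
    by (rule refl)+
  note graph = node_graph_signed[OF G x inc1 inc2, folded i1_def i2_def o1_def o2_def]
  have cross1: "crossing_line ?G x = l2" if "i1" "o1" "\<not> i2" "\<not> o2"
    using that inc1 inc2 unfolding i1_def i2_def o1_def o2_def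
    by (intro crossing_line_eqI[OF x]) auto
  have cross2: "crossing_line ?G x = l1" if "i2" "o2" "\<not> i1" "\<not> o1"
    using that inc1 inc2 unfolding i1_def i2_def o1_def o2_def
    by (intro crossing_line_eqI[OF x']) auto
  have xn: "x \<in> nodes T" using nodes_iff[OF x(1)] x by blast
  have seg1: "(signs x)(l2 := - incoming x l2) \<in> segs" "line_of_seg ((signs x)(l2 := - incoming x l2)) = l1"
    using node_seg(1,4)[OF x' out2] by auto
  have seg2: "(signs x)(l1 := - incoming x l1) \<in> segs" "line_of_seg ((signs x)(l1 := - incoming x l1)) = l2"
    using node_seg(1,4)[OF x out1] by auto
  have es1: "(signs x)(l2 := - incoming x l2) \<in> edge_starts ?G \<longleftrightarrow> o1 \<and> x \<in> vertices ?G"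
    "(signs x)(l2 := - incoming x l2) \<in> primary_edge_starts ?G \<longleftrightarrow> o1 \<and> \<not> i1"
    unfolding edge_starts_def primary_edge_starts_def mem_Collect_eq birth_outgoing_seg[OF x] preceding_outgoing[OF x]
    using seg1 xn by (auto simp: i1_def o1_def)
  have es2: "(signs x)(l1 := - incoming x l1) \<in> edge_starts ?G \<longleftrightarrow> o2 \<and> x \<in> vertices ?G"
    "(signs x)(l1 := - incoming x l1) \<in> primary_edge_starts ?G \<longleftrightarrow> o2 \<and> \<not> i2"
    unfolding edge_starts_def primary_edge_starts_def mem_Collect_eq birth_outgoing_seg[OF x'] preceding_outgoing[OF x']
    using seg2 xn by (auto simp: i2_def o2_def)
  have pr: "(\<Prod>l | signs x l = 0. f l) = f l1 * f l2" for f :: "point set \<Rightarrow> real"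
    unfolding node_activity_node(2)[OF x] using x(2) by simp
  show ?thesis
    unfolding colours node_weight_def pr es1 es2 seg1(2) seg2(2) node_activity_node(1)[OF x] graph
    using cross1 cross2
    by (cases i1; cases i2; cases o1; cases o2) (simp_all add: local_weight_def)
qed

lemma line_weight_eq:
  assumes "l \<in> lines"
  shows "line_weight (graph_of \<kappa>) l = (if \<kappa> (near_cell l) \<noteq> \<kappa> (far_cell l) then 1 / (real k - 1) * \<pi> l else 1)"
  unfolding line_weight_def line_birth_in_graph_of[OF assms] ..

text \<open>Attaches the weight of a line or node to the cell born there, so that factors and
  summation variables share the index set \<open>cells\<close>.\<close>

definition cell_weight :: "(point set \<Rightarrow> real) \<Rightarrow> ((point set \<Rightarrow> real) \<Rightarrow> nat) \<Rightarrow> real" where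
  "cell_weight v \<kappa> = (if v = signs origin then 1
     else if birth v \<in> nodes T then node_weight (graph_of \<kappa>) (birth v)
     else line_weight (graph_of \<kappa>) (line_of_seg (signs (birth v))))"

definition total_weight :: "(point set \<Rightarrow> real) \<Rightarrow> real" where
  "total_weight v = (if v = signs origin then real k
     else if birth v \<in> nodes T then inverse (1 - \<alpha> / (real k - 1) * node_activity T \<pi> (birth v))
     else 1 + \<pi> (line_of_seg (signs (birth v))))"

lemma cell_weight_simps:
  "cell_weight (signs origin) \<kappa> = 1"
  "l \<in> lines \<Longrightarrow> cell_weight (far_cell l) \<kappa> = line_weight (graph_of \<kappa>) l"
  "x \<in> nodes T \<inter> D \<Longrightarrow> cell_weight (outgoing_cell x) \<kappa> = node_weight (graph_of \<kappa>) x"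
  unfolding cell_weight_def
  using far_cell_not_origin birth_far_cell line_birth(4,6) outgoing_cell_not_origin birth_outgoing_cell_node by auto

lemma total_weight_simps:
  "total_weight (signs origin) = real k"
  "l \<in> lines \<Longrightarrow> total_weight (far_cell l) = 1 + \<pi> l"
  "x \<in> nodes T \<inter> D \<Longrightarrow> total_weight (outgoing_cell x) = inverse (1 - \<alpha> / (real k - 1) * node_activity T \<pi> x)"
  unfolding total_weight_def
  using far_cell_not_origin birth_far_cell line_birth(4,6) outgoing_cell_not_origin birth_outgoing_cell_node by auto

lemma node_cells_before:
  assumes x: "x \<in> D" "l1 \<noteq> l2" "signs x l1 = 0" "signs x l2 = 0"
  shows "(signs x)(l1 := incoming x l1, l2 := incoming x l2) \<in> cells"
    "(signs x)(l1 := - incoming x l1, l2 := incoming x l2) \<in> cells"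
    "(signs x)(l1 := incoming x l1, l2 := - incoming x l2) \<in> cells"
    "h (birth ((signs x)(l1 := incoming x l1, l2 := incoming x l2))) < h x"
    "h (birth ((signs x)(l1 := - incoming x l1, l2 := incoming x l2))) < h x"
    "h (birth ((signs x)(l1 := incoming x l1, l2 := - incoming x l2))) < h x"
proof -
  note inc1 = incoming_values(1)[of x l1] and inc2 = incoming_values(1)[of x l2]
    and out1 = incoming_values(2)[of x l1] and out2 = incoming_values(2)[of x l2]
  show "(signs x)(l1 := incoming x l1, l2 := incoming x l2) \<in> cells"
    "(signs x)(l1 := - incoming x l1, l2 := incoming x l2) \<in> cells"
    "(signs x)(l1 := incoming x l1, l2 := - incoming x l2) \<in> cells"
    using node_cells[OF x] inc1 inc2 out1 out2 by blast+
  show "h (birth ((signs x)(l1 := incoming x l1, l2 := incoming x l2))) < h x"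
    "h (birth ((signs x)(l1 := - incoming x l1, l2 := incoming x l2))) < h x"
    using birth_before_node[OF x] inc1 out1 by blast+
  have "h (birth ((signs x)(l2 := - incoming x l2, l1 := incoming x l1))) < h x"
    by (rule birth_before_node[OF x(1) x(2)[symmetric] x(4,3) out2])
  then show "h (birth ((signs x)(l1 := incoming x l1, l2 := - incoming x l2))) < h x"
    using fun_upd_twist[OF x(2)] by metis
qed

text \<open>The dependence condition of \<open>sum_PiE_triangular\<close>: the other cells around a
  birth point that enter the weight were born strictly earlier.\<close>

lemma cell_weight_local:
  assumes v: "v \<in> cells" and eq: "\<And>w. w \<in> cells \<Longrightarrow> w = v \<or> h (birth w) < h (birth v) \<Longrightarrow> \<kappa> w = \<mu> w"
  shows "cell_weight v \<kappa> = cell_weight v \<mu>"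
  using cell_birth_cases[OF v]
proof (elim disjE bexE)
  assume "v = signs origin"
  then show ?thesis by (simp add: cell_weight_simps)
next
  fix l assume l: "l \<in> lines" "v = far_cell l"
  have "\<kappa> (near_cell l) = \<mu> (near_cell l)" "\<kappa> (far_cell l) = \<mu> (far_cell l)"
    using eq near_cell[OF l(1)] birth_far_cell[OF l(1)] v unfolding l(2) by auto
  then show ?thesis unfolding l(2) cell_weight_simps(2)[OF l(1)] line_weight_eq[OF l(1)] by simp
next
  fix x assume x: "x \<in> nodes T \<inter> D" "v = outgoing_cell x"
  obtain l1 l2 where n: "x \<in> D" "l1 \<noteq> l2" "signs x l1 = 0" "signs x l2 = 0"
    using x(1) by (rule node_obtain)
  note b = node_cells_before[OF n]
  have bx: "birth v = x" unfolding x(2) by (rule birth_outgoing_cell_node[OF x(1)])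
  note e = eq[OF b(1) disjI2, unfolded bx, OF b(4)] eq[OF b(2) disjI2, unfolded bx, OF b(5)]
    eq[OF b(3) disjI2, unfolded bx, OF b(6)] eq[OF v disjI1[OF refl], unfolded x(2)]
  show ?thesis
    unfolding x(2) cell_weight_simps(3)[OF x(1)] node_weight_eq[OF n] e ..
qed

text \<open>The colour of the origin cell is free; beyond a line all colours but that of the near
  cell weigh the same; at a node the sum is \<open>sum_local_weight\<close>.\<close>

lemma sum_cell_weight:
  assumes v: "v \<in> cells" and \<kappa>: "\<And>w. w \<in> cells \<Longrightarrow> h (birth w) < h (birth v) \<Longrightarrow> \<kappa> w \<in> {1..k}"
  shows "(\<Sum>c\<in>{1..k}. cell_weight v (\<kappa>(v := c))) = total_weight v"
  using cell_birth_cases[OF v]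
proof (elim disjE bexE)
  assume "v = signs origin"
  then show ?thesis by (simp add: cell_weight_simps total_weight_simps)
next
  fix l assume l: "l \<in> lines" "v = far_cell l"
  have h: "h (birth (near_cell l)) < h (birth v)"
    using near_cell(2)[OF l(1)] birth_far_cell[OF l(1)] unfolding l(2) by simp
  then have n: "near_cell l \<noteq> v" "\<kappa> (near_cell l) \<in> {1..k}" using \<kappa> near_cell(1)[OF l(1)] by auto
  have "(\<Sum>c\<in>{1..k}. cell_weight v (\<kappa>(v := c))) =
      (\<Sum>c\<in>{1..k}. if \<kappa> (near_cell l) \<noteq> c then 1 / (real k - 1) * \<pi> l else 1)"
    using n unfolding l(2) cell_weight_simps(2)[OF l(1)] line_weight_eq[OF l(1)] by simp
  also have "\<dots> = 1 + (real (card {1..k}) - 1) * (1 / (real k - 1) * \<pi> l)"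
    using n(2) by (subst sum_except_one[of _ "\<kappa> (near_cell l)" _ "1 / (real k - 1) * \<pi> l"]) auto
  also have "\<dots> = 1 + \<pi> l" using k by simp
  finally show ?thesis unfolding l(2) total_weight_simps(2)[OF l(1)] .
next
  fix x assume x: "x \<in> nodes T \<inter> D" "v = outgoing_cell x"
  obtain l1 l2 where n: "x \<in> D" "l1 \<noteq> l2" "signs x l1 = 0" "signs x l2 = 0"
    using x(1) by (rule node_obtain)
  note b = node_cells_before[OF n]
  have bx: "birth v = x" unfolding x(2) by (rule birth_outgoing_cell_node[OF x(1)])
  have mem: "w \<noteq> v" "\<kappa> w \<in> {1..k}" if "w \<in> cells" "h (birth w) < h x" for w
    using \<kappa>[OF that(1)] that(2) bx by auto
  have p: "0 < \<pi> l1" "\<pi> l1 < 1" "0 < \<pi> l2" "\<pi> l2 < 1" using activity n signs_zero_iff by auto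
  have upd: "(\<kappa>(v := c)) w = \<kappa> w" if "w \<in> cells" "h (birth w) < h x" for w c
    using mem(1)[OF that] by simp
  have updv: "(\<kappa>(v := c)) (outgoing_cell x) = c" for c unfolding x(2) by simp
  have cw: "cell_weight v (\<kappa>(v := c)) = node_weight (graph_of (\<kappa>(v := c))) x" for c
    unfolding x(2) by (rule cell_weight_simps(3)[OF x(1)])
  show ?thesis
    unfolding cw node_weight_eq[OF n] upd[OF b(1,4)] upd[OF b(2,5)] upd[OF b(3,6)] updv
      sum_local_weight[OF k \<alpha> p mem(2)[OF b(1,4)] mem(2)[OF b(2,5)] mem(2)[OF b(3,6)]]
    unfolding x(2) total_weight_simps(3)[OF x(1)] node_activity_node(1)[OF n] ..
qed

lemma partition_function_eq:
  "partition_function T \<pi> D k \<alpha> = real k * (\<Prod>l | l \<in> T \<and> l \<inter> D \<noteq> {}. 1 + \<pi> l) *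
    (\<Prod>x\<in>nodes T \<inter> D. inverse (1 - \<alpha> / (real k - 1) * node_activity T \<pi> x))"
proof -
  have "partition_function T \<pi> D k \<alpha> =
      (\<Sum>\<kappa>\<in>cells \<rightarrow>\<^sub>E {1..k}. exp_uminus (Phi T \<pi> D k \<alpha> (configuration_of \<kappa>)) *
        (\<Prod>e\<in>primary_edges T (fst (configuration_of \<kappa>)). \<pi> (line_of T e)))"
    unfolding partition_function_def
    by (rule sum.reindex_bij_betw[OF bij_betw_configuration_of, symmetric])
  also have "\<dots> = (\<Sum>\<kappa>\<in>cells \<rightarrow>\<^sub>E {1..k}. (\<Prod>l\<in>lines. line_weight (graph_of \<kappa>) l) *
      (\<Prod>x\<in>nodes T \<inter> D. node_weight (graph_of \<kappa>) x))"
    unfolding configuration_of_def fst_conv configuration_weight[OF graph_of_segments] ..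
  also have "\<dots> = (\<Sum>\<kappa>\<in>cells \<rightarrow>\<^sub>E {1..k}. \<Prod>v\<in>cells. cell_weight v \<kappa>)"
    by (simp add: prod_cells cell_weight_simps)
  \<comment> \<open>Cells born at equal height do not interfere, since a weight involves besides its
    own cell only strictly earlier ones.\<close>
  also have "\<dots> = (\<Prod>v\<in>cells. total_weight v)"
    by (rule sum_PiE_triangular[OF finite_cells, where b = "\<lambda>v. h (birth v)"])
      (use cell_weight_local sum_cell_weight in blast)+
  also have "\<dots> = real k * (\<Prod>l\<in>lines. 1 + \<pi> l) *
    (\<Prod>x\<in>nodes T \<inter> D. inverse (1 - \<alpha> / (real k - 1) * node_activity T \<pi> x))"
    by (simp add: prod_cells total_weight_simps)
  finally show ?thesis unfolding lines_def .
qed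

end

theorem corollary1:
  fixes T :: "point set set" and \<pi> :: "point set \<Rightarrow> real" and D :: "point set"
    and k :: nat and \<alpha>\<^sub>V :: real
  assumes "regular_linear_tessellation T"
    and "\<And>l. l \<in> T \<Longrightarrow> 0 < \<pi> l \<and> \<pi> l < 1"
    and "window T D"
    and "k \<ge> 2"
    and "0 \<le> \<alpha>\<^sub>V" and "\<alpha>\<^sub>V \<le> 1"
  shows "partition_function T \<pi> D k \<alpha>\<^sub>V =
    real k * (\<Prod>l | l \<in> T \<and> l \<inter> D \<noteq> {}. 1 + \<pi> l) *
    (\<Prod>x\<in>nodes T \<inter> D. inverse (1 - \<alpha>\<^sub>V / (real k - 1) * node_activity T \<pi> x))"
proof -
  interpret tessellated_window T D using assms by unfold_locales
  \<comment> \<open>The sweep function is an auxiliary choice: the identity to be proved does not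
    mention it.\<close>
  obtain h :: "point \<Rightarrow> real" where h:
    "\<forall>x y t. x \<in> D \<longrightarrow> y \<in> D \<longrightarrow> x \<noteq> y \<longrightarrow> 0 < t \<longrightarrow> t < 1 \<longrightarrow>
       h ((1 - t) *\<^sub>R x + t *\<^sub>R y) < max (h x) (h y)"
    "\<forall>C. closed C \<longrightarrow> C \<inter> D \<noteq> {} \<longrightarrow> (\<exists>x\<in>C \<inter> D. \<forall>y\<in>C \<inter> D. h x \<le> h y)"
    "\<forall>x\<in>nodes T \<inter> D. \<forall>l\<in>T. x \<in> l \<longrightarrow> (\<exists>y\<in>l \<inter> D. h y < h x)"
    "\<exists>q\<in>D. \<forall>l\<in>T. \<forall>y\<in>l \<inter> D. h q < h y"
    using exists_sweep by (elim exE conjE)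
  interpret consistent_field T D h \<pi> k \<alpha>\<^sub>V
    by unfold_locales (fact assms h(4) | rule h(1)[rule_format] h(2)[rule_format] h(3)[rule_format] assms(2); assumption)+
  show ?thesis by (rule partition_function_eq)
qed

end
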